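(* Let $(X,r)$ be a finite bijective left non-degenerate solution of the Yang--Baxter equation. Let $M=M(X,r)$. If $K$ is a field then there exists an inclusion preserving bijection between the set of prime ideals $P$ of $K[M]$ satisfying $P\cap M=\varnothing$ and the set of all prime ideals of the group algebra $K[G]$, where $G$ is the group with presentation $$G=G(X,r)=\operatorname{gr}(X\mid xy=\lambda_x(y)\rho_y(x)\text{ for all }x,y\in X).$$ Moreover, the cancellative monoid $\overline M=M/\eta_M$ has a group of quotients, which is equal to the central localization $\overline M\langle z\rangle^{-1}$ for some $z\in\mathrm Z(\overline M)$, and $G\cong\overline M\langle z\rangle^{-1}$.
   Context: Let $X$ be a non-empty set. A (set-theoretic) solution of the Yang--Baxter equation is a pair $(X,r)$ with $r\colon X\times X\to X\times X$, written $r(x,y)=(\lambda_x(y),\rho_y(x))$, such that $(r\times\mathrm{id})(\mathrm{id}\times r)(r\times\mathrm{id})=(\mathrm{id}\times r)(r\times\mathrm{id})(\mathrm{id}\times r)$. It is finite if $X$ is finite, bijective if $r$ is bijective, left non-degenerate if every $\lambda_x\colon X\to X$ is bijective. The structure monoid is $M(X,r)=\langle X\mid xy=\lambda_x(y)\rho_y(x)\text{ for all }x,y\in X\rangle$, and $K[M]$ is its monoid algebra. $\eta_M=\{(x,y)\in M\times M: xz=yz\text{ for some }z\in M\}$ is the cancellative congruence of $M$ (the smallest congruence with cancellative quotient). $\mathrm Z(\cdot)$ denotes the center, $\overline M\langle z\rangle^{-1}$ the localization of $\overline M$ at the submonoid $\langle z\rangle$ generated by the central element $z$. *)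

theory Defs
  imports "HOL-Algebra.Ideal_Product"
begin

section \<open>Set-theoretic solutions of the Yang--Baxter equation\<close>

definition ybe_lam :: "('x \<times> 'x \<Rightarrow> 'x \<times> 'x) \<Rightarrow> 'x \<Rightarrow> 'x \<Rightarrow> 'x"
  where "ybe_lam r x y = fst (r (x, y))"

text \<open>The argument order follows \<open>r (x, y) = (\<lambda>\<^sub>x(y), \<rho>\<^sub>y(x))\<close>.\<close>

definition ybe_rho :: "('x \<times> 'x \<Rightarrow> 'x \<times> 'x) \<Rightarrow> 'x \<Rightarrow> 'x \<Rightarrow> 'x"
  where "ybe_rho r y x = snd (r (x, y))"

text \<open>The maps \<open>r \<times> id\<close> and \<open>id \<times> r\<close> on triples.\<close>

definition ybe_r12 :: "('x \<times> 'x \<Rightarrow> 'x \<times> 'x) \<Rightarrow> 'x \<times> 'x \<times> 'x \<Rightarrow> 'x \<times> 'x \<times> 'x"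
  where "ybe_r12 r = (\<lambda>(x, y, z). (fst (r (x, y)), snd (r (x, y)), z))"

definition ybe_r23 :: "('x \<times> 'x \<Rightarrow> 'x \<times> 'x) \<Rightarrow> 'x \<times> 'x \<times> 'x \<Rightarrow> 'x \<times> 'x \<times> 'x"
  where "ybe_r23 r = (\<lambda>(x, y, z). (x, r (y, z)))"

locale ybe_solution =
  fixes X :: "'x set" and r :: "'x \<times> 'x \<Rightarrow> 'x \<times> 'x"
  assumes nonempty: "X \<noteq> {}"
    and r_closed: "r \<in> X \<times> X \<rightarrow> X \<times> X"
    and yang_baxter: "\<And>t. t \<in> X \<times> X \<times> X \<Longrightarrow>
          (ybe_r12 r \<circ> ybe_r23 r \<circ> ybe_r12 r) t = (ybe_r23 r \<circ> ybe_r12 r \<circ> ybe_r23 r) t"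

definition ybe_bijective :: "'x set \<Rightarrow> ('x \<times> 'x \<Rightarrow> 'x \<times> 'x) \<Rightarrow> bool"
  where "ybe_bijective X r \<longleftrightarrow> bij_betw r (X \<times> X) (X \<times> X)"

definition ybe_left_nondegenerate :: "'x set \<Rightarrow> ('x \<times> 'x \<Rightarrow> 'x \<times> 'x) \<Rightarrow> bool"
  where "ybe_left_nondegenerate X r \<longleftrightarrow> (\<forall>x\<in>X. bij_betw (ybe_lam r x) X X)"


section \<open>Congruences, quotient monoids and presentations\<close>

definition congruence :: "('a, 'b) monoid_scheme \<Rightarrow> ('a \<times> 'a) set \<Rightarrow> bool"
  where "congruence M E \<longleftrightarrow> equiv (carrier M) E \<and>
    (\<forall>a b c d. (a, b) \<in> E \<longrightarrow> (c, d) \<in> E \<longrightarrow> (a \<otimes>\<^bsub>M\<^esub> c, b \<otimes>\<^bsub>M\<^esub> d) \<in> E)"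

definition generated_congruence :: "('a, 'b) monoid_scheme \<Rightarrow> ('a \<times> 'a) set \<Rightarrow> ('a \<times> 'a) set"
  where "generated_congruence M R = \<Inter>{E. congruence M E \<and> R \<subseteq> E}"

definition quotient_monoid :: "('a, 'b) monoid_scheme \<Rightarrow> ('a \<times> 'a) set \<Rightarrow> 'a set monoid"
  where "quotient_monoid M E =
    \<lparr>carrier = carrier M // E,
     mult = (\<lambda>A B. \<Union>a\<in>A. \<Union>b\<in>B. E `` {a \<otimes>\<^bsub>M\<^esub> b}),
     one = E `` {\<one>\<^bsub>M\<^esub>}\<rparr>"

definition free_monoid :: "'x set \<Rightarrow> 'x list monoid"
  where "free_monoid X = \<lparr>carrier = lists X, mult = (@), one = []\<rparr>"

text \<open>The monoid \<open>\<langle>X | R\<rangle>\<close>, where a relation \<open>u = v\<close> is the pair of words \<open>(u, v)\<close>.\<close>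

definition presented_monoid :: "'x set \<Rightarrow> ('x list \<times> 'x list) set \<Rightarrow> 'x list set monoid"
  where "presented_monoid X R =
    quotient_monoid (free_monoid X) (generated_congruence (free_monoid X) R)"

text \<open>The group \<open>gr(X | R)\<close> for relations between positive words: words in the letters
  \<open>(x, True) = x\<close> and \<open>(x, False) = x\<^sup>-\<^sup>1\<close>, modulo \<open>R\<close> and the relations
  \<open>x x\<^sup>-\<^sup>1 = 1 = x\<^sup>-\<^sup>1 x\<close>.\<close>

definition presented_group ::
    "'x set \<Rightarrow> ('x list \<times> 'x list) set \<Rightarrow> ('x \<times> bool) list set monoid"
  where "presented_group X R =
    presented_monoid (X \<times> UNIV)
      ({(map (\<lambda>x. (x, True)) u, map (\<lambda>x. (x, True)) v) | u v. (u, v) \<in> R} \<union>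
       {([(x, e), (x, \<not> e)], []) | x e. x \<in> X})"

definition ybe_relations :: "'x set \<Rightarrow> ('x \<times> 'x \<Rightarrow> 'x \<times> 'x) \<Rightarrow> ('x list \<times> 'x list) set"
  where "ybe_relations X r = {([x, y], [ybe_lam r x y, ybe_rho r y x]) | x y. x \<in> X \<and> y \<in> X}"

definition structure_monoid :: "'x set \<Rightarrow> ('x \<times> 'x \<Rightarrow> 'x \<times> 'x) \<Rightarrow> 'x list set monoid"
  where "structure_monoid X r = presented_monoid X (ybe_relations X r)"

definition structure_group :: "'x set \<Rightarrow> ('x \<times> 'x \<Rightarrow> 'x \<times> 'x) \<Rightarrow> ('x \<times> bool) list set monoid"
  where "structure_group X r = presented_group X (ybe_relations X r)"


section \<open>Cancellativity, center, central localization, group of quotients\<close>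

definition cancellative :: "('a, 'b) monoid_scheme \<Rightarrow> bool"
  where "cancellative M \<longleftrightarrow>
    (\<forall>a\<in>carrier M. \<forall>b\<in>carrier M. \<forall>c\<in>carrier M.
       (a \<otimes>\<^bsub>M\<^esub> c = b \<otimes>\<^bsub>M\<^esub> c \<longrightarrow> a = b) \<and> (c \<otimes>\<^bsub>M\<^esub> a = c \<otimes>\<^bsub>M\<^esub> b \<longrightarrow> a = b))"

definition cancellative_congruence :: "('a, 'b) monoid_scheme \<Rightarrow> ('a \<times> 'a) set"
  where "cancellative_congruence M =
    {(x, y) \<in> carrier M \<times> carrier M. \<exists>z\<in>carrier M. x \<otimes>\<^bsub>M\<^esub> z = y \<otimes>\<^bsub>M\<^esub> z}"

definition monoid_center :: "('a, 'b) monoid_scheme \<Rightarrow> 'a set"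
  where "monoid_center M = {z \<in> carrier M. \<forall>a\<in>carrier M. z \<otimes>\<^bsub>M\<^esub> a = a \<otimes>\<^bsub>M\<^esub> z}"

definition powers_of :: "('a, 'b) monoid_scheme \<Rightarrow> 'a \<Rightarrow> 'a set"
  where "powers_of M z = range (\<lambda>n::nat. z [^]\<^bsub>M\<^esub> n)"

text \<open>For a submonoid \<open>S\<close> of central elements; the class of \<open>(a, s)\<close> is the fraction
  \<open>a s\<^sup>-\<^sup>1\<close>.\<close>

definition fraction_rel :: "('a, 'b) monoid_scheme \<Rightarrow> 'a set \<Rightarrow> (('a \<times> 'a) \<times> ('a \<times> 'a)) set"
  where "fraction_rel M S =
    {((a, s), (b, t)) | a s b t. a \<in> carrier M \<and> b \<in> carrier M \<and> s \<in> S \<and> t \<in> S \<and>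
       (\<exists>u\<in>S. a \<otimes>\<^bsub>M\<^esub> t \<otimes>\<^bsub>M\<^esub> u = b \<otimes>\<^bsub>M\<^esub> s \<otimes>\<^bsub>M\<^esub> u)}"

definition central_localization :: "('a, 'b) monoid_scheme \<Rightarrow> 'a set \<Rightarrow> ('a \<times> 'a) set monoid"
  where "central_localization M S = quotient_monoid (M \<times>\<times> (M\<lparr>carrier := S\<rparr>)) (fraction_rel M S)"

definition localization_map :: "('a, 'b) monoid_scheme \<Rightarrow> 'a set \<Rightarrow> 'a \<Rightarrow> ('a \<times> 'a) set"
  where "localization_map M S a = fraction_rel M S `` {(a, \<one>\<^bsub>M\<^esub>)}"

text \<open>\<open>Q\<close> is a (two-sided) group of quotients of \<open>M\<close>, with \<open>M\<close> embedded by \<open>i\<close>: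
  \<open>Q = M M\<^sup>-\<^sup>1 = M\<^sup>-\<^sup>1 M\<close>.\<close>

definition is_group_of_quotients ::
    "('a, 'b) monoid_scheme \<Rightarrow> ('q, 'c) monoid_scheme \<Rightarrow> ('a \<Rightarrow> 'q) \<Rightarrow> bool"
  where "is_group_of_quotients M Q i \<longleftrightarrow>
    group Q \<and> i \<in> hom M Q \<and> inj_on i (carrier M) \<and>
    carrier Q = {i a \<otimes>\<^bsub>Q\<^esub> inv\<^bsub>Q\<^esub> (i b) | a b. a \<in> carrier M \<and> b \<in> carrier M} \<and>
    carrier Q = {inv\<^bsub>Q\<^esub> (i b) \<otimes>\<^bsub>Q\<^esub> i a | a b. a \<in> carrier M \<and> b \<in> carrier M}"


section \<open>Monoid algebras and prime ideals of noncommutative rings\<close>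

text \<open>Elements of \<open>K[M]\<close> are the finitely supported functions from \<open>carrier M\<close> to \<open>carrier K\<close>,
  extended by zero outside \<open>carrier M\<close>; multiplication is convolution.\<close>

definition monoid_algebra_support :: "('k, 'c) ring_scheme \<Rightarrow> ('a \<Rightarrow> 'k) \<Rightarrow> 'a set"
  where "monoid_algebra_support K f = {m. f m \<noteq> \<zero>\<^bsub>K\<^esub>}"

definition monoid_algebra ::
    "('k, 'c) ring_scheme \<Rightarrow> ('a, 'b) monoid_scheme \<Rightarrow> ('a \<Rightarrow> 'k) ring"
  where "monoid_algebra K M =
    \<lparr>carrier = {f. range f \<subseteq> carrier K \<and> finite (monoid_algebra_support K f) \<and>
                 monoid_algebra_support K f \<subseteq> carrier M},
     mult = (\<lambda>f g m. \<Oplus>\<^bsub>K\<^esub>u\<in>monoid_algebra_support K f. \<Oplus>\<^bsub>K\<^esub>v\<in>monoid_algebra_support K g.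
               (if u \<otimes>\<^bsub>M\<^esub> v = m then f u \<otimes>\<^bsub>K\<^esub> g v else \<zero>\<^bsub>K\<^esub>)),
     one = (\<lambda>m. if m = \<one>\<^bsub>M\<^esub> then \<one>\<^bsub>K\<^esub> else \<zero>\<^bsub>K\<^esub>),
     zero = (\<lambda>m. \<zero>\<^bsub>K\<^esub>),
     add = (\<lambda>f g m. f m \<oplus>\<^bsub>K\<^esub> g m)\<rparr>"

definition monoid_algebra_embed :: "('k, 'c) ring_scheme \<Rightarrow> 'a \<Rightarrow> 'a \<Rightarrow> 'k"
  where "monoid_algebra_embed K x = (\<lambda>m. if m = x then \<one>\<^bsub>K\<^esub> else \<zero>\<^bsub>K\<^esub>)"

text \<open>The library's \<^locale>\<open>primeideal\<close> is restricted to commutative rings.\<close>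

definition prime_ideal :: "('a, 'b) ring_scheme \<Rightarrow> 'a set \<Rightarrow> bool"
  where "prime_ideal R P \<longleftrightarrow> ideal P R \<and> P \<noteq> carrier R \<and>
    (\<forall>I J. ideal I R \<longrightarrow> ideal J R \<longrightarrow> I \<cdot>\<^bsub>R\<^esub> J \<subseteq> P \<longrightarrow> I \<subseteq> P \<or> J \<subseteq> P)"


section \<open>Well-definedness of the constructions\<close>

lemma congruence_quotient_mult:
  assumes "congruence M E" "a \<in> carrier M" "b \<in> carrier M"
  shows "E `` {a} \<otimes>\<^bsub>quotient_monoid M E\<^esub> E `` {b} = E `` {a \<otimes>\<^bsub>M\<^esub> b}"
proof -
  have eq: "equiv (carrier M) E"
    and comp: "\<And>a b c d. (a, b) \<in> E \<Longrightarrow> (c, d) \<in> E \<Longrightarrow> (a \<otimes>\<^bsub>M\<^esub> c, b \<otimes>\<^bsub>M\<^esub> d) \<in> E"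
    using assms(1) unfolding congruence_def by blast+
  have cls: "E `` {a' \<otimes>\<^bsub>M\<^esub> b'} = E `` {a \<otimes>\<^bsub>M\<^esub> b}" if "a' \<in> E `` {a}" "b' \<in> E `` {b}" for a' b'
    using that comp equiv_class_eq[OF eq] by (metis Image_singleton_iff)
  have self: "a \<in> E `` {a}" "b \<in> E `` {b}"
    using equiv_class_self[OF eq] assms(2,3) by blast+
  have "(\<Union>a'\<in>E `` {a}. \<Union>b'\<in>E `` {b}. E `` {a' \<otimes>\<^bsub>M\<^esub> b'}) =
      (\<Union>a'\<in>E `` {a}. \<Union>b'\<in>E `` {b}. E `` {a \<otimes>\<^bsub>M\<^esub> b})"
    by (intro SUP_cong refl cls)
  also have "\<dots> = E `` {a \<otimes>\<^bsub>M\<^esub> b}"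
    using self by blast
  finally show ?thesis by (simp only: quotient_monoid_def monoid.simps)
qed

lemma monoid_quotient_monoid:
  assumes "monoid M" "congruence M E"
  shows "monoid (quotient_monoid M E)"
proof -
  interpret monoid M by fact
  have car: "carrier (quotient_monoid M E) = (\<lambda>a. E `` {a}) ` carrier M"
    and one: "\<one>\<^bsub>quotient_monoid M E\<^esub> = E `` {\<one>\<^bsub>M\<^esub>}"
    by (auto simp: quotient_monoid_def quotient_def)
  show ?thesis
    by unfold_locales
       (auto simp: car one congruence_quotient_mult[OF assms(2)] m_assoc intro!: imageI)
qed

lemma congruence_generated_congruence:
  assumes "monoid M" "R \<subseteq> carrier M \<times> carrier M"
  shows "congruence M (generated_congruence M R)"
proof -
  interpret monoid M by fact
  have full: "congruence M (carrier M \<times> carrier M)"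
    unfolding congruence_def by (auto intro!: equivI refl_onI symI transI)
  have mem: "generated_congruence M R \<subseteq> E" if "congruence M E" "R \<subseteq> E" for E
    using that unfolding generated_congruence_def by blast
  have "equiv (carrier M) (generated_congruence M R)"
  proof (rule equivI)
    show "generated_congruence M R \<subseteq> carrier M \<times> carrier M"
      using mem[OF full assms(2)] .
    show "refl_on (carrier M) (generated_congruence M R)"
      unfolding generated_congruence_def congruence_def equiv_def refl_on_def by blast
    show "sym (generated_congruence M R)"
      unfolding generated_congruence_def congruence_def equiv_def sym_def by blast
    show "trans (generated_congruence M R)"
    proof (rule transI)
      fix x y z assume "(x, y) \<in> generated_congruence M R" "(y, z) \<in> generated_congruence M R"
      then show "(x, z) \<in> generated_congruence M R"
        unfolding generated_congruence_def congruence_def equiv_def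
        by (auto dest: transD)
    qed
  qed
  then show ?thesis
    unfolding congruence_def generated_congruence_def by auto
qed

lemma monoid_free_monoid: "monoid (free_monoid X)"
  by unfold_locales (auto simp: free_monoid_def)

lemma monoid_presented_monoid:
  assumes "R \<subseteq> lists X \<times> lists X"
  shows "monoid (presented_monoid X R)"
  unfolding presented_monoid_def
  by (intro monoid_quotient_monoid congruence_generated_congruence monoid_free_monoid)
     (use assms in \<open>simp add: free_monoid_def\<close>)

lemma group_presented_group:
  assumes R: "R \<subseteq> lists X \<times> lists X"
  shows "group (presented_group X R)"
proof -
  let ?L = "X \<times> (UNIV :: bool set)"
  let ?R = "{(map (\<lambda>x. (x, True)) u, map (\<lambda>x. (x, True)) v) | u v. (u, v) \<in> R} \<union>
       {([(x, e), (x, \<not> e)], []) | x e. x \<in> X}"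
  let ?F = "free_monoid ?L"
  let ?E = "generated_congruence ?F ?R"
  have sub: "?R \<subseteq> lists ?L \<times> lists ?L" using R by (fastforce simp: in_lists_conv_set)
  interpret G: monoid "presented_group X R"
    unfolding presented_group_def by (rule monoid_presented_monoid[OF sub])
  have cong: "congruence ?F ?E"
    by (rule congruence_generated_congruence[OF monoid_free_monoid])
       (use sub in \<open>simp add: free_monoid_def\<close>)
  then have eq: "equiv (lists ?L) ?E"
    and comp: "\<And>a b c d. (a, b) \<in> ?E \<Longrightarrow> (c, d) \<in> ?E \<Longrightarrow> (a @ c, b @ d) \<in> ?E"
    unfolding congruence_def by (auto simp: free_monoid_def)
  have inE: "?R \<subseteq> ?E" unfolding generated_congruence_def by blast
  have rf: "(w, w) \<in> ?E" if "w \<in> lists ?L" for w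
    using that eq by (meson equiv_def refl_onD)
  define iv where "iv w = rev (map (\<lambda>(x, e). (x, \<not> e)) w)" for w :: "('a \<times> bool) list"
  have iv_closed: "iv w \<in> lists ?L" if "w \<in> lists ?L" for w
    using that by (auto simp: iv_def in_lists_conv_set)
  have iv_l: "(iv w @ w, []) \<in> ?E" if "w \<in> lists ?L" for w
    using that
  proof (induction w)
    case Nil then show ?case using rf[of "[]"] by (simp add: iv_def)
  next
    case (Cons p w)
    obtain x e where p: "p = (x, e)" "x \<in> X" using Cons.hyps(1) by auto
    have "([(x, \<not> e), (x, \<not> \<not> e)], []) \<in> ?R" using p(2) by blast
    then have "([(x, \<not> e), (x, e)], []) \<in> ?E" using inE by auto
    from comp[OF comp[OF rf[OF iv_closed[OF Cons.hyps(2)]] this] rf[OF Cons.hyps(2)]]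
    have "(iv (p # w) @ p # w, iv w @ w) \<in> ?E" by (simp add: iv_def p)
    with Cons.IH eq show ?case by (meson equiv_def transD)
  qed
  show ?thesis
  proof (rule G.group_l_invI)
    fix A assume "A \<in> carrier (presented_group X R)"
    then obtain w where w: "A = ?E `` {w}" "w \<in> lists ?L"
      by (auto simp: presented_group_def presented_monoid_def quotient_monoid_def
          free_monoid_def elim!: quotientE)
    have "?E `` {iv w} \<otimes>\<^bsub>presented_group X R\<^esub> A = ?E `` {iv w @ w}"
      using congruence_quotient_mult[OF cong, of "iv w" w] w iv_closed[OF w(2)]
      by (simp add: presented_group_def presented_monoid_def free_monoid_def)
    also have "\<dots> = \<one>\<^bsub>presented_group X R\<^esub>"
      using equiv_class_eq[OF eq iv_l[OF w(2)]]
      by (simp add: presented_group_def presented_monoid_def quotient_monoid_def free_monoid_def)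
    finally have "?E `` {iv w} \<otimes>\<^bsub>presented_group X R\<^esub> A = \<one>\<^bsub>presented_group X R\<^esub>" .
    moreover have "?E `` {iv w} \<in> carrier (presented_group X R)"
      using quotientI[OF iv_closed[OF w(2)], of ?E]
      by (simp add: presented_group_def presented_monoid_def quotient_monoid_def free_monoid_def)
    ultimately show "\<exists>B\<in>carrier (presented_group X R). B \<otimes>\<^bsub>presented_group X R\<^esub> A = \<one>\<^bsub>presented_group X R\<^esub>"
      by blast
  qed
qed

lemma (in ybe_solution) ybe_relations_words: "ybe_relations X r \<subseteq> lists X \<times> lists X"
proof -
  have "r (x, y) \<in> X \<times> X" if "x \<in> X" "y \<in> X" for x y
    using r_closed that by blast
  then show ?thesis
    by (auto simp: ybe_relations_def ybe_lam_def ybe_rho_def mem_Times_iff)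
qed

lemma (in ybe_solution) monoid_structure_monoid: "monoid (structure_monoid X r)"
  unfolding structure_monoid_def by (rule monoid_presented_monoid[OF ybe_relations_words])

lemma (in ybe_solution) group_structure_group: "group (structure_group X r)"
  unfolding structure_group_def by (rule group_presented_group[OF ybe_relations_words])

lemma (in abelian_monoid) finsum_swap:
  assumes "finite A" "finite B" "\<And>a b. a \<in> A \<Longrightarrow> b \<in> B \<Longrightarrow> f a b \<in> carrier G"
  shows "(\<Oplus>a\<in>A. \<Oplus>b\<in>B. f a b) = (\<Oplus>b\<in>B. \<Oplus>a\<in>A. f a b)"
  using assms(1,3)
proof (induction A rule: finite_induct)
  case (insert x A)
  then have "(\<Oplus>a\<in>insert x A. \<Oplus>b\<in>B. f a b) = (\<Oplus>b\<in>B. f x b) \<oplus> (\<Oplus>b\<in>B. \<Oplus>a\<in>A. f a b)"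
    by (subst finsum_insert) (auto simp: Pi_def)
  also have "\<dots> = (\<Oplus>b\<in>B. f x b \<oplus> (\<Oplus>a\<in>A. f a b))"
    by (rule finsum_addf[symmetric]) (use insert.prems in \<open>auto simp: Pi_def\<close>)
  also have "\<dots> = (\<Oplus>b\<in>B. \<Oplus>a\<in>insert x A. f a b)"
    by (rule finsum_cong') (use insert in \<open>auto simp: Pi_def\<close>)
  finally show ?case .
qed simp

lemma ring_monoid_algebra:
  assumes "ring K" "monoid M"
  shows "ring (monoid_algebra K M)"
proof -
  interpret K: ring K by fact
  interpret M: monoid M by fact
  let ?R = "monoid_algebra K M" and ?s = "monoid_algebra_support K"
  note d = monoid_algebra_def monoid_algebra_support_def
  have kc: "f m \<in> carrier K" if "f \<in> carrier ?R" for f m using that by (auto simp: monoid_algebra_def)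
  have fs: "finite (?s f)" "?s f \<subseteq> carrier M" if "f \<in> carrier ?R" for f
    using that by (auto simp: monoid_algebra_def)
  have nz: "f m = \<zero>\<^bsub>K\<^esub>" if "m \<notin> ?s f" for f m using that by (auto simp: d)
  have carI: "f \<in> carrier ?R" if "\<And>m. f m \<in> carrier K" "finite S" "S \<subseteq> carrier M"
     "\<And>m. m \<notin> S \<Longrightarrow> f m = \<zero>\<^bsub>K\<^esub>" for f S
  proof -
    have "?s f \<subseteq> S" using that(4) by (auto simp: d)
    then show ?thesis using that finite_subset[of "?s f" S]
      by (auto simp: monoid_algebra_def)
  qed
  define c where "c f g u v m = (if u \<otimes>\<^bsub>M\<^esub> v = m then f u \<otimes>\<^bsub>K\<^esub> g v else \<zero>\<^bsub>K\<^esub>)" for f g u v m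
  have cc: "c f g u v m \<in> carrier K" if "f \<in> carrier ?R" "g \<in> carrier ?R" for f g u v m
    using kc that by (simp add: c_def)
  have mult: "(f \<otimes>\<^bsub>?R\<^esub> g) m = (\<Oplus>\<^bsub>K\<^esub>u\<in>A. \<Oplus>\<^bsub>K\<^esub>v\<in>B. c f g u v m)"
    if f: "f \<in> carrier ?R" and g: "g \<in> carrier ?R" and A: "finite A" "?s f \<subseteq> A"
      and B: "finite B" "?s g \<subseteq> B" for f g A B m
  proof -
    have i: "(\<Oplus>\<^bsub>K\<^esub>v\<in>?s g. c f g u v m) = (\<Oplus>\<^bsub>K\<^esub>v\<in>B. c f g u v m)" for u
      by (rule K.add.finprod_mono_neutral_cong_left)
         (use B cc[OF f g] nz[of _ g] kc[OF f] in \<open>auto simp: c_def\<close>)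
    have "(f \<otimes>\<^bsub>?R\<^esub> g) m = (\<Oplus>\<^bsub>K\<^esub>u\<in>?s f. \<Oplus>\<^bsub>K\<^esub>v\<in>?s g. c f g u v m)"
      by (simp add: monoid_algebra_def c_def)
    also have "\<dots> = (\<Oplus>\<^bsub>K\<^esub>u\<in>A. \<Oplus>\<^bsub>K\<^esub>v\<in>B. c f g u v m)"
      unfolding i
      by (rule K.add.finprod_mono_neutral_cong_left)
         (use A cc[OF f g] nz[of _ f] kc[OF g] in \<open>auto simp: c_def intro!: K.add.finprod_one_eqI\<close>)
    finally show ?thesis .
  qed
  have mclosed: "f \<otimes>\<^bsub>?R\<^esub> g \<in> carrier ?R"
    and msupp: "?s (f \<otimes>\<^bsub>?R\<^esub> g) \<subseteq> (\<lambda>(u, v). u \<otimes>\<^bsub>M\<^esub> v) ` (?s f \<times> ?s g)"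
    if f: "f \<in> carrier ?R" and g: "g \<in> carrier ?R" for f g
  proof -
    let ?W = "(\<lambda>(u, v). u \<otimes>\<^bsub>M\<^esub> v) ` (?s f \<times> ?s g)"
    have z: "(f \<otimes>\<^bsub>?R\<^esub> g) m = \<zero>\<^bsub>K\<^esub>" if "m \<notin> ?W" for m
      unfolding mult[OF f g fs(1)[OF f] subset_refl fs(1)[OF g] subset_refl]
      using that by (intro K.add.finprod_one_eqI) (auto simp: c_def)
    then show "?s (f \<otimes>\<^bsub>?R\<^esub> g) \<subseteq> ?W" by (auto simp: monoid_algebra_support_def)
    show "f \<otimes>\<^bsub>?R\<^esub> g \<in> carrier ?R"
    proof (rule carI[of _ ?W])
      show "(f \<otimes>\<^bsub>?R\<^esub> g) m \<in> carrier K" for m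
        unfolding mult[OF f g fs(1)[OF f] subset_refl fs(1)[OF g] subset_refl]
        using cc[OF f g] by (auto intro!: K.finsum_closed)
    qed (use fs f g z in \<open>auto\<close>)
  qed
  have aclosed: "f \<oplus>\<^bsub>?R\<^esub> g \<in> carrier ?R" and aeq: "(f \<oplus>\<^bsub>?R\<^esub> g) m = f m \<oplus>\<^bsub>K\<^esub> g m"
    if f: "f \<in> carrier ?R" and g: "g \<in> carrier ?R" for f g m
  proof -
    show "(f \<oplus>\<^bsub>?R\<^esub> g) m = f m \<oplus>\<^bsub>K\<^esub> g m" for m by (simp add: monoid_algebra_def)
    then show "f \<oplus>\<^bsub>?R\<^esub> g \<in> carrier ?R"
      by (intro carI[of _ "?s f \<union> ?s g"]) (use fs kc nz[of _ f] nz[of _ g] f g in auto)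
  qed
  have one: "\<one>\<^bsub>?R\<^esub> \<in> carrier ?R"
    by (rule carI[of _ "{\<one>\<^bsub>M\<^esub>}"]) (auto simp: monoid_algebra_def)
  have sone: "?s (\<one>\<^bsub>?R\<^esub>) \<subseteq> {\<one>\<^bsub>M\<^esub>}" by (auto simp: d)
  have pull: "(\<Oplus>\<^bsub>K\<^esub>w\<in>W. if p = w \<and> P w then k else \<zero>\<^bsub>K\<^esub>) = (if P p then k else \<zero>\<^bsub>K\<^esub>)"
    if "finite W" "p \<in> W" "k \<in> carrier K" for W p P k
  proof -
    have "(\<Oplus>\<^bsub>K\<^esub>w\<in>W. if p = w \<and> P w then k else \<zero>\<^bsub>K\<^esub>)
        = (\<Oplus>\<^bsub>K\<^esub>w\<in>W. if p = w then (if P w then k else \<zero>\<^bsub>K\<^esub>) else \<zero>\<^bsub>K\<^esub>)"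
      by (rule K.finsum_cong') (use that in auto)
    also have "\<dots> = (if P p then k else \<zero>\<^bsub>K\<^esub>)"
      by (rule K.finsum_singleton) (use that in \<open>auto\<close>)
    finally show ?thesis .
  qed
  show ?thesis
  proof (rule ringI)
    show "abelian_group ?R"
    proof (rule abelian_groupI)
      show "\<zero>\<^bsub>?R\<^esub> \<in> carrier ?R"
        by (rule carI[of _ "{}"]) (auto simp: monoid_algebra_def)
      fix f assume f: "f \<in> carrier ?R"
      show "\<exists>g\<in>carrier ?R. g \<oplus>\<^bsub>?R\<^esub> f = \<zero>\<^bsub>?R\<^esub>"
        by (rule bexI[of _ "\<lambda>m. \<ominus>\<^bsub>K\<^esub> f m"], (simp add: monoid_algebra_def, use kc[OF f] in \<open>simp add: K.l_neg\<close>),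
            rule carI[of _ "?s f"]) (use fs kc nz[of _ f] f in auto)
      show "\<zero>\<^bsub>?R\<^esub> \<oplus>\<^bsub>?R\<^esub> f = f" using kc[OF f] by (simp add: monoid_algebra_def)
    qed (auto simp: aclosed, auto simp: monoid_algebra_def fun_eq_iff K.a_ac image_subset_iff)
    show "monoid ?R"
    proof (rule monoidI)
      fix f assume f: "f \<in> carrier ?R"
      have fin: "finite (?s f)" using fs f by auto
      have out: "m \<in> carrier M \<or> f m = \<zero>\<^bsub>K\<^esub>" for m using fs(2)[OF f] nz[of m f] by blast
      show "\<one>\<^bsub>?R\<^esub> \<otimes>\<^bsub>?R\<^esub> f = f"
      proof
        fix m
        have "(\<one>\<^bsub>?R\<^esub> \<otimes>\<^bsub>?R\<^esub> f) m = (\<Oplus>\<^bsub>K\<^esub>v\<in>insert m (?s f). c \<one>\<^bsub>?R\<^esub> f \<one>\<^bsub>M\<^esub> v m)"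
          by (subst mult[OF one f _ sone, of "insert m (?s f)"])
             (use fin cc[OF one f] in \<open>auto simp: Pi_def\<close>)
        also have "\<dots> = (\<Oplus>\<^bsub>K\<^esub>v\<in>insert m (?s f). if m = v then f v else \<zero>\<^bsub>K\<^esub>)"
          by (rule K.finsum_cong') (use out[of m] kc[OF f] fs(2)[OF f] in \<open>auto simp: c_def monoid_algebra_def\<close>)
        also have "\<dots> = f m"
          by (rule K.finsum_singleton) (use fin kc[OF f] in auto)
        finally show "(\<one>\<^bsub>?R\<^esub> \<otimes>\<^bsub>?R\<^esub> f) m = f m" .
      qed
      show "f \<otimes>\<^bsub>?R\<^esub> \<one>\<^bsub>?R\<^esub> = f"
      proof
        fix m
        have "(f \<otimes>\<^bsub>?R\<^esub> \<one>\<^bsub>?R\<^esub>) m = (\<Oplus>\<^bsub>K\<^esub>v\<in>insert m (?s f). c f \<one>\<^bsub>?R\<^esub> v \<one>\<^bsub>M\<^esub> m)"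
          by (subst mult[OF f one _ _ _ sone, of "insert m (?s f)"])
             (use fin cc[OF f one] in \<open>auto simp: Pi_def\<close>)
        also have "\<dots> = (\<Oplus>\<^bsub>K\<^esub>v\<in>insert m (?s f). if m = v then f v else \<zero>\<^bsub>K\<^esub>)"
          by (rule K.finsum_cong') (use out[of m] kc[OF f] fs(2)[OF f] in \<open>auto simp: c_def monoid_algebra_def\<close>)
        also have "\<dots> = f m"
          by (rule K.finsum_singleton) (use fin kc[OF f] in auto)
        finally show "(f \<otimes>\<^bsub>?R\<^esub> \<one>\<^bsub>?R\<^esub>) m = f m" .
      qed
    next
      fix f g h assume f: "f \<in> carrier ?R" and g: "g \<in> carrier ?R" and h: "h \<in> carrier ?R"
      let ?A = "?s f" and ?B = "?s g" and ?C = "?s h"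
      let ?m = "\<lambda>(u, v). u \<otimes>\<^bsub>M\<^esub> v"
      note F = fs(1)[OF f] fs(1)[OF g] fs(1)[OF h]
      note S = fs(2)[OF f] fs(2)[OF g] fs(2)[OF h]
      let ?t = "\<lambda>m a b e. if a \<otimes>\<^bsub>M\<^esub> b \<otimes>\<^bsub>M\<^esub> e = m then f a \<otimes>\<^bsub>K\<^esub> g b \<otimes>\<^bsub>K\<^esub> h e else \<zero>\<^bsub>K\<^esub>"
      have tc: "?t m a b e \<in> carrier K" for m a b e using kc f g h by auto
      show "f \<otimes>\<^bsub>?R\<^esub> g \<otimes>\<^bsub>?R\<^esub> h = f \<otimes>\<^bsub>?R\<^esub> (g \<otimes>\<^bsub>?R\<^esub> h)"
      proof
        fix m
        let ?W = "?m ` (?A \<times> ?B)" and ?V = "?m ` (?B \<times> ?C)"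
        have "(f \<otimes>\<^bsub>?R\<^esub> g \<otimes>\<^bsub>?R\<^esub> h) m = (\<Oplus>\<^bsub>K\<^esub>w\<in>?W. \<Oplus>\<^bsub>K\<^esub>e\<in>?C. c (f \<otimes>\<^bsub>?R\<^esub> g) h w e m)"
          by (rule mult) (use mclosed f g h F msupp[OF f g] in auto)
        also have "\<dots> = (\<Oplus>\<^bsub>K\<^esub>w\<in>?W. \<Oplus>\<^bsub>K\<^esub>e\<in>?C. \<Oplus>\<^bsub>K\<^esub>a\<in>?A. \<Oplus>\<^bsub>K\<^esub>b\<in>?B.
            if a \<otimes>\<^bsub>M\<^esub> b = w \<and> w \<otimes>\<^bsub>M\<^esub> e = m then f a \<otimes>\<^bsub>K\<^esub> g b \<otimes>\<^bsub>K\<^esub> h e else \<zero>\<^bsub>K\<^esub>)"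
        proof (intro K.finsum_cong' refl)
          fix w e
          show "c (f \<otimes>\<^bsub>?R\<^esub> g) h w e m = (\<Oplus>\<^bsub>K\<^esub>a\<in>?A. \<Oplus>\<^bsub>K\<^esub>b\<in>?B.
            if a \<otimes>\<^bsub>M\<^esub> b = w \<and> w \<otimes>\<^bsub>M\<^esub> e = m then f a \<otimes>\<^bsub>K\<^esub> g b \<otimes>\<^bsub>K\<^esub> h e else \<zero>\<^bsub>K\<^esub>)"
          proof (cases "w \<otimes>\<^bsub>M\<^esub> e = m")
            case True
            have "c (f \<otimes>\<^bsub>?R\<^esub> g) h w e m = (\<Oplus>\<^bsub>K\<^esub>a\<in>?A. \<Oplus>\<^bsub>K\<^esub>b\<in>?B. c f g a b w) \<otimes>\<^bsub>K\<^esub> h e"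
              using True mult[OF f g F(1) subset_refl F(2) subset_refl] by (simp add: c_def)
            also have "\<dots> = (\<Oplus>\<^bsub>K\<^esub>a\<in>?A. (\<Oplus>\<^bsub>K\<^esub>b\<in>?B. c f g a b w) \<otimes>\<^bsub>K\<^esub> h e)"
              by (rule K.finsum_ldistr) (use F kc[OF h] cc[OF f g] in \<open>auto intro!: K.finsum_closed\<close>)
            also have "\<dots> = (\<Oplus>\<^bsub>K\<^esub>a\<in>?A. \<Oplus>\<^bsub>K\<^esub>b\<in>?B. c f g a b w \<otimes>\<^bsub>K\<^esub> h e)"
              by (intro K.finsum_cong' refl K.finsum_ldistr)
                 (use F kc[OF h] cc[OF f g] in \<open>auto intro!: K.finsum_closed\<close>)
            also have "\<dots> = (\<Oplus>\<^bsub>K\<^esub>a\<in>?A. \<Oplus>\<^bsub>K\<^esub>b\<in>?B.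
              if a \<otimes>\<^bsub>M\<^esub> b = w \<and> w \<otimes>\<^bsub>M\<^esub> e = m then f a \<otimes>\<^bsub>K\<^esub> g b \<otimes>\<^bsub>K\<^esub> h e else \<zero>\<^bsub>K\<^esub>)"
              by (intro K.finsum_cong' refl)
                 (use True kc f g h in \<open>auto intro!: K.finsum_closed simp: c_def\<close>)
            finally show ?thesis .
          qed (simp add: c_def)
        qed (use kc f g h in \<open>auto intro!: K.finsum_closed\<close>)
        also have "\<dots> = (\<Oplus>\<^bsub>K\<^esub>e\<in>?C. \<Oplus>\<^bsub>K\<^esub>w\<in>?W. \<Oplus>\<^bsub>K\<^esub>a\<in>?A. \<Oplus>\<^bsub>K\<^esub>b\<in>?B.
            if a \<otimes>\<^bsub>M\<^esub> b = w \<and> w \<otimes>\<^bsub>M\<^esub> e = m then f a \<otimes>\<^bsub>K\<^esub> g b \<otimes>\<^bsub>K\<^esub> h e else \<zero>\<^bsub>K\<^esub>)"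
          by (rule K.finsum_swap) (use F kc f g h in \<open>auto intro!: K.finsum_closed\<close>)
        also have "\<dots> = (\<Oplus>\<^bsub>K\<^esub>e\<in>?C. \<Oplus>\<^bsub>K\<^esub>a\<in>?A. \<Oplus>\<^bsub>K\<^esub>w\<in>?W. \<Oplus>\<^bsub>K\<^esub>b\<in>?B.
            if a \<otimes>\<^bsub>M\<^esub> b = w \<and> w \<otimes>\<^bsub>M\<^esub> e = m then f a \<otimes>\<^bsub>K\<^esub> g b \<otimes>\<^bsub>K\<^esub> h e else \<zero>\<^bsub>K\<^esub>)"
          by (intro K.finsum_cong' refl K.finsum_swap) (use F kc f g h in \<open>auto intro!: K.finsum_closed\<close>)
        also have "\<dots> = (\<Oplus>\<^bsub>K\<^esub>e\<in>?C. \<Oplus>\<^bsub>K\<^esub>a\<in>?A. \<Oplus>\<^bsub>K\<^esub>b\<in>?B. \<Oplus>\<^bsub>K\<^esub>w\<in>?W. 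
            if a \<otimes>\<^bsub>M\<^esub> b = w \<and> w \<otimes>\<^bsub>M\<^esub> e = m then f a \<otimes>\<^bsub>K\<^esub> g b \<otimes>\<^bsub>K\<^esub> h e else \<zero>\<^bsub>K\<^esub>)"
          by (intro K.finsum_cong' refl K.finsum_swap) (use F kc f g h in \<open>auto intro!: K.finsum_closed\<close>)
        also have "\<dots> = (\<Oplus>\<^bsub>K\<^esub>e\<in>?C. \<Oplus>\<^bsub>K\<^esub>a\<in>?A. \<Oplus>\<^bsub>K\<^esub>b\<in>?B. ?t m a b e)"
          proof (intro K.finsum_cong' refl)
          fix a b e assume ab: "a \<in> ?A" "b \<in> ?B" "e \<in> ?C"
          show "(\<Oplus>\<^bsub>K\<^esub>w\<in>?W. if a \<otimes>\<^bsub>M\<^esub> b = w \<and> w \<otimes>\<^bsub>M\<^esub> e = m then f a \<otimes>\<^bsub>K\<^esub> g b \<otimes>\<^bsub>K\<^esub> h e else \<zero>\<^bsub>K\<^esub>)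
            = ?t m a b e"
            by (rule pull[of _ _ _ "\<lambda>w. w \<otimes>\<^bsub>M\<^esub> e = m"]) (use F kc f g h ab in auto)
        qed (use F kc f g h in \<open>auto intro!: K.finsum_closed\<close>)
        also have "\<dots> = (\<Oplus>\<^bsub>K\<^esub>a\<in>?A. \<Oplus>\<^bsub>K\<^esub>e\<in>?C. \<Oplus>\<^bsub>K\<^esub>b\<in>?B. ?t m a b e)"
          by (rule K.finsum_swap) (use F kc f g h in \<open>auto intro!: K.finsum_closed\<close>)
        also have "\<dots> = (\<Oplus>\<^bsub>K\<^esub>a\<in>?A. \<Oplus>\<^bsub>K\<^esub>b\<in>?B. \<Oplus>\<^bsub>K\<^esub>e\<in>?C. ?t m a b e)"
          by (intro K.finsum_cong' refl K.finsum_swap) (use F kc f g h in \<open>auto intro!: K.finsum_closed\<close>)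
        finally have L: "(f \<otimes>\<^bsub>?R\<^esub> g \<otimes>\<^bsub>?R\<^esub> h) m = \<dots>" .
        have "(f \<otimes>\<^bsub>?R\<^esub> (g \<otimes>\<^bsub>?R\<^esub> h)) m = (\<Oplus>\<^bsub>K\<^esub>a\<in>?A. \<Oplus>\<^bsub>K\<^esub>w\<in>?V. c f (g \<otimes>\<^bsub>?R\<^esub> h) a w m)"
          by (rule mult) (use mclosed f g h F msupp[OF g h] in auto)
        also have "\<dots> = (\<Oplus>\<^bsub>K\<^esub>a\<in>?A. \<Oplus>\<^bsub>K\<^esub>w\<in>?V. \<Oplus>\<^bsub>K\<^esub>b\<in>?B. \<Oplus>\<^bsub>K\<^esub>e\<in>?C.
            if b \<otimes>\<^bsub>M\<^esub> e = w \<and> a \<otimes>\<^bsub>M\<^esub> w = m then f a \<otimes>\<^bsub>K\<^esub> g b \<otimes>\<^bsub>K\<^esub> h e else \<zero>\<^bsub>K\<^esub>)"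
        proof (intro K.finsum_cong' refl)
          fix a w
          show "c f (g \<otimes>\<^bsub>?R\<^esub> h) a w m = (\<Oplus>\<^bsub>K\<^esub>b\<in>?B. \<Oplus>\<^bsub>K\<^esub>e\<in>?C.
            if b \<otimes>\<^bsub>M\<^esub> e = w \<and> a \<otimes>\<^bsub>M\<^esub> w = m then f a \<otimes>\<^bsub>K\<^esub> g b \<otimes>\<^bsub>K\<^esub> h e else \<zero>\<^bsub>K\<^esub>)"
          proof (cases "a \<otimes>\<^bsub>M\<^esub> w = m")
            case True
            have "c f (g \<otimes>\<^bsub>?R\<^esub> h) a w m = f a \<otimes>\<^bsub>K\<^esub> (\<Oplus>\<^bsub>K\<^esub>b\<in>?B. \<Oplus>\<^bsub>K\<^esub>e\<in>?C. c g h b e w)"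
              using True mult[OF g h F(2) subset_refl F(3) subset_refl] by (simp add: c_def)
            also have "\<dots> = (\<Oplus>\<^bsub>K\<^esub>b\<in>?B. f a \<otimes>\<^bsub>K\<^esub> (\<Oplus>\<^bsub>K\<^esub>e\<in>?C. c g h b e w))"
              by (rule K.finsum_rdistr) (use F kc[OF f] cc[OF g h] in \<open>auto intro!: K.finsum_closed\<close>)
            also have "\<dots> = (\<Oplus>\<^bsub>K\<^esub>b\<in>?B. \<Oplus>\<^bsub>K\<^esub>e\<in>?C. f a \<otimes>\<^bsub>K\<^esub> c g h b e w)"
              by (intro K.finsum_cong' refl K.finsum_rdistr)
                 (use F kc[OF f] cc[OF g h] in \<open>auto intro!: K.finsum_closed\<close>)
            also have "\<dots> = (\<Oplus>\<^bsub>K\<^esub>b\<in>?B. \<Oplus>\<^bsub>K\<^esub>e\<in>?C.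
              if b \<otimes>\<^bsub>M\<^esub> e = w \<and> a \<otimes>\<^bsub>M\<^esub> w = m then f a \<otimes>\<^bsub>K\<^esub> g b \<otimes>\<^bsub>K\<^esub> h e else \<zero>\<^bsub>K\<^esub>)"
              by (intro K.finsum_cong' refl)
                 (use True kc f g h in \<open>auto intro!: K.finsum_closed simp: c_def K.m_assoc\<close>)
            finally show ?thesis .
          qed (simp add: c_def)
        qed (use kc f g h in \<open>auto intro!: K.finsum_closed\<close>)
        also have "\<dots> = (\<Oplus>\<^bsub>K\<^esub>a\<in>?A. \<Oplus>\<^bsub>K\<^esub>b\<in>?B. \<Oplus>\<^bsub>K\<^esub>w\<in>?V. \<Oplus>\<^bsub>K\<^esub>e\<in>?C.
            if b \<otimes>\<^bsub>M\<^esub> e = w \<and> a \<otimes>\<^bsub>M\<^esub> w = m then f a \<otimes>\<^bsub>K\<^esub> g b \<otimes>\<^bsub>K\<^esub> h e else \<zero>\<^bsub>K\<^esub>)"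
          by (intro K.finsum_cong' refl K.finsum_swap) (use F kc f g h in \<open>auto intro!: K.finsum_closed\<close>)
        also have "\<dots> = (\<Oplus>\<^bsub>K\<^esub>a\<in>?A. \<Oplus>\<^bsub>K\<^esub>b\<in>?B. \<Oplus>\<^bsub>K\<^esub>e\<in>?C. \<Oplus>\<^bsub>K\<^esub>w\<in>?V. 
            if b \<otimes>\<^bsub>M\<^esub> e = w \<and> a \<otimes>\<^bsub>M\<^esub> w = m then f a \<otimes>\<^bsub>K\<^esub> g b \<otimes>\<^bsub>K\<^esub> h e else \<zero>\<^bsub>K\<^esub>)"
          by (intro K.finsum_cong' refl K.finsum_swap) (use F kc f g h in \<open>auto intro!: K.finsum_closed\<close>)
        also have "\<dots> = (\<Oplus>\<^bsub>K\<^esub>a\<in>?A. \<Oplus>\<^bsub>K\<^esub>b\<in>?B. \<Oplus>\<^bsub>K\<^esub>e\<in>?C.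
            if a \<otimes>\<^bsub>M\<^esub> (b \<otimes>\<^bsub>M\<^esub> e) = m then f a \<otimes>\<^bsub>K\<^esub> g b \<otimes>\<^bsub>K\<^esub> h e else \<zero>\<^bsub>K\<^esub>)"
          proof (intro K.finsum_cong' refl)
          fix a b e assume ab: "a \<in> ?A" "b \<in> ?B" "e \<in> ?C"
          show "(\<Oplus>\<^bsub>K\<^esub>w\<in>?V. if b \<otimes>\<^bsub>M\<^esub> e = w \<and> a \<otimes>\<^bsub>M\<^esub> w = m then f a \<otimes>\<^bsub>K\<^esub> g b \<otimes>\<^bsub>K\<^esub> h e else \<zero>\<^bsub>K\<^esub>)
            = (if a \<otimes>\<^bsub>M\<^esub> (b \<otimes>\<^bsub>M\<^esub> e) = m then f a \<otimes>\<^bsub>K\<^esub> g b \<otimes>\<^bsub>K\<^esub> h e else \<zero>\<^bsub>K\<^esub>)"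
            by (rule pull[of _ _ _ "\<lambda>w. a \<otimes>\<^bsub>M\<^esub> w = m"]) (use F kc f g h ab in auto)
        qed (use F kc f g h in \<open>auto intro!: K.finsum_closed\<close>)
        also have "\<dots> = (\<Oplus>\<^bsub>K\<^esub>a\<in>?A. \<Oplus>\<^bsub>K\<^esub>b\<in>?B. \<Oplus>\<^bsub>K\<^esub>e\<in>?C. ?t m a b e)"
        proof (intro K.finsum_cong' refl)
          fix a b e assume "a \<in> ?A" "b \<in> ?B" "e \<in> ?C"
          then have "a \<otimes>\<^bsub>M\<^esub> (b \<otimes>\<^bsub>M\<^esub> e) = a \<otimes>\<^bsub>M\<^esub> b \<otimes>\<^bsub>M\<^esub> e" using S by (simp add: M.m_assoc subset_iff)
          then show "(if a \<otimes>\<^bsub>M\<^esub> (b \<otimes>\<^bsub>M\<^esub> e) = m then f a \<otimes>\<^bsub>K\<^esub> g b \<otimes>\<^bsub>K\<^esub> h e else \<zero>\<^bsub>K\<^esub>) = ?t m a b e"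
            by simp
        qed (use kc f g h in \<open>auto intro!: K.finsum_closed\<close>)
        finally show "(f \<otimes>\<^bsub>?R\<^esub> g \<otimes>\<^bsub>?R\<^esub> h) m = (f \<otimes>\<^bsub>?R\<^esub> (g \<otimes>\<^bsub>?R\<^esub> h)) m"
          using L by simp
      qed
    qed (use mclosed one in auto)
  next
    fix f g h assume f: "f \<in> carrier ?R" and g: "g \<in> carrier ?R" and h: "h \<in> carrier ?R"
    let ?A = "?s f \<union> ?s g" and ?C = "?s h"
    have fin: "finite ?A" "finite ?C" using fs f g h by auto
    have sa: "?s (f \<oplus>\<^bsub>?R\<^esub> g) \<subseteq> ?A" by (auto simp: d)
    show "(f \<oplus>\<^bsub>?R\<^esub> g) \<otimes>\<^bsub>?R\<^esub> h = f \<otimes>\<^bsub>?R\<^esub> h \<oplus>\<^bsub>?R\<^esub> g \<otimes>\<^bsub>?R\<^esub> h"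
    proof
      fix m
      have "((f \<oplus>\<^bsub>?R\<^esub> g) \<otimes>\<^bsub>?R\<^esub> h) m = (\<Oplus>\<^bsub>K\<^esub>a\<in>?A. \<Oplus>\<^bsub>K\<^esub>b\<in>?C. c (f \<oplus>\<^bsub>?R\<^esub> g) h a b m)"
        by (rule mult) (use aclosed f g h fin sa in auto)
      also have "\<dots> = (\<Oplus>\<^bsub>K\<^esub>a\<in>?A. \<Oplus>\<^bsub>K\<^esub>b\<in>?C. c f h a b m \<oplus>\<^bsub>K\<^esub> c g h a b m)"
        by (intro K.finsum_cong' refl)
           (use kc aeq[OF f g] f g h in \<open>auto simp: c_def K.l_distr intro!: K.finsum_closed\<close>)
      also have "\<dots> = (\<Oplus>\<^bsub>K\<^esub>a\<in>?A. (\<Oplus>\<^bsub>K\<^esub>b\<in>?C. c f h a b m) \<oplus>\<^bsub>K\<^esub> (\<Oplus>\<^bsub>K\<^esub>b\<in>?C. c g h a b m))"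
        by (intro K.finsum_cong' refl K.finsum_addf) (use cc f g h in \<open>auto intro!: K.finsum_closed\<close>)
      also have "\<dots> = (\<Oplus>\<^bsub>K\<^esub>a\<in>?A. \<Oplus>\<^bsub>K\<^esub>b\<in>?C. c f h a b m) \<oplus>\<^bsub>K\<^esub> (\<Oplus>\<^bsub>K\<^esub>a\<in>?A. \<Oplus>\<^bsub>K\<^esub>b\<in>?C. c g h a b m)"
        by (rule K.finsum_addf) (use cc f g h in \<open>auto intro!: K.finsum_closed\<close>)
      also have "\<dots> = (f \<otimes>\<^bsub>?R\<^esub> h \<oplus>\<^bsub>?R\<^esub> g \<otimes>\<^bsub>?R\<^esub> h) m"
        using mult[OF f h fin(1) _ fin(2) subset_refl] mult[OF g h fin(1) _ fin(2) subset_refl]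
          aeq[OF mclosed[OF f h] mclosed[OF g h]] by simp
      finally show "((f \<oplus>\<^bsub>?R\<^esub> g) \<otimes>\<^bsub>?R\<^esub> h) m = (f \<otimes>\<^bsub>?R\<^esub> h \<oplus>\<^bsub>?R\<^esub> g \<otimes>\<^bsub>?R\<^esub> h) m" .
    qed
    show "h \<otimes>\<^bsub>?R\<^esub> (f \<oplus>\<^bsub>?R\<^esub> g) = h \<otimes>\<^bsub>?R\<^esub> f \<oplus>\<^bsub>?R\<^esub> h \<otimes>\<^bsub>?R\<^esub> g"
    proof
      fix m
      have "(h \<otimes>\<^bsub>?R\<^esub> (f \<oplus>\<^bsub>?R\<^esub> g)) m = (\<Oplus>\<^bsub>K\<^esub>a\<in>?C. \<Oplus>\<^bsub>K\<^esub>b\<in>?A. c h (f \<oplus>\<^bsub>?R\<^esub> g) a b m)"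
        by (rule mult) (use aclosed f g h fin sa in auto)
      also have "\<dots> = (\<Oplus>\<^bsub>K\<^esub>a\<in>?C. \<Oplus>\<^bsub>K\<^esub>b\<in>?A. c h f a b m \<oplus>\<^bsub>K\<^esub> c h g a b m)"
        by (intro K.finsum_cong' refl)
           (use kc aeq[OF f g] f g h in \<open>auto simp: c_def K.r_distr intro!: K.finsum_closed\<close>)
      also have "\<dots> = (\<Oplus>\<^bsub>K\<^esub>a\<in>?C. (\<Oplus>\<^bsub>K\<^esub>b\<in>?A. c h f a b m) \<oplus>\<^bsub>K\<^esub> (\<Oplus>\<^bsub>K\<^esub>b\<in>?A. c h g a b m))"
        by (intro K.finsum_cong' refl K.finsum_addf) (use cc f g h in \<open>auto intro!: K.finsum_closed\<close>)
      also have "\<dots> = (\<Oplus>\<^bsub>K\<^esub>a\<in>?C. \<Oplus>\<^bsub>K\<^esub>b\<in>?A. c h f a b m) \<oplus>\<^bsub>K\<^esub> (\<Oplus>\<^bsub>K\<^esub>a\<in>?C. \<Oplus>\<^bsub>K\<^esub>b\<in>?A. c h g a b m)"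
        by (rule K.finsum_addf) (use cc f g h in \<open>auto intro!: K.finsum_closed\<close>)
      also have "\<dots> = (h \<otimes>\<^bsub>?R\<^esub> f \<oplus>\<^bsub>?R\<^esub> h \<otimes>\<^bsub>?R\<^esub> g) m"
        using mult[OF h f fin(2) subset_refl fin(1)] mult[OF h g fin(2) subset_refl fin(1)]
          aeq[OF mclosed[OF h f] mclosed[OF h g]] by simp
      finally show "(h \<otimes>\<^bsub>?R\<^esub> (f \<oplus>\<^bsub>?R\<^esub> g)) m = (h \<otimes>\<^bsub>?R\<^esub> f \<oplus>\<^bsub>?R\<^esub> h \<otimes>\<^bsub>?R\<^esub> g) m" .
    qed
  qed
qed

end

theory Submission
  imports Defs "HOL-Combinatorics.Cycles"
begin

text \<open>
  Left non-degeneracy gives the structure monoid a second operation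
  \<open>w + y = w \<circ> \<lambda>\<^sub>w\<^sup>-\<^sup>1(y)\<close> by letters \<open>y\<close>, which satisfies \<open>w + x + y = w + y + \<sigma>\<^sub>y(x)\<close> with
  \<open>\<sigma>\<^sub>y\<close> bijective because \<open>r\<close> is bijective. As \<open>X\<close> is finite, some \<open>k > 0\<close> has \<open>\<sigma>\<^sub>y\<^sup>k = id\<close> for
  all \<open>y\<close>, so every multiple \<open>k x\<close> is central for \<open>+\<close>. The sum \<open>\<zeta>\<close> of all \<open>k x\<close> is invariant under
  the maps \<open>\<lambda>\<close>, whence \<open>\<zeta> x = \<lambda>\<^sub>\<zeta>(x) \<zeta>\<close>, and a power \<open>z\<close> of \<open>\<zeta>\<close> is central in \<open>M\<close> and a multiple
  of every generator. Inverting \<open>z\<close> therefore turns \<open>M\<close> into a group, which has the universal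
  property of \<open>G\<close>, and the kernel of \<open>M \<rightarrow> G\<close> is \<open>\<eta>\<close>. Consequently \<open>K[G]\<close> is the localization of
  \<open>K[M]\<close> at the central powers of \<open>z\<close>, and extension and contraction of ideals match the primes of
  \<open>K[G]\<close> with the primes of \<open>K[M]\<close> that avoid the powers of \<open>z\<close>, equivalently that avoid \<open>M\<close>.
\<close>

text \<open>Since \<open>M\<close> need not be cancellative and the maps \<rho> need not be
  bijective, addition is never built as a monoid; only the right action of letters on words, well
  defined modulo the defining congruence, is used. Passing y over one x applies \<sigma>_x, so
  \<sigma>_x^k = id gives w + y + k x = w + k x + y. The sum \<zeta> runs over all letters because
  each \<lambda>_c permutes X: with c \<circ> (w + v) = (c \<circ> w) + \<lambda>_c(v) this yields c
  \<circ> \<zeta> = c + \<zeta>. Additive centrality then allows \<zeta> \<circ> x = \<zeta> +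
  \<lambda>_\<zeta>(x) = \<lambda>_\<zeta>(x) + \<zeta>. The power of \<zeta> that is taken is a
  period of \<lambda>_\<zeta>. The localization is formed from M itself and not from its
  cancellative quotient, because comparing it with G is what identifies the kernel of M
  \<rightarrow> G. The rest of the argument sees G only through two facts: elements with equal image
  in G agree after multiplication by a power of z, and every element of G is a fraction whose
  denominator is a power of z.\<close>

locale central_submonoid = monoid M for M (structure) +
  fixes S
  assumes submonoid_S: "submonoid S M"
    and S_central: "S \<subseteq> monoid_center M"
begin

lemma S_in_carrier [simp]: "s \<in> S \<Longrightarrow> s \<in> carrier M"
  using submonoid.subset[OF submonoid_S] by blast

lemma S_mult_closed [simp]: "s \<in> S \<Longrightarrow> t \<in> S \<Longrightarrow> s \<otimes> t \<in> S"
  using submonoid.m_closed[OF submonoid_S] .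

lemma one_in_S [simp]: "\<one> \<in> S"
  using submonoid.one_closed[OF submonoid_S] .

lemma S_comm: "s \<in> S \<Longrightarrow> a \<in> carrier M \<Longrightarrow> s \<otimes> a = a \<otimes> s"
  using S_central by (auto simp: monoid_center_def)

lemma S_right_comm:
  "s \<in> S \<Longrightarrow> t \<in> S \<Longrightarrow> a \<in> carrier M \<Longrightarrow> a \<otimes> s \<otimes> t = a \<otimes> t \<otimes> s"
  by (simp add: m_assoc S_comm[of s t])

lemma S_interchange:
  assumes "s \<in> S" "a \<in> carrier M" "b \<in> carrier M" "c \<in> carrier M"
  shows "(a \<otimes> b) \<otimes> (s \<otimes> c) = (a \<otimes> s) \<otimes> (b \<otimes> c)"
proof -
  have "a \<otimes> (b \<otimes> s) \<otimes> c = a \<otimes> (s \<otimes> b) \<otimes> c" using assms by (simp add: S_comm)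
  then show ?thesis using assms by (simp add: m_assoc)
qed

section \<open>Fractions over a central submonoid\<close>

lemma fraction_relI:
  "\<lbrakk>a \<in> carrier M; b \<in> carrier M; s \<in> S; t \<in> S; u \<in> S; a \<otimes> t \<otimes> u = b \<otimes> s \<otimes> u\<rbrakk>
    \<Longrightarrow> ((a, s), (b, t)) \<in> fraction_rel M S"
  unfolding fraction_rel_def by blast

lemma fraction_relE:
  assumes "((a, s), (b, t)) \<in> fraction_rel M S"
  obtains u where "a \<in> carrier M" "b \<in> carrier M" "s \<in> S" "t \<in> S" "u \<in> S"
    "a \<otimes> t \<otimes> u = b \<otimes> s \<otimes> u"
  using assms unfolding fraction_rel_def by blast

lemma congruence_fraction_rel:
  "congruence (M \<times>\<times> M\<lparr>carrier := S\<rparr>) (fraction_rel M S)"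
  unfolding congruence_def
proof (intro conjI allI impI)
  show "equiv (carrier (M \<times>\<times> M\<lparr>carrier := S\<rparr>)) (fraction_rel M S)"
  proof (rule equivI)
    show "fraction_rel M S \<subseteq> carrier (M \<times>\<times> M\<lparr>carrier := S\<rparr>) \<times> carrier (M \<times>\<times> M\<lparr>carrier := S\<rparr>)"
      by (auto simp: fraction_rel_def)
    show "refl_on (carrier (M \<times>\<times> M\<lparr>carrier := S\<rparr>)) (fraction_rel M S)"
      by (auto intro!: refl_onI fraction_relI[where u = \<one>])
    show "sym (fraction_rel M S)"
    proof (rule symI)
      fix p q assume "(p, q) \<in> fraction_rel M S"
      then show "(q, p) \<in> fraction_rel M S"
        unfolding fraction_rel_def by force
    qed
    show "trans (fraction_rel M S)"
    proof (rule transI)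
      fix p q w assume pq: "(p, q) \<in> fraction_rel M S" and qw: "(q, w) \<in> fraction_rel M S"
      obtain a s b t c v where e: "p = (a, s)" "q = (b, t)" "w = (c, v)"
        by (cases p, cases q, cases w)
      obtain u where u: "a \<in> carrier M" "b \<in> carrier M" "s \<in> S" "t \<in> S" "u \<in> S"
        "a \<otimes> t \<otimes> u = b \<otimes> s \<otimes> u" using pq e by (auto elim: fraction_relE)
      obtain u' where u': "c \<in> carrier M" "v \<in> S" "u' \<in> S"
        "b \<otimes> v \<otimes> u' = c \<otimes> t \<otimes> u'" using qw e by (auto elim: fraction_relE)
      note mem = u(1-5) u'(1-3)
      have "a \<otimes> v \<otimes> (t \<otimes> u \<otimes> u') = (a \<otimes> t \<otimes> u) \<otimes> (v \<otimes> u')"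
        using mem by (simp add: m_assoc[symmetric] S_right_comm)
      also have "\<dots> = (b \<otimes> s \<otimes> u) \<otimes> (v \<otimes> u')"
        by (simp only: u(6))
      also have "\<dots> = (b \<otimes> v \<otimes> u') \<otimes> (s \<otimes> u)"
        using mem by (simp add: m_assoc[symmetric] S_right_comm)
      also have "\<dots> = (c \<otimes> t \<otimes> u') \<otimes> (s \<otimes> u)"
        by (simp only: u'(4))
      also have "\<dots> = c \<otimes> s \<otimes> (t \<otimes> u \<otimes> u')"
        using mem by (simp add: m_assoc[symmetric] S_right_comm)
      finally show "(p, w) \<in> fraction_rel M S"
        unfolding e using u u' by (intro fraction_relI[where u = "t \<otimes> u \<otimes> u'"]) auto
    qed
  qed
next
  fix p q p' q' assume pq: "(p, q) \<in> fraction_rel M S" and pq': "(p', q') \<in> fraction_rel M S"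
  obtain a s b t a' s' b' t' where e: "p = (a, s)" "q = (b, t)" "p' = (a', s')" "q' = (b', t')"
    by (cases p, cases q, cases p', cases q')
  obtain u where u: "a \<in> carrier M" "b \<in> carrier M" "s \<in> S" "t \<in> S" "u \<in> S"
    "a \<otimes> t \<otimes> u = b \<otimes> s \<otimes> u" using pq e by (auto elim: fraction_relE)
  obtain u' where u': "a' \<in> carrier M" "b' \<in> carrier M" "s' \<in> S" "t' \<in> S" "u' \<in> S"
    "a' \<otimes> t' \<otimes> u' = b' \<otimes> s' \<otimes> u'" using pq' e by (auto elim: fraction_relE)
  have "(a \<otimes> a') \<otimes> (t \<otimes> t') \<otimes> (u \<otimes> u') = (a \<otimes> t \<otimes> u) \<otimes> (a' \<otimes> t' \<otimes> u')"
    using u(1-5) u'(1-5) S_interchange[of t a a' t'] S_interchange[of u "a \<otimes> t" "a' \<otimes> t'" u'] by simp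
  also have "\<dots> = (b \<otimes> s \<otimes> u) \<otimes> (b' \<otimes> s' \<otimes> u')"
    by (simp only: u(6) u'(6))
  also have "\<dots> = (b \<otimes> b') \<otimes> (s \<otimes> s') \<otimes> (u \<otimes> u')"
    using u(1-5) u'(1-5) S_interchange[of s b b' s'] S_interchange[of u "b \<otimes> s" "b' \<otimes> s'" u'] by simp
  finally show "(p \<otimes>\<^bsub>M \<times>\<times> M\<lparr>carrier := S\<rparr>\<^esub> p', q \<otimes>\<^bsub>M \<times>\<times> M\<lparr>carrier := S\<rparr>\<^esub> q') \<in> fraction_rel M S"
    unfolding e using u u' by (auto intro!: fraction_relI[where u = "u \<otimes> u'"])
qed

definition fraction where "fraction a s = fraction_rel M S `` {(a, s)}"

abbreviation "L \<equiv> central_localization M S"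

lemma monoid_localization: "monoid L"
  unfolding central_localization_def
proof (rule monoid_quotient_monoid[OF DirProd_monoid congruence_fraction_rel])
  show "monoid M" by (rule monoid_axioms)
  show "monoid (M\<lparr>carrier := S\<rparr>)" by (rule submonoid.submonoid_is_monoid[OF submonoid_S monoid_axioms])
qed

lemma carrier_localization:
  "carrier L = {fraction a s | a s. a \<in> carrier M \<and> s \<in> S}"
  unfolding central_localization_def quotient_monoid_def quotient_def fraction_def by auto

lemma fraction_closed: "a \<in> carrier M \<Longrightarrow> s \<in> S \<Longrightarrow> fraction a s \<in> carrier L"
  unfolding carrier_localization by blast

lemma fraction_mult:
  assumes "a \<in> carrier M" "s \<in> S" "b \<in> carrier M" "t \<in> S"
  shows "fraction a s \<otimes>\<^bsub>L\<^esub> fraction b t = fraction (a \<otimes> b) (s \<otimes> t)"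
  unfolding central_localization_def fraction_def
  using assms by (subst congruence_quotient_mult[OF congruence_fraction_rel]) auto

lemma one_localization: "\<one>\<^bsub>L\<^esub> = fraction \<one> \<one>"
  unfolding central_localization_def quotient_monoid_def fraction_def by simp

lemma fraction_eq_iff:
  assumes "a \<in> carrier M" "s \<in> S" "b \<in> carrier M" "t \<in> S"
  shows "fraction a s = fraction b t \<longleftrightarrow> (\<exists>u\<in>S. a \<otimes> t \<otimes> u = b \<otimes> s \<otimes> u)"
proof -
  have eq: "equiv (carrier M \<times> S) (fraction_rel M S)"
    using congruence_fraction_rel by (simp add: congruence_def)
  have "fraction a s = fraction b t \<longleftrightarrow> ((a, s), (b, t)) \<in> fraction_rel M S"
    unfolding fraction_def using eq_equiv_class_iff[OF eq] assms by simp
  then show ?thesis using assms by (auto simp: fraction_rel_def)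
qed

lemma localization_map_eq: "localization_map M S = (\<lambda>a. fraction a \<one>)"
  by (auto simp: localization_map_def fraction_def)

lemma localization_map_hom: "localization_map M S \<in> hom M L"
  unfolding localization_map_eq hom_def by (auto simp: fraction_mult fraction_closed)

text \<open>If a b lies in \<open>S\<close>, then the fraction a/s has the right inverse (b s)/(a
  b). A monoid in which every element has a right inverse is a group.\<close>

lemma group_localization:
  assumes dvd: "\<And>a. a \<in> carrier M \<Longrightarrow> \<exists>b\<in>carrier M. a \<otimes> b \<in> S"
  shows "group L"
proof -
  interpret L: monoid L by (rule monoid_localization)
  have r_inv: "\<exists>y\<in>carrier L. x \<otimes>\<^bsub>L\<^esub> y = \<one>\<^bsub>L\<^esub>" if xL: "x \<in> carrier L" for x
  proof -
    obtain a s where x: "x = fraction a s" "a \<in> carrier M" "s \<in> S"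
      using xL unfolding carrier_localization by blast
    obtain b where b: "b \<in> carrier M" "a \<otimes> b \<in> S" using dvd x by blast
    have "x \<otimes>\<^bsub>L\<^esub> fraction (b \<otimes> s) (a \<otimes> b) = fraction (a \<otimes> (b \<otimes> s)) (s \<otimes> (a \<otimes> b))"
      using x b by (simp add: fraction_mult)
    also have "\<dots> = \<one>\<^bsub>L\<^esub>"
    proof -
      have "s \<otimes> (a \<otimes> b) \<in> S" using x b by simp
      moreover have "a \<otimes> (b \<otimes> s) = s \<otimes> (a \<otimes> b)"
        using x b S_comm[OF x(3), of "a \<otimes> b"] by (simp add: m_assoc)
      ultimately show ?thesis
        unfolding one_localization by (simp add: fraction_eq_iff) (rule exI[of _ \<one>], simp)
    qed
    finally show ?thesis using x b fraction_closed[of "b \<otimes> s" "a \<otimes> b"] by auto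
  qed
  show ?thesis
  proof (rule L.group_l_invI)
    fix x assume x: "x \<in> carrier L"
    obtain y where y: "y \<in> carrier L" "x \<otimes>\<^bsub>L\<^esub> y = \<one>\<^bsub>L\<^esub>" using r_inv x by blast
    obtain w where w: "w \<in> carrier L" "y \<otimes>\<^bsub>L\<^esub> w = \<one>\<^bsub>L\<^esub>" using r_inv y by blast
    \<comment> \<open>\<open>w\<close> is a right inverse of the right inverse \<open>y\<close> of
      \<open>x\<close>; equality with \<open>x\<close> turns \<open>y\<close> into a left
      inverse.\<close>
    have "x = w" using x y w by (metis L.m_assoc L.l_one L.r_one)
    then show "\<exists>y\<in>carrier L. y \<otimes>\<^bsub>L\<^esub> x = \<one>\<^bsub>L\<^esub>" using y w by blast
  qed
qed

end

section \<open>Homomorphisms out of presented monoids and groups\<close>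

definition word_eval :: "('n, 'c) monoid_scheme \<Rightarrow> ('x \<Rightarrow> 'n) \<Rightarrow> 'x list \<Rightarrow> 'n"
  where "word_eval N f w = foldr (\<lambda>x a. f x \<otimes>\<^bsub>N\<^esub> a) w \<one>\<^bsub>N\<^esub>"

lemma (in monoid) word_eval_closed:
  assumes "f \<in> X \<rightarrow> carrier G" "w \<in> lists X"
  shows "word_eval G f w \<in> carrier G"
  using assms(2) by induction (use assms(1) in \<open>auto simp: word_eval_def\<close>)

lemma (in monoid) word_eval_append:
  assumes "f \<in> X \<rightarrow> carrier G" "u \<in> lists X" "v \<in> lists X"
  shows "word_eval G f (u @ v) = word_eval G f u \<otimes> word_eval G f v"
  using assms(2)
proof induction
  case Nil
  then show ?case using word_eval_closed[OF assms(1,3)] by (simp add: word_eval_def)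
next
  case (Cons a l)
  have "f a \<in> carrier G" using assms(1) Cons by auto
  then show ?case
    using Cons word_eval_closed[OF assms(1,3)] word_eval_closed[OF assms(1) Cons.hyps(2)]
    by (simp add: word_eval_def m_assoc)
qed

lemma equiv_generated_congruence:
  assumes "R \<subseteq> lists X \<times> lists X"
  shows "equiv (lists X) (generated_congruence (free_monoid X) R)"
  using congruence_generated_congruence[OF monoid_free_monoid, of R X] assms
  by (simp add: congruence_def free_monoid_def)

lemma generated_congruence_append:
  assumes "R \<subseteq> lists X \<times> lists X"
    and "(u, u') \<in> generated_congruence (free_monoid X) R"
    and "(v, v') \<in> generated_congruence (free_monoid X) R"
  shows "(u @ v, u' @ v') \<in> generated_congruence (free_monoid X) R"
  using congruence_generated_congruence[OF monoid_free_monoid, of R X] assms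
  by (simp add: congruence_def free_monoid_def)

lemma generated_congruence_base: "R \<subseteq> generated_congruence M R"
  unfolding generated_congruence_def by blast

lemma carrier_presented_monoid:
  "carrier (presented_monoid X R) = lists X // generated_congruence (free_monoid X) R"
  by (simp add: presented_monoid_def quotient_monoid_def free_monoid_def)

lemma one_presented_monoid:
  "\<one>\<^bsub>presented_monoid X R\<^esub> = generated_congruence (free_monoid X) R `` {[]}"
  by (simp add: presented_monoid_def quotient_monoid_def free_monoid_def)

lemma mult_presented_monoid:
  assumes "R \<subseteq> lists X \<times> lists X" "u \<in> lists X" "v \<in> lists X"
  shows "generated_congruence (free_monoid X) R `` {u} \<otimes>\<^bsub>presented_monoid X R\<^esub>
      generated_congruence (free_monoid X) R `` {v} = generated_congruence (free_monoid X) R `` {u @ v}"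
  unfolding presented_monoid_def
  using congruence_quotient_mult[OF congruence_generated_congruence[OF monoid_free_monoid], of R X u v]
    assms by (simp add: free_monoid_def)

text \<open>The kernel of evaluation is a congruence containing \<open>R\<close>, hence it contains
  the least one.\<close>

lemma (in monoid) generated_congruence_word_eval:
  assumes R: "R \<subseteq> lists X \<times> lists X" and f: "f \<in> X \<rightarrow> carrier G"
    and rel: "\<And>u v. (u, v) \<in> R \<Longrightarrow> word_eval G f u = word_eval G f v"
    and uv: "(u, v) \<in> generated_congruence (free_monoid X) R"
  shows "word_eval G f u = word_eval G f v"
proof -
  let ?E = "{(u, v) \<in> lists X \<times> lists X. word_eval G f u = word_eval G f v}"
  have "congruence (free_monoid X) ?E"
    unfolding congruence_def free_monoid_def
    by (auto intro!: equivI refl_onI symI transI simp: word_eval_append[OF f] simp del: append_in_lists_conv)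
  moreover have "R \<subseteq> ?E" using R rel by blast
  ultimately show ?thesis using uv unfolding generated_congruence_def by blast
qed

lemma (in monoid) presented_monoid_hom:
  assumes R: "R \<subseteq> lists X \<times> lists X" and f: "f \<in> X \<rightarrow> carrier G"
    and rel: "\<And>u v. (u, v) \<in> R \<Longrightarrow> word_eval G f u = word_eval G f v"
  obtains h where "h \<in> hom (presented_monoid X R) G"
    "\<And>w. w \<in> lists X \<Longrightarrow> h (generated_congruence (free_monoid X) R `` {w}) = word_eval G f w"
proof
  let ?E = "generated_congruence (free_monoid X) R"
  \<comment> \<open>A class is evaluated at a chosen representative; the kernel argument above makes
    the choice irrelevant.\<close>
  define h where "h A = word_eval G f (SOME w. w \<in> A)" for A
  note eq = equiv_generated_congruence[OF R]
  show val: "h (?E `` {w}) = word_eval G f w" if "w \<in> lists X" for w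
  proof -
    have "w \<in> ?E `` {w}" using equiv_class_self[OF eq that] .
    then have "(SOME v. v \<in> ?E `` {w}) \<in> ?E `` {w}" by (rule someI)
    then have "(w, SOME v. v \<in> ?E `` {w}) \<in> ?E" by simp
    from generated_congruence_word_eval[OF R f rel this] show ?thesis by (simp add: h_def)
  qed
  show "h \<in> hom (presented_monoid X R) G"
  proof (rule homI)
    fix A assume "A \<in> carrier (presented_monoid X R)"
    then obtain u where "u \<in> lists X" "A = ?E `` {u}"
      unfolding carrier_presented_monoid by (rule quotientE)
    then show "h A \<in> carrier G" using val word_eval_closed[OF f] by simp
  next
    fix A B assume "A \<in> carrier (presented_monoid X R)" "B \<in> carrier (presented_monoid X R)"
    then obtain u v where "u \<in> lists X" "A = ?E `` {u}" "v \<in> lists X" "B = ?E `` {v}"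
      unfolding carrier_presented_monoid by (meson quotientE)
    then show "h (A \<otimes>\<^bsub>presented_monoid X R\<^esub> B) = h A \<otimes> h B"
      using val[of u] val[of v] val[of "u @ v"] word_eval_append[OF f]
      by (simp add: mult_presented_monoid[OF R] del: in_lists_conv_set)
  qed
qed

text \<open>Names the relation set hidden in \<open>presented_group\<close>, so that results on
  presented monoids apply to it.\<close>

definition group_relations :: "'x set \<Rightarrow> ('x list \<times> 'x list) set \<Rightarrow> (('x \<times> bool) list \<times> ('x \<times> bool) list) set"
  where "group_relations X R =
      {(map (\<lambda>x. (x, True)) u, map (\<lambda>x. (x, True)) v) | u v. (u, v) \<in> R} \<union>
       {([(x, e), (x, \<not> e)], []) | x e. x \<in> X}"

lemma presented_group_eq: "presented_group X R = presented_monoid (X \<times> UNIV) (group_relations X R)"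
  by (simp add: presented_group_def group_relations_def)

lemma group_relations_words:
  assumes "R \<subseteq> lists X \<times> lists X"
  shows "group_relations X R \<subseteq> lists (X \<times> UNIV) \<times> lists (X \<times> UNIV)"
  using assms unfolding group_relations_def by (fastforce simp: in_lists_conv_set)

text \<open>Sending the letter (x, False) to the inverse of f x respects the relators x x^-1 and
  x^-1 x. The values are recorded on positive words because these are the images of elements of the
  structure monoid.\<close>

lemma (in group) presented_group_hom:
  assumes R: "R \<subseteq> lists X \<times> lists X" and f: "f \<in> X \<rightarrow> carrier G"
    and rel: "\<And>u v. (u, v) \<in> R \<Longrightarrow> word_eval G f u = word_eval G f v"
  obtains h where "h \<in> hom (presented_group X R) G"
    "\<And>w. w \<in> lists X \<Longrightarrow>
       h (generated_congruence (free_monoid (X \<times> UNIV)) (group_relations X R) `` {map (\<lambda>x. (x, True)) w})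
       = word_eval G f w"
proof -
  define g where "g = (\<lambda>(x, e). if e then f x else inv (f x))"
  have pos: "word_eval G g (map (\<lambda>x. (x, True)) w) = word_eval G f w" for w
    by (induction w) (auto simp: word_eval_def g_def)
  have g: "g \<in> X \<times> UNIV \<rightarrow> carrier G" using f by (auto simp: g_def Pi_iff)
  have "word_eval G g u = word_eval G g v" if "(u, v) \<in> group_relations X R" for u v
    using that unfolding group_relations_def
  proof
    assume "(u, v) \<in> {([(x, e), (x, \<not> e)], []) | x e. x \<in> X}"
    then obtain x e where xe: "u = [(x, e), (x, \<not> e)]" "v = []" "x \<in> X" by blast
    then have "f x \<in> carrier G" using f by blast
    then show ?thesis using xe by (cases e) (auto simp: word_eval_def g_def)
  qed (use rel pos in auto)
  from presented_monoid_hom[OF group_relations_words[OF R] g this]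
  obtain h where h: "h \<in> hom (presented_monoid (X \<times> UNIV) (group_relations X R)) G"
    "\<And>w. w \<in> lists (X \<times> UNIV) \<Longrightarrow>
      h (generated_congruence (free_monoid (X \<times> UNIV)) (group_relations X R) `` {w}) = word_eval G g w"
    by blast
  show ?thesis
  proof
    show "h \<in> hom (presented_group X R) G" using h by (simp add: presented_group_eq)
    fix w assume "w \<in> lists X"
    then have "map (\<lambda>x. (x, True)) w \<in> lists (X \<times> UNIV)" by (auto simp: in_lists_conv_set)
    then show "h (generated_congruence (free_monoid (X \<times> UNIV)) (group_relations X R)
        `` {map (\<lambda>x. (x, True)) w}) = word_eval G f w"
      using h(2) pos by metis
  qed
qed

section \<open>Common periods of permutations of a finite set\<close>

lemma bij_betw_funpow_fixes:
  assumes "finite X" "bij_betw f X X"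
  obtains n where "n > 0" "\<And>x. x \<in> X \<Longrightarrow> (f ^^ n) x = x"
proof -
  \<comment> \<open>Nothing is known about \<open>f\<close> outside \<open>X\<close>;
    \<open>g\<close> replaces it there by the identity, which makes it a permutation of finite
    support.\<close>
  define g where "g = (\<lambda>x. if x \<in> X then f x else x)"
  have "bij_betw g X X" using assms(2) by (simp add: g_def cong: bij_betw_cong)
  then have "g permutes X" by (rule bij_imp_permutes) (simp add: g_def)
  then have "permutation g" using assms(1) permutation_permutes by blast
  then obtain n where n: "g ^^ n = id" "n > 0" using permutation_is_nilpotent by blast
  have "(f ^^ m) x = (g ^^ m) x \<and> (f ^^ m) x \<in> X" if "x \<in> X" for x m
    using that assms(2) by (induction m) (auto simp: g_def bij_betw_def)
  with n show ?thesis by (intro that[of n]) auto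
qed

lemma funpow_mult_fixes:
  assumes "(f ^^ m) x = x"
  shows "(f ^^ (m * n)) x = x"
  using assms by (induction n) (simp_all add: funpow_add)

lemma finite_family_funpow_fixes:
  assumes "finite X" "finite F" "\<And>f. f \<in> F \<Longrightarrow> bij_betw f X X"
  obtains n where "n > 0" "\<And>f x. f \<in> F \<Longrightarrow> x \<in> X \<Longrightarrow> (f ^^ n) x = x"
proof -
  have "\<exists>n>0. \<forall>f\<in>F. \<forall>x\<in>X. (f ^^ n) x = x"
    using assms(2,3)
  proof (induction F rule: finite_induct)
    case (insert f F)
    then obtain n where n: "n > 0" "\<forall>f\<in>F. \<forall>x\<in>X. (f ^^ n) x = x" by auto
    obtain m where m: "m > 0" "\<And>x. x \<in> X \<Longrightarrow> (f ^^ m) x = x"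
      using bij_betw_funpow_fixes[OF assms(1)] insert by blast
    have "(g ^^ (m * n)) x = x" if "g \<in> insert f F" "x \<in> X" for g x
      using that n(2) m(2) funpow_mult_fixes[of m g x n] funpow_mult_fixes[of n g x m]
      by (auto simp: mult.commute)
    then show ?case using n m by (intro exI[of _ "m * n"]) auto
  qed auto
  then show ?thesis using that by blast
qed

section \<open>A central word\<close>

locale finite_bijective_lnd_solution = ybe_solution X r
  for X :: "'x set" and r +
  assumes finite_X: "finite X"
    and bijective: "ybe_bijective X r"
    and left_nondegenerate: "ybe_left_nondegenerate X r"
begin

text \<open>Keeps automation from replacing \<open>w \<in> lists X\<close> by a statement about
  \<open>set w\<close>, so that lemmas on words continue to match.\<close>

declare in_listsD [rule del] in_listsI [rule del]

section \<open>The Yang--Baxter equation in terms of \<lambda>, \<rho> and \<sigma>\<close>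

abbreviation "lam \<equiv> ybe_lam r"
abbreviation "rho \<equiv> ybe_rho r"

lemma r_eq: "r (x, y) = (lam x y, rho y x)"
  by (simp add: ybe_lam_def ybe_rho_def)

lemma lam_closed: "x \<in> X \<Longrightarrow> y \<in> X \<Longrightarrow> lam x y \<in> X"
  and rho_closed: "x \<in> X \<Longrightarrow> y \<in> X \<Longrightarrow> rho y x \<in> X"
proof -
  have *: "(lam x y, rho y x) \<in> X \<times> X" if "x \<in> X" "y \<in> X"
    unfolding r_eq[symmetric] using r_closed that by blast
  show "x \<in> X \<Longrightarrow> y \<in> X \<Longrightarrow> lam x y \<in> X" "x \<in> X \<Longrightarrow> y \<in> X \<Longrightarrow> rho y x \<in> X"
    using * by blast+
qed

lemma lam_bij: "x \<in> X \<Longrightarrow> bij_betw (lam x) X X"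
  using left_nondegenerate by (simp add: ybe_left_nondegenerate_def)

text \<open>First coordinate of the Yang--Baxter equation; it makes \<lambda> compatible with the
  defining relations of the structure monoid.\<close>

lemma lam_lam:
  assumes "x \<in> X" "y \<in> X" "z \<in> X"
  shows "lam (lam x y) (lam (rho y x) z) = lam x (lam y z)"
  using yang_baxter[of "(x, y, z)"] assms by (simp add: ybe_r12_def ybe_r23_def r_eq)

text \<open>Second coordinate of the Yang--Baxter equation.\<close>

lemma rho_lam:
  assumes "x \<in> X" "y \<in> X" "z \<in> X"
  shows "rho (lam (rho y x) z) (lam x y) = lam (rho (lam y z) x) (rho z y)"
  using yang_baxter[of "(x, y, z)"] assms by (simp add: ybe_r12_def ybe_r23_def r_eq)

text \<open>The rack operation of the derived solution \<open>(x, y) \<mapsto> (y, \<sigma>\<^sub>y(x))\<close>.\<close>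

definition sig :: "'x \<Rightarrow> 'x \<Rightarrow> 'x"
  where "sig y x = lam y (rho (inv_into X (lam x) y) x)"

text \<open>Parametrizing the first argument as \<open>lam x q\<close> removes the inverse from the
  definition of \<open>sig\<close>; all later computations use this form.\<close>

lemma sig_lam: "x \<in> X \<Longrightarrow> q \<in> X \<Longrightarrow> sig (lam x q) x = lam (lam x q) (rho q x)"
  using lam_bij[of x] by (simp add: sig_def bij_betw_def)

lemma lam_surj:
  assumes "x \<in> X" "y \<in> X"
  obtains q where "q \<in> X" "y = lam x q"
  using assms lam_bij[of x] by (auto simp: bij_betw_def)

lemma sig_closed: "x \<in> X \<Longrightarrow> y \<in> X \<Longrightarrow> sig y x \<in> X"
  by (metis lam_surj sig_lam lam_closed rho_closed)

text \<open>Each \<lambda>_a is an endomorphism of the operation \<open>sig\<close>. This is the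
  second Yang--Baxter coordinate, with the first one rewriting the arguments on both sides.\<close>

lemma lam_sig:
  assumes "a \<in> X" "x \<in> X" "y \<in> X"
  shows "lam a (sig y x) = sig (lam a y) (lam a x)"
proof -
  obtain q where q: "q \<in> X" "y = lam x q" using lam_surj assms by blast
  \<comment> \<open>Finds the parameter that \<open>sig_lam\<close> needs at \<open>lam a x\<close>,
    namely \<open>lam (rho x a) q\<close>.\<close>
  have y: "lam a y = lam (lam a x) (lam (rho x a) q)"
    using lam_lam[of a x q] assms q by simp
  have "sig (lam a y) (lam a x) = lam (lam a y) (rho (lam (rho x a) q) (lam a x))"
    unfolding y using assms q by (simp add: sig_lam lam_closed rho_closed)
  also have "\<dots> = lam (lam a y) (lam (rho y a) (rho q x))"
    using rho_lam[of a x q] assms q by simp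
  also have "\<dots> = lam a (sig y x)"
    using lam_lam[of a y "rho q x"] assms q by (simp add: sig_lam rho_closed)
  finally show ?thesis by simp
qed

text \<open>Here bijectivity of \<open>r\<close> enters. With y = \<lambda>_x(q) = \<lambda>_x'(q'),
  equal values of \<sigma>_y give \<rho>_q(x) = \<rho>_q'(x'), so (x, q) and (x', q') have the same
  image under \<open>r\<close>. Surjectivity follows from finiteness.\<close>

lemma sig_bij:
  assumes "y \<in> X"
  shows "bij_betw (sig y) X X"
proof -
  have "inj_on (sig y) X"
  proof (rule inj_onI)
    fix x x' assume x: "x \<in> X" "x' \<in> X" and eq: "sig y x = sig y x'"
    obtain q where q: "q \<in> X" "y = lam x q" using lam_surj x(1) assms by blast
    obtain q' where q': "q' \<in> X" "y = lam x' q'" using lam_surj x(2) assms by blast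
    have "lam y (rho q x) = lam y (rho q' x')"
      using eq sig_lam[OF x(1) q(1)] sig_lam[OF x(2) q'(1)] q q' by simp
    then have "rho q x = rho q' x'"
      using lam_bij[OF assms] rho_closed x q q' by (meson bij_betw_def inj_on_def)
    then have "r (x, q) = r (x', q')" using q q' by (simp add: r_eq)
    then show "x = x'"
      using bijective x q q' by (auto simp: ybe_bijective_def bij_betw_def inj_on_def)
  qed
  moreover have "sig y ` X \<subseteq> X" using sig_closed assms by blast
  ultimately show ?thesis using finite_X by (simp add: bij_betw_def endo_inj_surj)
qed

section \<open>The action of words on letters and the congruence \<open>E\<close>\<close>

definition lamw :: "'x list \<Rightarrow> 'x \<Rightarrow> 'x"
  where "lamw w q = foldr lam w q"

lemma lamw_simps [simp]:
  "lamw [] q = q" "lamw (x # w) q = lam x (lamw w q)" "lamw (u @ v) q = lamw u (lamw v q)"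
  by (simp_all add: lamw_def)

lemma lamw_bij: "w \<in> lists X \<Longrightarrow> bij_betw (lamw w) X X"
proof (induction w)
  case (Cons x w)
  then have "bij_betw (lam x \<circ> lamw w) X X"
    by (auto intro: bij_betw_trans lam_bij)
  then show ?case by (simp add: comp_def cong: bij_betw_cong)
qed (auto simp: bij_betw_def inj_on_def)

lemma lamw_closed: "w \<in> lists X \<Longrightarrow> q \<in> X \<Longrightarrow> lamw w q \<in> X"
  using lamw_bij bij_betwE by blast

lemma lamw_sig:
  assumes "w \<in> lists X" "x \<in> X" "y \<in> X"
  shows "lamw w (sig y x) = sig (lamw w y) (lamw w x)"
  using assms(1) by induction (use assms lam_sig lamw_closed in auto)

abbreviation "E \<equiv> generated_congruence (free_monoid X) (ybe_relations X r)"

lemma equiv_E: "equiv (lists X) E"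
  by (rule equiv_generated_congruence[OF ybe_relations_words])

lemma E_refl: "w \<in> lists X \<Longrightarrow> (w, w) \<in> E"
  and E_trans [trans]: "(u, v) \<in> E \<Longrightarrow> (v, w) \<in> E \<Longrightarrow> (u, w) \<in> E"
  and E_sym: "(u, v) \<in> E \<Longrightarrow> (v, u) \<in> E"
  and E_words: "(u, v) \<in> E \<Longrightarrow> u \<in> lists X" "(u, v) \<in> E \<Longrightarrow> v \<in> lists X"
  using equiv_E unfolding equiv_def refl_on_def sym_def trans_def by blast+

lemma E_append: "(u, u') \<in> E \<Longrightarrow> (v, v') \<in> E \<Longrightarrow> (u @ v, u' @ v') \<in> E"
  by (rule generated_congruence_append[OF ybe_relations_words])

lemma E_base: "x \<in> X \<Longrightarrow> y \<in> X \<Longrightarrow> ([x, y], [lam x y, rho y x]) \<in> E"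
  using generated_congruence_base[of "ybe_relations X r" "free_monoid X"]
  by (auto simp: ybe_relations_def)

text \<open>Acting equally on \<open>X\<close> is a congruence on words, and \<open>lam_lam\<close>
  says that it contains the defining relations.\<close>

lemma lamw_E:
  assumes "(u, v) \<in> E" "q \<in> X"
  shows "lamw u q = lamw v q"
proof -
  let ?E = "{(u, v) \<in> lists X \<times> lists X. \<forall>q\<in>X. lamw u q = lamw v q}"
  have "congruence (free_monoid X) ?E"
    unfolding congruence_def free_monoid_def
    by (auto intro!: equivI refl_onI symI transI simp: lamw_closed)
  moreover have "ybe_relations X r \<subseteq> ?E"
    by (auto simp: ybe_relations_def lam_closed rho_closed lam_lam)
  ultimately show ?thesis using assms unfolding generated_congruence_def by blast
qed

text \<open>Words are acted on from the right by letters through the additive structure of the structure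
  monoid, \<open>w + y = w \<circ> \<lambda>\<^sub>w\<^sup>-\<^sup>1(y)\<close>.\<close>

definition act :: "'x list \<Rightarrow> 'x \<Rightarrow> 'x list"
  where "act w y = w @ [inv_into X (lamw w) y]"

abbreviation actw :: "'x list \<Rightarrow> 'x list \<Rightarrow> 'x list"
  where "actw \<equiv> foldl act"

text \<open>Every letter has the form \<open>lamw w q\<close>, so in this parametrization
  \<open>act\<close> just appends \<open>q\<close>.\<close>

lemma act_lamw: "w \<in> lists X \<Longrightarrow> q \<in> X \<Longrightarrow> act w (lamw w q) = w @ [q]"
  using lamw_bij[of w] by (simp add: act_def bij_betw_def)

lemma lamw_surj:
  assumes "w \<in> lists X" "y \<in> X"
  obtains q where "q \<in> X" "y = lamw w q"
  using assms lamw_bij[of w] by (auto simp: bij_betw_def)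

lemma act_words: "w \<in> lists X \<Longrightarrow> y \<in> X \<Longrightarrow> act w y \<in> lists X"
  using inv_into_into[of y "lamw w" X] lamw_bij[of w] by (simp add: act_def bij_betw_def)

lemma actw_words: "w \<in> lists X \<Longrightarrow> v \<in> lists X \<Longrightarrow> actw w v \<in> lists X"
  by (induction v arbitrary: w) (auto simp: act_words simp del: in_lists_conv_set)

text \<open>Congruent words act equally on letters, hence \<open>act\<close> appends the same letter
  to both.\<close>

lemma act_cong:
  assumes "(u, v) \<in> E" "y \<in> X"
  shows "(act u y, act v y) \<in> E"
proof -
  note w = E_words[OF assms(1)]
  obtain q where q: "q \<in> X" "y = lamw u q" using lamw_surj w assms by blast
  have "act u y = u @ [q]" "act v y = v @ [q]"
    using act_lamw[OF w(1) q(1)] act_lamw[OF w(2) q(1)] q(2) lamw_E[OF assms(1) q(1)] by auto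
  then show ?thesis using E_append[OF assms(1) E_refl[of "[q]"]] q by simp
qed

lemma actw_cong:
  assumes "(u, v) \<in> E" "w \<in> lists X"
  shows "(actw u w, actw v w) \<in> E"
  using assms(2,1) by (induction w arbitrary: u v) (auto simp: act_cong)

text \<open>After the letters are pulled back along \<open>lamw w\<close>, the two sides are
  \<open>w\<close> followed by the two sides of the defining relation x' q = \<lambda>_x'(q)
  \<rho>_q(x').\<close>

lemma act_swap:
  assumes "w \<in> lists X" "x \<in> X" "y \<in> X"
  shows "(act (act w x) y, act (act w y) (sig y x)) \<in> E"
proof -
  obtain x' where x': "x' \<in> X" "x = lamw w x'" using lamw_surj assms by blast
  obtain y' where y': "y' \<in> X" "y = lamw w y'" using lamw_surj assms by blast
  obtain q where q: "q \<in> X" "y' = lam x' q" using lam_surj x' y' by blast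
  have "act (act w x) y = w @ [x', q]"
    using act_lamw[of "w @ [x']" q] act_lamw[of w x'] assms x' y' q by simp
  moreover have "lamw w (lam y' (rho q x')) = sig y x"
    using lamw_sig[of w x' y'] sig_lam[of x' q] assms x' y' q by simp
  then have "act (act w y) (sig y x) = w @ [y', rho q x']"
    using act_lamw[of "w @ [y']" "rho q x'"] act_lamw[of w y'] assms x' y' q rho_closed by simp
  moreover have "([x', q], [y', rho q x']) \<in> E" using E_base x' q by simp
  ultimately show ?thesis using E_append[OF E_refl[OF assms(1)]] by simp
qed

text \<open>The brace-type law c \<circ> (w + v) = (c \<circ> w) + \<lambda>_c(v). It holds as an
  equality of words, not only modulo \<open>E\<close>.\<close>

lemma append_actw:
  assumes "c \<in> lists X" "w \<in> lists X" "v \<in> lists X"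
  shows "c @ actw w v = actw (c @ w) (map (lamw c) v)"
  using assms(3,2)
proof (induction v arbitrary: w)
  case (Cons y v)
  obtain q where q: "q \<in> X" "y = lamw w q" using lamw_surj Cons by blast
  have "act (c @ w) (lamw c y) = c @ act w y"
    using act_lamw[of w q] act_lamw[of "c @ w" q] assms(1) Cons.prems q by simp
  moreover have "act w y \<in> lists X" using act_words Cons by blast
  ultimately show ?case using Cons.IH[of "act w y"] by simp
qed simp

text \<open>Addition only appends letters. Therefore a sum starting with x is a multiple of x in the
  structure monoid.\<close>

lemma actw_prefix: "\<exists>b. actw w v = w @ b"
proof (induction v arbitrary: w)
  case (Cons y v)
  obtain b where "actw (act w y) v = act w y @ b" using Cons by blast
  then have "actw (act w y) v = w @ (inv_into X (lamw w) y # b)" by (simp add: act_def)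
  then show ?case by auto
qed simp

section \<open>Additive commutation of words\<close>

lemma replicate_words: "x \<in> X \<Longrightarrow> replicate n x \<in> lists X"
  by (auto simp: in_lists_conv_set)

text \<open>Each copy of x that y passes changes y to \<sigma>_x(y). Once \<sigma>_x^n is the
  identity, n x commutes additively with every letter.\<close>

lemma actw_swap_replicate:
  assumes "w \<in> lists X" "x \<in> X" "y \<in> X"
  shows "(actw (act w y) (replicate n x), act (actw w (replicate n x)) ((sig x ^^ n) y)) \<in> E"
  using assms
proof (induction n arbitrary: w y)
  case 0
  then show ?case by (simp add: E_refl act_words)
next
  case (Suc n)
  have "(actw (act (act w y) x) (replicate n x), actw (act (act w x) (sig x y)) (replicate n x)) \<in> E"
    using Suc.prems by (intro actw_cong act_swap replicate_words act_words)
  also have "(actw (act (act w x) (sig x y)) (replicate n x),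
      act (actw (act w x) (replicate n x)) ((sig x ^^ n) (sig x y))) \<in> E"
    using Suc.prems by (intro Suc.IH act_words sig_closed)
  finally show ?case by (simp add: funpow_swap1)
qed

text \<open>Additive centrality. The base word \<open>w\<close> is arbitrary because addition exists
  only as an action on words.\<close>

definition add_central :: "'x list \<Rightarrow> bool"
  where "add_central v \<longleftrightarrow> v \<in> lists X \<and>
    (\<forall>w\<in>lists X. \<forall>y\<in>X. (actw (act w y) v, act (actw w v) y) \<in> E)"

lemma add_central_append:
  assumes "add_central u" "add_central v"
  shows "add_central (u @ v)"
  unfolding add_central_def
proof (intro conjI ballI)
  have w: "u \<in> lists X" "v \<in> lists X" using assms by (auto simp: add_central_def)
  then show "u @ v \<in> lists X" by simp
  fix a y assume a: "a \<in> lists X" "y \<in> X"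
  have "(actw (actw (act a y) u) v, actw (act (actw a u) y) v) \<in> E"
    using assms(1) a w by (intro actw_cong) (auto simp: add_central_def)
  also have "(actw (act (actw a u) y) v, act (actw (actw a u) v) y) \<in> E"
    using assms(2) a w actw_words[of a u] by (auto simp: add_central_def)
  finally show "(actw (act a y) (u @ v), act (actw a (u @ v)) y) \<in> E" by simp
qed

lemma add_central_commute:
  assumes "add_central v" "u \<in> lists X" "w \<in> lists X"
  shows "(actw (actw w u) v, actw (actw w v) u) \<in> E"
  using assms(2,3)
proof (induction u arbitrary: w)
  case Nil
  then show ?case using assms(1) by (auto intro!: E_refl actw_words simp: add_central_def simp del: in_lists_conv_set)
next
  case (Cons y u)
  have "(actw (actw (act w y) u) v, actw (actw (act w y) v) u) \<in> E"
    using Cons by (intro Cons.IH act_words) auto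
  also have "(actw (actw (act w y) v) u, actw (act (actw w v) y) u) \<in> E"
    using assms(1) Cons by (intro actw_cong) (auto simp: add_central_def simp del: in_lists_conv_set)
  finally show ?case by simp
qed

text \<open>To be read additively, as the sum of the multiples k x; \<open>replicate k x\<close>
  does not stand for a power in the structure monoid.\<close>

definition blocks :: "nat \<Rightarrow> 'x list \<Rightarrow> 'x list"
  where "blocks k xs = concat (map (replicate k) xs)"

lemma blocks_simps [simp]:
  "blocks k [] = []" "blocks k (x # xs) = replicate k x @ blocks k xs"
  "blocks k (xs @ ys) = blocks k xs @ blocks k ys"
  by (simp_all add: blocks_def)

lemma map_blocks: "map f (blocks k xs) = blocks k (map f xs)"
  by (induction xs) simp_all

lemma blocks_words: "xs \<in> lists X \<Longrightarrow> blocks k xs \<in> lists X"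
  by (induction xs) (auto simp: replicate_words)

text \<open>The summands k x are additively central, so their order does not matter: the block of
  the head of \<open>xs\<close> is located in \<open>ys\<close> and moved to the front.\<close>

lemma actw_blocks_mset:
  assumes cent: "\<And>x. x \<in> X \<Longrightarrow> add_central (replicate k x)"
    and "xs \<in> lists X" "mset xs = mset ys" "w \<in> lists X"
  shows "(actw w (blocks k xs), actw w (blocks k ys)) \<in> E"
  using assms(2-4)
proof (induction xs arbitrary: ys w)
  case Nil
  then show ?case by (simp add: E_refl)
next
  case (Cons x xs)
  have "x \<in> set ys" using mset_eq_setD[OF Cons.prems(1)] by auto
  then obtain p q where ys: "ys = p @ x # q" by (meson split_list)
  have X: "x \<in> X" "xs \<in> lists X" "p \<in> lists X" "q \<in> lists X"
    using Cons.hyps mset_eq_setD[OF Cons.prems(1)] unfolding ys by (auto simp: in_lists_conv_set)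
  have rx: "replicate k x \<in> lists X" using X(1) by (rule replicate_words)
  have "(actw (actw w (replicate k x)) (blocks k xs), actw (actw w (replicate k x)) (blocks k (p @ q))) \<in> E"
    using Cons.prems X rx by (intro Cons.IH actw_words) (auto simp: ys)
  also have "(actw (actw w (replicate k x)) (blocks k (p @ q)),
      actw (actw (actw w (blocks k p)) (replicate k x)) (blocks k q)) \<in> E"
    using actw_cong[OF E_sym[OF add_central_commute[OF cent[OF X(1)] blocks_words[OF X(3)] Cons.prems(2)]]
        blocks_words[OF X(4)]] by simp
  finally show ?case by (simp add: ys)
qed

text \<open>Centrality makes the powers of \<open>z\<close> admissible denominators; divisibility by
  every letter will make all generators invertible after localization.\<close>

lemma ex_central_word:
  obtains z where "z \<in> lists X"
    "\<And>w. w \<in> lists X \<Longrightarrow> (z @ w, w @ z) \<in> E"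
    "\<And>x. x \<in> X \<Longrightarrow> \<exists>b\<in>lists X. (x # b, z) \<in> E"
proof -
  \<comment> \<open>A common period of all the permutations \<open>sig y\<close>.\<close>
  obtain k where k: "k > 0" "\<And>x y. x \<in> X \<Longrightarrow> y \<in> X \<Longrightarrow> (sig y ^^ k) x = x"
    by (rule finite_family_funpow_fixes[OF finite_X, of "sig ` X"]) (use finite_X sig_bij in auto)
  have cent: "add_central (replicate k x)" if "x \<in> X" for x
    unfolding add_central_def
    using actw_swap_replicate[of _ x _ k] that k(2) by (auto simp: replicate_words)
  obtain xs where xs: "set xs = X" "distinct xs" using finite_distinct_list[OF finite_X] by blast
  have xsX: "xs \<in> lists X" using xs by (auto simp: in_lists_conv_set)
  define zeta where "zeta = actw [] (blocks k xs)"
  have zX: "zeta \<in> lists X" unfolding zeta_def by (intro actw_words blocks_words xsX) simp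
  have cents: "add_central (blocks k ys)" if "ys \<in> lists X" for ys
    using that
  proof induction
    case Nil
    then show ?case by (auto simp: add_central_def intro!: E_refl act_words)
  qed (simp add: add_central_append cent)
  \<comment> \<open>This is c \<circ> \<zeta> = c + \<zeta>: the letters of \<open>xs\<close> are
    all of \<open>X\<close>, and \<lambda>_c merely permutes them.\<close>
  have left: "(c @ zeta, actw c (blocks k xs)) \<in> E" if c: "c \<in> lists X" for c
  proof -
    have "c @ zeta = actw c (blocks k (map (lamw c) xs))"
      unfolding zeta_def using append_actw[OF c, of "[]" "blocks k xs"] blocks_words[OF xsX]
      by (simp add: map_blocks)
    moreover have "mset (map (lamw c) xs) = mset xs"
      using lamw_bij[OF c] xs unfolding bij_betw_def
      by (intro set_eq_iff_mset_eq_distinct[THEN iffD1]) (auto simp: distinct_map)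
    moreover have "map (lamw c) xs \<in> lists X"
      using xs lamw_closed[OF c] by (auto simp: in_lists_conv_set)
    ultimately show ?thesis using actw_blocks_mset[OF cent, of "map (lamw c) xs" xs c] c by simp
  qed
  \<comment> \<open>Turn the product into a sum, commute the central summand \<zeta>, and turn the
    sum back into a product by \<open>left\<close>.\<close>
  have swap: "(zeta @ [x], lamw zeta x # zeta) \<in> E" if x: "x \<in> X" for x
  proof -
    let ?y = "lamw zeta x"
    have y: "?y \<in> X" using lamw_closed zX x by blast
    have "zeta @ [x] = act (actw [] (blocks k xs)) ?y"
      using act_lamw[OF zX x] by (simp add: zeta_def)
    moreover have "(act (actw [] (blocks k xs)) ?y, actw (act [] ?y) (blocks k xs)) \<in> E"
      using cents[OF xsX] y by (auto simp: add_central_def intro: E_sym)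
    moreover have "act [] ?y = [?y]" using act_lamw[of "[]" ?y] y by simp
    moreover have "(actw [?y] (blocks k xs), [?y] @ zeta) \<in> E"
      using left[of "[?y]"] y by (auto intro: E_sym)
    ultimately show ?thesis using E_trans by simp
  qed
  \<comment> \<open>Passing x through one factor \<zeta> applies \<lambda>_\<zeta>; after
    \<open>e\<close> factors x is itself again, so \<zeta>^e is central.\<close>
  obtain e where e: "e > 0" "\<And>x. x \<in> X \<Longrightarrow> (lamw zeta ^^ e) x = x"
    using bij_betw_funpow_fixes[OF finite_X lamw_bij[OF zX]] by blast
  define zz where "zz n = concat (replicate n zeta)" for n
  have zzX: "zz n \<in> lists X" for n using zX by (induction n) (auto simp: zz_def)
  have swap_pow: "(zz n @ [x], (lamw zeta ^^ n) x # zz n) \<in> E" if "x \<in> X" for n x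
    using that
  proof (induction n arbitrary: x)
    case 0
    then show ?case by (simp add: zz_def E_refl)
  next
    case (Suc n)
    let ?y = "(lamw zeta ^^ n) x"
    have y: "?y \<in> X" using Suc.prems lamw_closed[OF zX] by (induction n) auto
    have "(zeta @ (zz n @ [x]), zeta @ (?y # zz n)) \<in> E"
      using Suc by (intro E_append E_refl zX)
    also have "(zeta @ (?y # zz n), lamw zeta ?y # zeta @ zz n) \<in> E"
      using E_append[OF swap[OF y] E_refl[OF zzX[of n]]] by simp
    finally show ?case by (simp add: zz_def)
  qed
  show ?thesis
  proof
    show "zz e \<in> lists X" by (rule zzX)
    show "(zz e @ w, w @ zz e) \<in> E" if "w \<in> lists X" for w
      using that
    proof induction
      case Nil
      then show ?case using zzX by (simp add: E_refl)
    next
      case (Cons x w)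
      have "(zz e @ [x], x # zz e) \<in> E" using swap_pow[of x e] e(2) Cons by simp
      from E_append[OF this E_refl[OF Cons.hyps(2)]]
      have "(zz e @ x # w, x # zz e @ w) \<in> E" by simp
      also have "(x # zz e @ w, x # w @ zz e) \<in> E"
        using E_append[OF E_refl[of "[x]"] Cons.IH] Cons.hyps by simp
      finally show ?case by simp
    qed
    show "\<exists>b\<in>lists X. (x # b, zz e) \<in> E" if x: "x \<in> X" for x
    proof -
      \<comment> \<open>Reordering the sum puts the block of x first; since k > 0, that block begins
        with the letter x.\<close>
      let ?ys = "x # remove1 x xs"
      have ys: "?ys \<in> lists X" using xsX x by (auto simp: in_lists_conv_set dest: notin_set_remove1)
      have "mset ?ys = mset xs" using x xs by simp
      then have "(actw [] (blocks k ?ys), zeta) \<in> E"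
        unfolding zeta_def by (intro actw_blocks_mset cent ys) auto
      moreover have "blocks k ?ys = x # replicate (k - 1) x @ blocks k (remove1 x xs)"
        using k(1) by (cases k) auto
      then have "actw [] (blocks k ?ys) = actw [x] (replicate (k - 1) x @ blocks k (remove1 x xs))"
        using act_lamw[of "[]" x] x by simp
      then obtain b where "actw [] (blocks k ?ys) = x # b"
        using actw_prefix[of "[x]"] by (metis append_Cons append_Nil)
      ultimately have b: "(x # b, zeta) \<in> E" by simp
      then have bX: "b \<in> lists X" using E_words(1) by fastforce
      \<comment> \<open>Uses e > 0: the central word must still contain a factor \<zeta>, which x
        divides.\<close>
      have "zz e = zeta @ zz (e - 1)" using e(1) by (cases e) (auto simp: zz_def)
      then have "(x # b @ zz (e - 1), zz e) \<in> E"
        using E_append[OF b E_refl[OF zzX[of "e - 1"]]] by simp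
      then show ?thesis using bX zzX by (intro bexI[of _ "b @ zz (e - 1)"]) auto
    qed
  qed
qed

end

section \<open>Groups of fractions\<close>

context central_submonoid
begin

text \<open>A fraction a/s is j(a) j(s)^-1 and, by centrality of s, also j(s)^-1 j(a).
  Cancellativity makes j injective.\<close>

lemma is_group_of_quotients_localization:
  assumes canc: "cancellative M" and grp: "group L"
  shows "is_group_of_quotients M L (localization_map M S)"
proof -
  interpret L: group L by (rule grp)
  let ?j = "localization_map M S"
  have jc: "?j a \<in> carrier L" if "a \<in> carrier M" for a
    using that fraction_closed by (simp add: localization_map_eq)
  have inv_j: "inv\<^bsub>L\<^esub> (?j s) = fraction \<one> s" if "s \<in> S" for s
  proof (rule L.inv_equality)
    show "fraction \<one> s \<otimes>\<^bsub>L\<^esub> ?j s = \<one>\<^bsub>L\<^esub>"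
      using that unfolding localization_map_eq one_localization
      by (subst fraction_mult, simp_all, subst fraction_eq_iff) (auto intro!: bexI[of _ \<one>])
  qed (use that jc fraction_closed in auto)
  have "fraction a s = ?j a \<otimes>\<^bsub>L\<^esub> inv\<^bsub>L\<^esub> (?j s)" "fraction a s = inv\<^bsub>L\<^esub> (?j s) \<otimes>\<^bsub>L\<^esub> ?j a"
    if "a \<in> carrier M" "s \<in> S" for a s
    using that by (simp_all only: inv_j) (simp_all add: localization_map_eq fraction_mult)
  then have "carrier L \<subseteq> {?j a \<otimes>\<^bsub>L\<^esub> inv\<^bsub>L\<^esub> (?j b) | a b. a \<in> carrier M \<and> b \<in> carrier M}"
    "carrier L \<subseteq> {inv\<^bsub>L\<^esub> (?j b) \<otimes>\<^bsub>L\<^esub> ?j a | a b. a \<in> carrier M \<and> b \<in> carrier M}"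
    unfolding carrier_localization using S_in_carrier by blast+
  moreover have "inj_on ?j (carrier M)"
  proof (rule inj_onI)
    fix a b assume ab: "a \<in> carrier M" "b \<in> carrier M" "?j a = ?j b"
    then obtain u where "u \<in> S" "a \<otimes> u = b \<otimes> u"
      by (auto simp: localization_map_eq fraction_eq_iff)
    then show "a = b" using canc ab S_in_carrier unfolding cancellative_def by blast
  qed
  ultimately show ?thesis
    unfolding is_group_of_quotients_def using grp localization_map_hom jc by auto
qed

text \<open>The inner product a' b' is central and slides out, leaving (a b)(a' b').\<close>

lemma divides_S_mult:
  assumes "a \<in> carrier M" "b \<in> carrier M" "a \<otimes> b \<in> S"
    and "a' \<in> carrier M" "b' \<in> carrier M" "a' \<otimes> b' \<in> S"
  shows "(a \<otimes> a') \<otimes> (b' \<otimes> b) \<in> S"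
proof -
  have "(a \<otimes> a') \<otimes> (b' \<otimes> b) = a \<otimes> ((a' \<otimes> b') \<otimes> b)" using assms by (simp add: m_assoc)
  also have "\<dots> = (a \<otimes> b) \<otimes> (a' \<otimes> b')"
    using assms S_comm[OF assms(6), of b] by (simp add: m_assoc)
  finally show ?thesis using S_mult_closed[OF assms(3,6)] by simp
qed

end

text \<open>An abstract description of \<open>G\<close> as the localization of a possibly
  noncancellative \<open>M\<close> at \<open>S\<close>. Both the statement on the cancellative
  quotient and the one on prime ideals are derived from it.\<close>

locale monoid_fractions = central_submonoid M S + G: group G
  for M :: "('a, 'b) monoid_scheme" (structure) and S and G :: "('g, 'c) monoid_scheme" +
  fixes \<iota> :: "'a \<Rightarrow> 'g"
  assumes iota_hom: "\<iota> \<in> hom M G"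
    and iota_eqD: "\<lbrakk>a \<in> carrier M; b \<in> carrier M; \<iota> a = \<iota> b\<rbrakk> \<Longrightarrow> \<exists>s\<in>S. a \<otimes> s = b \<otimes> s"
    and iota_fractions: "g \<in> carrier G \<Longrightarrow> \<exists>a\<in>carrier M. \<exists>s\<in>S. g \<otimes>\<^bsub>G\<^esub> \<iota> s = \<iota> a"
begin

lemma iota_closed [simp]: "a \<in> carrier M \<Longrightarrow> \<iota> a \<in> carrier G"
  and iota_mult: "a \<in> carrier M \<Longrightarrow> b \<in> carrier M \<Longrightarrow> \<iota> (a \<otimes> b) = \<iota> a \<otimes>\<^bsub>G\<^esub> \<iota> b"
  using iota_hom by (auto simp: hom_def)

lemma iota_one: "\<iota> \<one> = \<one>\<^bsub>G\<^esub>"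
  using iota_mult[of \<one> \<one>] G.r_cancel_one[of "\<iota> \<one>" "\<iota> \<one>"] by simp

lemma iota_eqI:
  assumes "a \<in> carrier M" "b \<in> carrier M" "c \<in> carrier M" "a \<otimes> c = b \<otimes> c"
  shows "\<iota> a = \<iota> b"
  using iota_mult[of a c] iota_mult[of b c] assms by (metis G.right_cancel iota_closed)

text \<open>Write g as a fraction with denominator t, commute numerators in \<open>M\<close>, and
  cancel \<iota>(t) in the group.\<close>

lemma iota_central:
  assumes "s \<in> S" "g \<in> carrier G"
  shows "\<iota> s \<otimes>\<^bsub>G\<^esub> g = g \<otimes>\<^bsub>G\<^esub> \<iota> s"
proof -
  obtain a t where at: "a \<in> carrier M" "t \<in> S" "g \<otimes>\<^bsub>G\<^esub> \<iota> t = \<iota> a"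
    using iota_fractions assms by blast
  have "\<iota> s \<otimes>\<^bsub>G\<^esub> g \<otimes>\<^bsub>G\<^esub> \<iota> t = \<iota> (s \<otimes> a)"
    using assms at by (simp add: iota_mult G.m_assoc)
  also have "\<dots> = \<iota> a \<otimes>\<^bsub>G\<^esub> \<iota> s"
    using assms at by (simp add: S_comm iota_mult)
  also have "\<dots> = g \<otimes>\<^bsub>G\<^esub> (\<iota> t \<otimes>\<^bsub>G\<^esub> \<iota> s)"
    using assms at by (simp add: G.m_assoc flip: at(3))
  also have "\<iota> t \<otimes>\<^bsub>G\<^esub> \<iota> s = \<iota> s \<otimes>\<^bsub>G\<^esub> \<iota> t"
    using assms at S_comm[of t s] iota_mult[of t s] iota_mult[of s t] by simp
  also have "g \<otimes>\<^bsub>G\<^esub> (\<iota> s \<otimes>\<^bsub>G\<^esub> \<iota> t) = g \<otimes>\<^bsub>G\<^esub> \<iota> s \<otimes>\<^bsub>G\<^esub> \<iota> t"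
    using assms at by (simp add: G.m_assoc)
  finally show ?thesis using assms at by simp
qed

text \<open>If the inverse of \<iota>(a) is the fraction b/s, then \<iota>(a b) = \<iota>(s). Hence
  a b t = s t for some t in \<open>S\<close>, and a divides this element of
  \<open>S\<close>.\<close>

lemma divides_S:
  assumes "a \<in> carrier M"
  shows "\<exists>b\<in>carrier M. a \<otimes> b \<in> S"
proof -
  obtain b s where b: "b \<in> carrier M" "s \<in> S" "inv\<^bsub>G\<^esub> (\<iota> a) \<otimes>\<^bsub>G\<^esub> \<iota> s = \<iota> b"
    using iota_fractions[of "inv\<^bsub>G\<^esub> (\<iota> a)"] assms by auto
  then have "\<iota> (a \<otimes> b) = \<iota> s"
    using assms iota_mult[of a b] by (metis G.inv_solve_left' S_in_carrier iota_closed)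
  then obtain t where "t \<in> S" "a \<otimes> b \<otimes> t = s \<otimes> t"
    using iota_eqD[of "a \<otimes> b" s] assms b by auto
  then show ?thesis using assms b by (intro bexI[of _ "b \<otimes> t"]) (auto simp: m_assoc)
qed

section \<open>The cancellative quotient and its localization\<close>

abbreviation "\<eta> \<equiv> cancellative_congruence M"
abbreviation "M' \<equiv> quotient_monoid M \<eta>"

definition cls where "cls a = \<eta> `` {a}"

text \<open>One inclusion cancels in the group, the other is \<open>iota_eqD\<close>. As the kernel
  of \<iota>, \<eta> is a congruence, and the quotient inherits cancellation from
  \<open>G\<close>.\<close>

lemma cancellative_congruence_eq:
  "\<eta> = {(a, b) \<in> carrier M \<times> carrier M. \<iota> a = \<iota> b}"
proof -
  have "(\<exists>c\<in>carrier M. a \<otimes> c = b \<otimes> c) \<longleftrightarrow> \<iota> a = \<iota> b" if ab: "a \<in> carrier M" "b \<in> carrier M" for a b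
  proof
    assume "\<exists>c\<in>carrier M. a \<otimes> c = b \<otimes> c"
    then obtain c where "c \<in> carrier M" "a \<otimes> c = b \<otimes> c" by blast
    then show "\<iota> a = \<iota> b" by (rule iota_eqI[OF ab])
  next
    assume "\<iota> a = \<iota> b"
    then obtain s where "s \<in> S" "a \<otimes> s = b \<otimes> s" using iota_eqD[OF ab] by blast
    then show "\<exists>c\<in>carrier M. a \<otimes> c = b \<otimes> c" using S_in_carrier by blast
  qed
  then show ?thesis unfolding cancellative_congruence_def by auto
qed

lemma congruence_eta: "congruence M \<eta>"
  unfolding congruence_def cancellative_congruence_eq
  by (auto intro!: equivI refl_onI symI transI simp: iota_mult)

lemma cls_eq_iff: "a \<in> carrier M \<Longrightarrow> b \<in> carrier M \<Longrightarrow> cls a = cls b \<longleftrightarrow> \<iota> a = \<iota> b"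
  unfolding cls_def
  using eq_equiv_class_iff[of "carrier M" \<eta> a b] congruence_eta
  by (auto simp: congruence_def cancellative_congruence_eq)

lemma cls_mult: "a \<in> carrier M \<Longrightarrow> b \<in> carrier M \<Longrightarrow> cls a \<otimes>\<^bsub>M'\<^esub> cls b = cls (a \<otimes> b)"
  unfolding cls_def by (rule congruence_quotient_mult[OF congruence_eta])

lemma carrier_M': "carrier M' = cls ` carrier M"
  by (auto simp: quotient_monoid_def quotient_def cls_def)

lemma one_M': "\<one>\<^bsub>M'\<^esub> = cls \<one>"
  by (simp add: quotient_monoid_def cls_def)

lemma cancellative_M': "cancellative M'"
  unfolding cancellative_def carrier_M' by (auto simp: cls_mult cls_eq_iff iota_mult)

lemma monoid_M': "monoid M'"
  by (rule monoid_quotient_monoid[OF monoid_axioms congruence_eta])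

lemma cls_center: "s \<in> S \<Longrightarrow> cls s \<in> monoid_center M'"
  unfolding monoid_center_def carrier_M' by (auto simp: cls_mult S_comm)

lemma central_submonoid_M': "central_submonoid M' (cls ` S)"
proof (intro central_submonoid.intro central_submonoid_axioms.intro monoid_M')
  show "submonoid (cls ` S) M'"
  proof
    show "cls ` S \<subseteq> carrier M'" unfolding carrier_M' by (intro image_mono subsetI S_in_carrier)
    show "\<one>\<^bsub>M'\<^esub> \<in> cls ` S" unfolding one_M' by (intro imageI one_in_S)
    fix x y assume "x \<in> cls ` S" "y \<in> cls ` S"
    then obtain s t where "s \<in> S" "t \<in> S" "x = cls s" "y = cls t" by blast
    then show "x \<otimes>\<^bsub>M'\<^esub> y \<in> cls ` S" by (simp add: cls_mult)
  qed
  show "cls ` S \<subseteq> monoid_center M'" using cls_center by blast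
qed

lemma iso_localization_M': "G \<cong> central_localization M' (cls ` S)"
proof -
  interpret Q: central_submonoid M' "cls ` S" by (rule central_submonoid_M')
  define frac where "frac a s = Q.fraction (cls a) (cls s)" for a s
  \<comment> \<open>\<open>h\<close> sends g to an arbitrarily chosen fraction representing it; the
    fact \<open>h\<close> below proves independence of the choice.\<close>
  define h where "h g = (let (a, s) = SOME (a, s). a \<in> carrier M \<and> s \<in> S \<and> g \<otimes>\<^bsub>G\<^esub> \<iota> s = \<iota> a in frac a s)" for g
  \<comment> \<open>The auxiliary factor in the fraction relation disappears because its image under
    \<iota> cancels in \<open>G\<close>.\<close>
  have frac_eq: "frac a s = frac b t \<longleftrightarrow> \<iota> a \<otimes>\<^bsub>G\<^esub> \<iota> t = \<iota> b \<otimes>\<^bsub>G\<^esub> \<iota> s"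
    if "a \<in> carrier M" "s \<in> S" "b \<in> carrier M" "t \<in> S" for a s b t
  proof -
    have "cls a \<otimes>\<^bsub>M'\<^esub> cls t \<otimes>\<^bsub>M'\<^esub> cls u = cls b \<otimes>\<^bsub>M'\<^esub> cls s \<otimes>\<^bsub>M'\<^esub> cls u \<longleftrightarrow>
        \<iota> a \<otimes>\<^bsub>G\<^esub> \<iota> t = \<iota> b \<otimes>\<^bsub>G\<^esub> \<iota> s" if u: "u \<in> S" for u
      using \<open>a \<in> carrier M\<close> \<open>s \<in> S\<close> \<open>b \<in> carrier M\<close> \<open>t \<in> S\<close> u
      by (simp add: cls_mult cls_eq_iff iota_mult)
    moreover have "frac a s = frac b t \<longleftrightarrow>
        (\<exists>u\<in>S. cls a \<otimes>\<^bsub>M'\<^esub> cls t \<otimes>\<^bsub>M'\<^esub> cls u = cls b \<otimes>\<^bsub>M'\<^esub> cls s \<otimes>\<^bsub>M'\<^esub> cls u)"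
      unfolding frac_def using that by (subst Q.fraction_eq_iff) (simp_all add: carrier_M')
    ultimately show ?thesis using one_in_S by blast
  qed
  have h: "h g = frac a s" if "a \<in> carrier M" "s \<in> S" "g \<otimes>\<^bsub>G\<^esub> \<iota> s = \<iota> a" "g \<in> carrier G" for g a s
  proof -
    obtain b t where bt: "(SOME (a, s). a \<in> carrier M \<and> s \<in> S \<and> g \<otimes>\<^bsub>G\<^esub> \<iota> s = \<iota> a) = (b, t)" by fastforce
    with someI[of "\<lambda>(a, s). a \<in> carrier M \<and> s \<in> S \<and> g \<otimes>\<^bsub>G\<^esub> \<iota> s = \<iota> a" "(a, s)"] that
    have b: "b \<in> carrier M" "t \<in> S" "g \<otimes>\<^bsub>G\<^esub> \<iota> t = \<iota> b" by auto
    have "\<iota> b \<otimes>\<^bsub>G\<^esub> \<iota> s = g \<otimes>\<^bsub>G\<^esub> (\<iota> t \<otimes>\<^bsub>G\<^esub> \<iota> s)"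
      using that b by (simp add: b(3)[symmetric] G.m_assoc)
    also have "\<dots> = \<iota> a \<otimes>\<^bsub>G\<^esub> \<iota> t"
      using that b iota_central[of t "\<iota> s"] by (simp add: that(3)[symmetric] G.m_assoc)
    finally show ?thesis using that b bt by (simp add: h_def frac_eq)
  qed
  have carL: "carrier (central_localization M' (cls ` S)) = {frac a s | a s. a \<in> carrier M \<and> s \<in> S}"
    unfolding Q.carrier_localization frac_def carrier_M' by blast
  have "h \<in> iso G (central_localization M' (cls ` S))"
  proof (rule isoI)
    show "h \<in> hom G (central_localization M' (cls ` S))"
    proof (rule homI)
      fix g assume "g \<in> carrier G"
      then show "h g \<in> carrier (central_localization M' (cls ` S))"
        unfolding carL using iota_fractions[of g] h by blast
    next
      fix g g' assume g: "g \<in> carrier G" "g' \<in> carrier G"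
      obtain a s where a: "a \<in> carrier M" "s \<in> S" "g \<otimes>\<^bsub>G\<^esub> \<iota> s = \<iota> a" using iota_fractions g by blast
      obtain b t where b: "b \<in> carrier M" "t \<in> S" "g' \<otimes>\<^bsub>G\<^esub> \<iota> t = \<iota> b" using iota_fractions g by blast
      have "g \<otimes>\<^bsub>G\<^esub> g' \<otimes>\<^bsub>G\<^esub> \<iota> (s \<otimes> t) = g \<otimes>\<^bsub>G\<^esub> (g' \<otimes>\<^bsub>G\<^esub> \<iota> s) \<otimes>\<^bsub>G\<^esub> \<iota> t"
        using a b g by (simp add: iota_mult G.m_assoc)
      also have "\<dots> = \<iota> (a \<otimes> b)"
        using a(1,2) b(1,2) g by (simp add: iota_mult iota_central[OF a(2) g(2), symmetric] a(3)[symmetric] b(3)[symmetric] G.m_assoc)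
      finally have "h (g \<otimes>\<^bsub>G\<^esub> g') = frac (a \<otimes> b) (s \<otimes> t)" using a b g by (intro h) auto
      also have "\<dots> = frac a s \<otimes>\<^bsub>central_localization M' (cls ` S)\<^esub> frac b t"
        unfolding frac_def using a b by (subst Q.fraction_mult) (auto simp: carrier_M' cls_mult)
      also have "\<dots> = h g \<otimes>\<^bsub>central_localization M' (cls ` S)\<^esub> h g'"
        by (simp only: h[OF a g(1)] h[OF b g(2)])
      finally show "h (g \<otimes>\<^bsub>G\<^esub> g') = h g \<otimes>\<^bsub>central_localization M' (cls ` S)\<^esub> h g'" .
    qed
    show "bij_betw h (carrier G) (carrier (central_localization M' (cls ` S)))"
      unfolding bij_betw_def
    proof
      show "inj_on h (carrier G)"
      proof (rule inj_onI)
        fix g g' assume g: "g \<in> carrier G" "g' \<in> carrier G" and eq: "h g = h g'"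
        obtain a s where a: "a \<in> carrier M" "s \<in> S" "g \<otimes>\<^bsub>G\<^esub> \<iota> s = \<iota> a" using iota_fractions g by blast
        obtain b t where b: "b \<in> carrier M" "t \<in> S" "g' \<otimes>\<^bsub>G\<^esub> \<iota> t = \<iota> b" using iota_fractions g by blast
        have "\<iota> a \<otimes>\<^bsub>G\<^esub> \<iota> t = \<iota> b \<otimes>\<^bsub>G\<^esub> \<iota> s" 
          using eq h[OF a g(1)] h[OF b g(2)] frac_eq[OF a(1,2) b(1,2)] by simp
        then have "g \<otimes>\<^bsub>G\<^esub> (\<iota> s \<otimes>\<^bsub>G\<^esub> \<iota> t) = g' \<otimes>\<^bsub>G\<^esub> (\<iota> s \<otimes>\<^bsub>G\<^esub> \<iota> t)"
          using a(1,2) b(1,2) g iota_central[of s "\<iota> t"] by (simp add: a(3)[symmetric] b(3)[symmetric] G.m_assoc)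
        then show "g = g'" using a b g by simp
      qed
      have "frac a s \<in> h ` carrier G" if "a \<in> carrier M" "s \<in> S" for a s
        using that h[of a s "\<iota> a \<otimes>\<^bsub>G\<^esub> inv\<^bsub>G\<^esub> (\<iota> s)"]
        by (intro image_eqI[of _ _ "\<iota> a \<otimes>\<^bsub>G\<^esub> inv\<^bsub>G\<^esub> (\<iota> s)"]) (auto simp: G.m_assoc)
      moreover have "h g \<in> {frac a s | a s. a \<in> carrier M \<and> s \<in> S}" if "g \<in> carrier G" for g
        using iota_fractions[of g] h that by blast
      ultimately show "h ` carrier G = carrier (central_localization M' (cls ` S))"
        unfolding carL by blast
    qed
  qed
  then show ?thesis by (rule is_isoI)
qed

lemma group_of_quotients_M':
  "is_group_of_quotients M' (central_localization M' (cls ` S)) (localization_map M' (cls ` S))"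
proof -
  interpret Q: central_submonoid M' "cls ` S" by (rule central_submonoid_M')
  show ?thesis
    by (intro Q.is_group_of_quotients_localization cancellative_M'
        G.iso_imp_group iso_localization_M' Q.monoid_localization)
qed

text \<open>Identifies the image of the denominators with the powers of a single central element of
  the quotient.\<close>

lemma powers_of_cls:
  assumes "z \<in> carrier M"
  shows "powers_of M' (cls z) = cls ` powers_of M z"
proof -
  interpret M': monoid M' by (rule monoid_M')
  have "cls z [^]\<^bsub>M'\<^esub> n = cls (z [^] n)" for n :: nat
    using assms by (induction n) (auto simp: one_M' cls_mult)
  then show ?thesis by (auto simp: powers_of_def)
qed

end

lemma (in monoid) central_submonoid_powers:
  assumes "z \<in> monoid_center G"
  shows "central_submonoid G (powers_of G z)"
proof (intro central_submonoid.intro central_submonoid_axioms.intro monoid_axioms)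
  have z: "z \<in> carrier G" and comm: "\<And>a. a \<in> carrier G \<Longrightarrow> z \<otimes> a = a \<otimes> z"
    using assms by (auto simp: monoid_center_def)
  show "submonoid (powers_of G z) G"
  proof unfold_locales
    show "powers_of G z \<subseteq> carrier G" using z by (auto simp: powers_of_def)
    show "\<one> \<in> powers_of G z" unfolding powers_of_def by (rule range_eqI[of _ _ 0]) simp
    show "x \<otimes> y \<in> powers_of G z" if "x \<in> powers_of G z" "y \<in> powers_of G z" for x y
      using that nat_pow_mult[OF z] unfolding powers_of_def by auto
  qed
  have "z [^] n \<otimes> a = a \<otimes> z [^] n" if "a \<in> carrier G" for n :: nat and a
  proof (induction n)
    case (Suc n)
    have "z [^] Suc n \<otimes> a = z [^] n \<otimes> (a \<otimes> z)" using z that comm by (simp add: m_assoc)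
    also have "\<dots> = a \<otimes> z [^] Suc n"
      using Suc z that by (metis m_assoc nat_pow_Suc nat_pow_closed)
    finally show ?case .
  qed (use that in simp)
  then show "powers_of G z \<subseteq> monoid_center G"
    using z by (auto simp: powers_of_def monoid_center_def)
qed

section \<open>The structure monoid and the structure group\<close>

context finite_bijective_lnd_solution
begin

definition wcls where "wcls w = E `` {w}"

definition gcls where
  "gcls w = generated_congruence (free_monoid (X \<times> (UNIV :: bool set)))
     (group_relations X (ybe_relations X r)) `` {w}"

abbreviation pos :: "'x list \<Rightarrow> ('x \<times> bool) list" where "pos \<equiv> map (\<lambda>x. (x, True))"

abbreviation "SM \<equiv> structure_monoid X r"
abbreviation "SG \<equiv> structure_group X r"

lemma wcls_eq: "(u, v) \<in> E \<Longrightarrow> wcls u = wcls v"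
  unfolding wcls_def by (rule equiv_class_eq[OF equiv_E])

lemma wcls_mult: "u \<in> lists X \<Longrightarrow> v \<in> lists X \<Longrightarrow> wcls u \<otimes>\<^bsub>SM\<^esub> wcls v = wcls (u @ v)"
  unfolding wcls_def structure_monoid_def by (rule mult_presented_monoid[OF ybe_relations_words])

lemma carrier_SM: "carrier SM = wcls ` lists X"
  by (auto simp: structure_monoid_def carrier_presented_monoid wcls_def quotient_def)

lemma one_SM: "\<one>\<^bsub>SM\<^esub> = wcls []"
  by (simp add: structure_monoid_def one_presented_monoid wcls_def)

lemma equiv_gcls:
  "equiv (lists (X \<times> UNIV)) (generated_congruence (free_monoid (X \<times> (UNIV :: bool set)))
     (group_relations X (ybe_relations X r)))"
  by (rule equiv_generated_congruence[OF group_relations_words[OF ybe_relations_words]])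

lemma gcls_mult:
  "u \<in> lists (X \<times> UNIV) \<Longrightarrow> v \<in> lists (X \<times> UNIV) \<Longrightarrow> gcls u \<otimes>\<^bsub>SG\<^esub> gcls v = gcls (u @ v)"
  unfolding gcls_def structure_group_def presented_group_eq
  by (rule mult_presented_monoid[OF group_relations_words[OF ybe_relations_words]])

lemma carrier_SG: "carrier SG = gcls ` lists (X \<times> UNIV)"
  by (auto simp: structure_group_def presented_group_eq carrier_presented_monoid gcls_def quotient_def)

lemma one_SG: "\<one>\<^bsub>SG\<^esub> = gcls []"
  by (simp add: structure_group_def presented_group_eq one_presented_monoid gcls_def)

lemma gcls_relation:
  assumes "(u, v) \<in> group_relations X (ybe_relations X r)"
  shows "gcls u = gcls v"
  unfolding gcls_def
  using assms generated_congruence_base by (intro equiv_class_eq[OF equiv_gcls]) blast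

lemma pos_words: "w \<in> lists X \<Longrightarrow> pos w \<in> lists (X \<times> UNIV)"
  by (auto simp: in_lists_conv_set)

text \<open>The localization of \<open>SM\<close> serves to detect equality: a homomorphism from
  \<open>SG\<close> to it shows that \<iota> identifies no more than the localization map does. That
  every group element is a fraction is checked on words.\<close>

lemma ex_monoid_fractions:
  obtains z \<iota> where "z \<in> monoid_center SM" "monoid_fractions SM (powers_of SM z) SG \<iota>"
proof -
  interpret SM: monoid SM by (rule monoid_structure_monoid)
  interpret SG: group SG by (rule group_structure_group)
  obtain zw where zw: "zw \<in> lists X" "\<And>w. w \<in> lists X \<Longrightarrow> (zw @ w, w @ zw) \<in> E"
    "\<And>x. x \<in> X \<Longrightarrow> \<exists>b\<in>lists X. (x # b, zw) \<in> E" using ex_central_word by blast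
  define z where "z = wcls zw"
  have z: "z \<in> monoid_center SM"
    unfolding monoid_center_def carrier_SM z_def using zw wcls_mult wcls_eq by auto
  interpret central_submonoid SM "powers_of SM z" by (rule SM.central_submonoid_powers[OF z])
  have zS: "z \<in> powers_of SM z"
  proof -
    have "z \<in> carrier SM" using zw(1) by (simp add: z_def carrier_SM)
    then have "z = z [^]\<^bsub>SM\<^esub> (1 :: nat)" by simp
    then show ?thesis unfolding powers_of_def by (rule range_eqI)
  qed
  have gen: "\<exists>b\<in>carrier SM. wcls [x] \<otimes>\<^bsub>SM\<^esub> b \<in> powers_of SM z" if x: "x \<in> X" for x
  proof -
    obtain b where b: "b \<in> lists X" "(x # b, zw) \<in> E" using zw(3)[OF x] by blast
    then have "wcls [x] \<otimes>\<^bsub>SM\<^esub> wcls b = z" using wcls_mult[of "[x]" b] wcls_eq[OF b(2)] x by (simp add: z_def)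
    then show ?thesis using b zS by (intro bexI[of _ "wcls b"]) (auto simp: carrier_SM)
  qed
  have dvd: "\<exists>b\<in>carrier SM. a \<otimes>\<^bsub>SM\<^esub> b \<in> powers_of SM z" if "a \<in> carrier SM" for a
  proof -
    have "\<exists>b\<in>carrier SM. wcls w \<otimes>\<^bsub>SM\<^esub> b \<in> powers_of SM z" if "w \<in> lists X" for w
      using that
    proof induction
      case Nil
      then show ?case using zS S_in_carrier by (intro bexI[of _ z]) (auto simp flip: one_SM)
    next
      case (Cons x w)
      then obtain b b' where b: "b \<in> carrier SM" "wcls [x] \<otimes>\<^bsub>SM\<^esub> b \<in> powers_of SM z"
        "b' \<in> carrier SM" "wcls w \<otimes>\<^bsub>SM\<^esub> b' \<in> powers_of SM z" using gen by blast
      then have "(wcls [x] \<otimes>\<^bsub>SM\<^esub> wcls w) \<otimes>\<^bsub>SM\<^esub> (b' \<otimes>\<^bsub>SM\<^esub> b) \<in> powers_of SM z"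
        using Cons.hyps by (intro divides_S_mult) (auto simp: carrier_SM)
      then show ?case using b Cons.hyps wcls_mult[of "[x]" w] by (intro bexI[of _ "b' \<otimes>\<^bsub>SM\<^esub> b"]) auto
    qed
    then show ?thesis using that unfolding carrier_SM by blast
  qed
  have Lgrp: "group L" using dvd by (rule group_localization)
  then interpret L: group L .
  obtain \<iota> where \<iota>: "\<iota> \<in> hom SM SG" "\<And>w. w \<in> lists X \<Longrightarrow> \<iota> (wcls w) = gcls (pos w)"
  proof -
    have f: "(\<lambda>x. gcls [(x, True)]) \<in> X \<rightarrow> carrier SG" by (auto simp: carrier_SG)
    have ev: "word_eval SG (\<lambda>x. gcls [(x, True)]) w = gcls (pos w)" if "w \<in> lists X" for w
      using that
    proof induction
      case (Cons x w)
      then show ?case using gcls_mult[of "[(x, True)]" "pos w"] pos_words by (simp add: word_eval_def)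
    qed (simp add: word_eval_def one_SG)
    have rel: "word_eval SG (\<lambda>x. gcls [(x, True)]) u = word_eval SG (\<lambda>x. gcls [(x, True)]) v"
      if "(u, v) \<in> ybe_relations X r" for u v
      using that ybe_relations_words ev gcls_relation[of "pos u" "pos v"]
      by (auto simp: group_relations_def)
    from SG.presented_monoid_hom[OF ybe_relations_words f rel] that ev show thesis
      unfolding wcls_def structure_monoid_def by metis
  qed
  \<comment> \<open>The universal property of the group, applied to the localization: composed with
    \<iota>, \<open>h\<close> is the localization map.\<close>
  obtain h where h: "\<And>w. w \<in> lists X \<Longrightarrow> h (gcls (pos w)) = localization_map SM (powers_of SM z) (wcls w)"
  proof -
    let ?j = "localization_map SM (powers_of SM z)"
    have j: "?j a \<in> carrier L" "?j (a \<otimes>\<^bsub>SM\<^esub> b) = ?j a \<otimes>\<^bsub>L\<^esub> ?j b"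
      if "a \<in> carrier SM" "b \<in> carrier SM" for a b
      using localization_map_hom that by (auto simp: hom_def)
    have f: "(\<lambda>x. ?j (wcls [x])) \<in> X \<rightarrow> carrier L"
      by (rule Pi_I, rule j(1)[OF _ SM.one_closed]) (simp add: carrier_SM)
    have ev: "word_eval L (\<lambda>x. ?j (wcls [x])) w = ?j (wcls w)" if "w \<in> lists X" for w
      using that
    proof induction
      case Nil
      then show ?case by (simp add: word_eval_def one_localization localization_map_eq flip: one_SM)
    next
      case (Cons x w)
      then show ?case using wcls_mult[of "[x]" w] j(2)[of "wcls [x]" "wcls w"]
        by (simp add: word_eval_def carrier_SM)
    qed
    have rel: "word_eval L (\<lambda>x. ?j (wcls [x])) u = word_eval L (\<lambda>x. ?j (wcls [x])) v"
      if "(u, v) \<in> ybe_relations X r" for u v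
    proof -
      have "u \<in> lists X" "v \<in> lists X" using that ybe_relations_words by auto
      moreover have "wcls u = wcls v" using that generated_congruence_base by (intro wcls_eq) blast
      ultimately show ?thesis by (simp add: ev)
    qed
    from L.presented_group_hom[OF ybe_relations_words f rel] that ev show thesis
      unfolding gcls_def by metis
  qed
  have "monoid_fractions SM (powers_of SM z) SG \<iota>"
  proof unfold_locales
    show "\<iota> \<in> hom SM SG" by (rule \<iota>)
    fix a b assume "a \<in> carrier SM" "b \<in> carrier SM" and eq: "\<iota> a = \<iota> b"
    then obtain u v where uv: "u \<in> lists X" "a = wcls u" "v \<in> lists X" "b = wcls v"
      unfolding carrier_SM by blast
    then have "localization_map SM (powers_of SM z) a = localization_map SM (powers_of SM z) b"
      using eq h \<iota>(2) by metis
    then show "\<exists>s\<in>powers_of SM z. a \<otimes>\<^bsub>SM\<^esub> s = b \<otimes>\<^bsub>SM\<^esub> s"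
      using uv by (auto simp: localization_map_eq fraction_eq_iff carrier_SM)
  next
    have ic: "\<iota> a \<in> carrier SG" "\<iota> (a \<otimes>\<^bsub>SM\<^esub> b) = \<iota> a \<otimes>\<^bsub>SG\<^esub> \<iota> b"
      if "a \<in> carrier SM" "b \<in> carrier SM" for a b using \<iota>(1) that by (auto simp: hom_def)
    let ?P = "\<lambda>g. \<exists>a\<in>carrier SM. \<exists>s\<in>powers_of SM z. g \<otimes>\<^bsub>SG\<^esub> \<iota> s = \<iota> a"
    \<comment> \<open>\<open>iota_central\<close> rests on the property being proved, so the
      denominator s is commuted inside \<open>SM\<close>, with t and with b, rather than in the
      group.\<close>
    have mult: "?P (g \<otimes>\<^bsub>SG\<^esub> g')" if g: "g \<in> carrier SG" "g' \<in> carrier SG" and P: "?P g" "?P g'" for g g'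
    proof -
      obtain a s b t where a: "a \<in> carrier SM" "s \<in> powers_of SM z" "g \<otimes>\<^bsub>SG\<^esub> \<iota> s = \<iota> a"
        and b: "b \<in> carrier SM" "t \<in> powers_of SM z" "g' \<otimes>\<^bsub>SG\<^esub> \<iota> t = \<iota> b" using P by blast
      note car = a(1,2) b(1,2) g S_in_carrier[OF a(2)] S_in_carrier[OF b(2)]
      have "g' \<otimes>\<^bsub>SG\<^esub> \<iota> (s \<otimes>\<^bsub>SM\<^esub> t) = g' \<otimes>\<^bsub>SG\<^esub> \<iota> (t \<otimes>\<^bsub>SM\<^esub> s)"
        using car S_comm[of s t] by simp
      also have "\<dots> = \<iota> b \<otimes>\<^bsub>SG\<^esub> \<iota> s"
        using car by (simp add: ic SG.m_assoc flip: b(3))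
      also have "\<dots> = \<iota> s \<otimes>\<^bsub>SG\<^esub> \<iota> b"
        using car S_comm[of s b] ic(2)[of s b] ic(2)[of b s] by simp
      finally have "g \<otimes>\<^bsub>SG\<^esub> g' \<otimes>\<^bsub>SG\<^esub> \<iota> (s \<otimes>\<^bsub>SM\<^esub> t) = g \<otimes>\<^bsub>SG\<^esub> (\<iota> s \<otimes>\<^bsub>SG\<^esub> \<iota> b)"
        using car by (simp add: ic SG.m_assoc)
      also have "\<dots> = \<iota> (a \<otimes>\<^bsub>SM\<^esub> b)"
        using car by (simp add: ic SG.m_assoc flip: a(3))
      finally show ?thesis using a b by (intro bexI[of _ "a \<otimes>\<^bsub>SM\<^esub> b"] bexI[of _ "s \<otimes>\<^bsub>SM\<^esub> t"]) auto
    qed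
    \<comment> \<open>If x b is a power of z, then x^-1 is the fraction with numerator b and
      denominator x b; for x itself the denominator z serves.\<close>
    have letter: "?P (gcls [(x, e)])" if x: "x \<in> X" for x e
    proof -
      have xc: "wcls [x] \<in> carrier SM" using x by (auto simp: carrier_SM)
      have ix: "\<iota> (wcls [x]) = gcls [(x, True)]" using \<iota>(2)[of "[x]"] x by simp
      obtain b where b: "b \<in> carrier SM" "wcls [x] \<otimes>\<^bsub>SM\<^esub> b \<in> powers_of SM z" using gen x by blast
      have gc: "gcls [(x, e)] \<in> carrier SG" for e using x by (auto simp: carrier_SG)
      have "gcls [(x, False)] \<otimes>\<^bsub>SG\<^esub> \<iota> (wcls [x]) = gcls [(x, False), (x, True)]"
        using gcls_mult[of "[(x, False)]" "[(x, True)]"] x by (simp add: ix)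
      also have "\<dots> = \<one>\<^bsub>SG\<^esub>"
        unfolding one_SG using x by (intro gcls_relation) (auto simp: group_relations_def)
      finally have "gcls [(x, False)] \<otimes>\<^bsub>SG\<^esub> \<iota> (wcls [x] \<otimes>\<^bsub>SM\<^esub> b) = \<iota> b"
        using ic xc b gc by (simp add: SG.m_assoc[symmetric])
      moreover have "gcls [(x, True)] \<otimes>\<^bsub>SG\<^esub> \<iota> z = \<iota> (wcls [x] \<otimes>\<^bsub>SM\<^esub> z)"
        using ic[OF xc, of z] zS ix by simp
      moreover have "wcls [x] \<otimes>\<^bsub>SM\<^esub> z \<in> carrier SM" using xc S_in_carrier[OF zS] by simp
      ultimately show ?thesis using b zS by (cases e) (simp, blast)+
    qed
    fix g assume "g \<in> carrier SG"
    moreover have "?P (gcls w)" if "w \<in> lists (X \<times> UNIV)" for w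
      using that
    proof induction
      case Nil
      show ?case
        using zS S_in_carrier[OF zS] ic(1)[of z z] unfolding one_SG[symmetric]
        by (intro bexI[of _ z]) simp_all
    next
      case (Cons p w)
      then have "gcls (p # w) = gcls [p] \<otimes>\<^bsub>SG\<^esub> gcls w" using gcls_mult[of "[p]" w] by simp
      moreover have "?P (gcls [p])" using letter Cons.hyps by (cases p) auto
      ultimately show ?case using mult[of "gcls [p]" "gcls w"] Cons by (simp add: carrier_SG)
    qed
    ultimately show "?P g" unfolding carrier_SG by blast
  qed
  then show thesis using that z by blast
qed

end

section \<open>Prime ideals and central localization of rings\<close>

context ring
begin

lemma idealI_closed:
  assumes "I \<subseteq> carrier R" "\<zero> \<in> I" "\<And>x y. x \<in> I \<Longrightarrow> y \<in> I \<Longrightarrow> x \<oplus> y \<in> I"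
    and l: "\<And>x y. x \<in> carrier R \<Longrightarrow> y \<in> I \<Longrightarrow> x \<otimes> y \<in> I"
    and r: "\<And>x y. x \<in> I \<Longrightarrow> y \<in> carrier R \<Longrightarrow> x \<otimes> y \<in> I"
  shows "ideal I R"
proof (rule idealI[OF ring_axioms])
  show "subgroup I (add_monoid R)"
  proof (rule add.subgroupI)
    fix a assume a: "a \<in> I"
    then have "\<ominus> a = (\<ominus> \<one>) \<otimes> a" using assms(1) by (auto simp: l_minus)
    then show "\<ominus> a \<in> I" using l a by simp
  qed (use assms in auto)
qed (use l r in auto)

text \<open>The usual elementwise criterion: a R b inside P forces a or b into P.\<close>

lemma prime_ideal_iff:
  "prime_ideal R P \<longleftrightarrow> ideal P R \<and> \<one> \<notin> P \<and>
    (\<forall>a\<in>carrier R. \<forall>b\<in>carrier R. (\<forall>x\<in>carrier R. a \<otimes> x \<otimes> b \<in> P) \<longrightarrow> a \<in> P \<or> b \<in> P)"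
proof (cases "ideal P R")
  case True
  then interpret P: ideal P R .
  have proper: "P \<noteq> carrier R \<longleftrightarrow> \<one> \<notin> P"
    using P.one_imp_carrier one_closed by blast
  have "a \<in> P \<or> b \<in> P"
    if prime: "\<And>I J. ideal I R \<Longrightarrow> ideal J R \<Longrightarrow> I \<cdot> J \<subseteq> P \<Longrightarrow> I \<subseteq> P \<or> J \<subseteq> P"
      and ab: "a \<in> carrier R" "b \<in> carrier R" "\<And>x. x \<in> carrier R \<Longrightarrow> a \<otimes> x \<otimes> b \<in> P" for a b
  proof -
    \<comment> \<open>Annihilator-like ideals replace the ideals generated by \<open>a\<close> and
      \<open>b\<close>: they contain a and b respectively, and their product lies in
      \<open>P\<close> by construction, without describing generated ideals.\<close>
    let ?I = "{x \<in> carrier R. \<forall>w\<in>carrier R. x \<otimes> w \<otimes> b \<in> P}"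
    let ?J = "{y \<in> carrier R. \<forall>x\<in>?I. \<forall>w\<in>carrier R. x \<otimes> w \<otimes> y \<in> P}"
    have I: "ideal ?I R"
    proof (rule idealI_closed)
      fix r x assume x: "r \<in> carrier R" "x \<in> ?I"
      have "r \<otimes> x \<otimes> w \<otimes> b \<in> P" if "w \<in> carrier R" for w
        using x that ab P.I_l_closed[of "x \<otimes> w \<otimes> b" r] by (auto simp: m_assoc)
      then show "r \<otimes> x \<in> ?I" using x by auto
    next
      fix r x assume x: "x \<in> ?I" "r \<in> carrier R"
      have "x \<otimes> r \<otimes> w \<otimes> b \<in> P" if w: "w \<in> carrier R" for w
      proof -
        have "x \<otimes> (r \<otimes> w) \<otimes> b \<in> P" using x w m_closed by blast
        then show ?thesis using x w by (simp add: m_assoc)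
      qed
      then show "x \<otimes> r \<in> ?I" using x by auto
    qed (use ab in \<open>auto simp: l_distr\<close>)
    have J: "ideal ?J R"
    proof (rule idealI_closed)
      fix r y assume r: "r \<in> carrier R" "y \<in> ?J"
      have "x \<otimes> w \<otimes> (r \<otimes> y) \<in> P" if x: "x \<in> ?I" "w \<in> carrier R" for x w
      proof -
        have "x \<otimes> (w \<otimes> r) \<otimes> y \<in> P" using r x m_closed by blast
        then show ?thesis using r x by (simp add: m_assoc)
      qed
      then show "r \<otimes> y \<in> ?J" using r by auto
    next
      fix r y assume r: "y \<in> ?J" "r \<in> carrier R"
      have "x \<otimes> w \<otimes> (y \<otimes> r) \<in> P" if x: "x \<in> ?I" "w \<in> carrier R" for x w
      proof -
        have "x \<otimes> w \<otimes> y \<in> P" using r x by blast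
        then have "x \<otimes> w \<otimes> y \<otimes> r \<in> P" using r by (auto intro: P.I_r_closed)
        then show ?thesis using r x by (simp add: m_assoc)
      qed
      then show "y \<otimes> r \<in> ?J" using r by auto
    qed (auto simp: r_distr)
    have mult: "x \<otimes> y \<in> P" if "x \<in> ?I" "y \<in> ?J" for x y
    proof -
      have "x \<otimes> \<one> \<otimes> y \<in> P" using that by blast
      then show ?thesis using that by simp
    qed
    have "s \<in> P" if "s \<in> ?I \<cdot> ?J" for s
      using that
    proof induction
      case (prod i j)
      then show ?case by (rule mult)
    qed (rule P.a_closed)
    then have "?I \<subseteq> P \<or> ?J \<subseteq> P" using prime[OF I J] by (meson subsetI)
    moreover have "a \<in> ?I" "b \<in> ?J" using ab by auto
    ultimately show ?thesis by blast
  qed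
  note elementwise = this
  have idealwise: "I \<subseteq> P \<or> J \<subseteq> P"
    if prime: "\<And>a b. a \<in> carrier R \<Longrightarrow> b \<in> carrier R \<Longrightarrow> (\<And>x. x \<in> carrier R \<Longrightarrow> a \<otimes> x \<otimes> b \<in> P) \<Longrightarrow> a \<in> P \<or> b \<in> P"
      and IJ: "ideal I R" "ideal J R" "I \<cdot> J \<subseteq> P" for I J
  proof -
    have "i \<in> P \<or> j \<in> P" if ij: "i \<in> I" "j \<in> J" for i j
    proof (rule prime)
      fix x assume "x \<in> carrier R"
      then have "i \<otimes> x \<in> I" using IJ ij ideal.I_r_closed by fast
      then show "i \<otimes> x \<otimes> j \<in> P" using IJ(3) ij ideal_prod.prod by fast
    qed (use IJ ij ideal.Icarr in fast)+
    then show ?thesis by blast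
  qed
  show ?thesis
  proof
    assume "prime_ideal R P"
    then have proper': "P \<noteq> carrier R"
      and prime: "\<And>I J. ideal I R \<Longrightarrow> ideal J R \<Longrightarrow> I \<cdot> J \<subseteq> P \<Longrightarrow> I \<subseteq> P \<or> J \<subseteq> P"
      by (simp_all add: prime_ideal_def)
    show "ideal P R \<and> \<one> \<notin> P \<and>
        (\<forall>a\<in>carrier R. \<forall>b\<in>carrier R. (\<forall>x\<in>carrier R. a \<otimes> x \<otimes> b \<in> P) \<longrightarrow> a \<in> P \<or> b \<in> P)"
      using True proper' proper by (intro conjI ballI impI elementwise[OF prime]) auto
  next
    assume *: "ideal P R \<and> \<one> \<notin> P \<and>
        (\<forall>a\<in>carrier R. \<forall>b\<in>carrier R. (\<forall>x\<in>carrier R. a \<otimes> x \<otimes> b \<in> P) \<longrightarrow> a \<in> P \<or> b \<in> P)"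
    then have "I \<subseteq> P \<or> J \<subseteq> P" if "ideal I R" "ideal J R" "I \<cdot> J \<subseteq> P" for I J
      by (intro idealwise[OF _ that]) auto
    then show "prime_ideal R P"
      unfolding prime_ideal_def proper using * by simp
  qed
qed (simp add: prime_ideal_def)

end

lemma prime_idealD:
  assumes "prime_ideal R P" "ring R"
  shows "ideal P R" "\<one>\<^bsub>R\<^esub> \<notin> P"
    "\<And>a b. \<lbrakk>a \<in> carrier R; b \<in> carrier R; \<And>x. x \<in> carrier R \<Longrightarrow> a \<otimes>\<^bsub>R\<^esub> x \<otimes>\<^bsub>R\<^esub> b \<in> P\<rbrakk> \<Longrightarrow> a \<in> P \<or> b \<in> P"
  using assms ring.prime_ideal_iff by blast+

text \<open>The ring counterpart of \<open>monoid_fractions\<close>: \<open>T\<close> is the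
  localization of \<open>R\<close> at the central set \<open>C\<close>, and \<phi> may have a
  kernel, consisting of elements killed by some c in \<open>C\<close>.\<close>

locale ring_fractions = R: ring R + T: ring T
  for R :: "('a, 'b) ring_scheme" (structure) and T :: "('t, 'u) ring_scheme" +
  fixes \<phi> :: "'a \<Rightarrow> 't" and C :: "'a set"
  assumes phi_hom: "\<phi> \<in> ring_hom R T"
    and C_carrier: "C \<subseteq> carrier R"
    and one_C: "\<one> \<in> C"
    and C_mult: "\<lbrakk>c \<in> C; d \<in> C\<rbrakk> \<Longrightarrow> c \<otimes> d \<in> C"
    and C_comm: "\<lbrakk>c \<in> C; x \<in> carrier R\<rbrakk> \<Longrightarrow> c \<otimes> x = x \<otimes> c"
    and phi_zeroD: "\<lbrakk>f \<in> carrier R; \<phi> f = \<zero>\<^bsub>T\<^esub>\<rbrakk> \<Longrightarrow> \<exists>c\<in>C. f \<otimes> c = \<zero>"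
    and phi_fractions: "t \<in> carrier T \<Longrightarrow> \<exists>f\<in>carrier R. \<exists>c\<in>C. t \<otimes>\<^bsub>T\<^esub> \<phi> c = \<phi> f"
    and phi_unit: "c \<in> C \<Longrightarrow> \<exists>u\<in>carrier T. \<phi> c \<otimes>\<^bsub>T\<^esub> u = \<one>\<^bsub>T\<^esub>"
begin

section \<open>Extension and contraction of ideals along a central localization\<close>

lemma C_closed [simp]: "c \<in> C \<Longrightarrow> c \<in> carrier R"
  using C_carrier by blast

lemma phi_closed [simp]: "f \<in> carrier R \<Longrightarrow> \<phi> f \<in> carrier T"
  and phi_mult: "f \<in> carrier R \<Longrightarrow> g \<in> carrier R \<Longrightarrow> \<phi> (f \<otimes> g) = \<phi> f \<otimes>\<^bsub>T\<^esub> \<phi> g"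
  and phi_add: "f \<in> carrier R \<Longrightarrow> g \<in> carrier R \<Longrightarrow> \<phi> (f \<oplus> g) = \<phi> f \<oplus>\<^bsub>T\<^esub> \<phi> g"
  and phi_one: "\<phi> \<one> = \<one>\<^bsub>T\<^esub>"
  using phi_hom by (auto simp: ring_hom_closed ring_hom_mult ring_hom_add ring_hom_one)

lemma phi_zero: "\<phi> \<zero> = \<zero>\<^bsub>T\<^esub>"
  using phi_hom R.ring_axioms T.ring_axioms by (rule ring_hom_zero)

lemma phi_cancel:
  assumes "c \<in> C" "t \<in> carrier T" "t' \<in> carrier T" "t \<otimes>\<^bsub>T\<^esub> \<phi> c = t' \<otimes>\<^bsub>T\<^esub> \<phi> c"
  shows "t = t'"
proof -
  obtain u where u: "u \<in> carrier T" "\<phi> c \<otimes>\<^bsub>T\<^esub> u = \<one>\<^bsub>T\<^esub>" using phi_unit assms by blast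
  have "c \<in> carrier R" using assms by simp
  then have "t = t \<otimes>\<^bsub>T\<^esub> \<phi> c \<otimes>\<^bsub>T\<^esub> u" using assms(2) u by (simp add: T.m_assoc)
  also have "\<dots> = t'" using \<open>c \<in> carrier R\<close> assms(3) u by (simp add: assms(4) T.m_assoc)
  finally show ?thesis .
qed

lemma phi_central:
  assumes "c \<in> C" "t \<in> carrier T"
  shows "\<phi> c \<otimes>\<^bsub>T\<^esub> t = t \<otimes>\<^bsub>T\<^esub> \<phi> c"
proof -
  obtain f d where f: "f \<in> carrier R" "d \<in> C" "t \<otimes>\<^bsub>T\<^esub> \<phi> d = \<phi> f" using phi_fractions assms by blast
  have cd: "\<phi> c \<otimes>\<^bsub>T\<^esub> \<phi> d = \<phi> d \<otimes>\<^bsub>T\<^esub> \<phi> c"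
    using C_comm[of c d] assms f by (simp flip: phi_mult)
  have "\<phi> c \<otimes>\<^bsub>T\<^esub> t \<otimes>\<^bsub>T\<^esub> \<phi> d = \<phi> c \<otimes>\<^bsub>T\<^esub> \<phi> f"
    using assms f by (simp add: T.m_assoc)
  also have "\<dots> = \<phi> f \<otimes>\<^bsub>T\<^esub> \<phi> c"
    using C_comm[of c f] assms f by (simp flip: phi_mult)
  also have "\<dots> = t \<otimes>\<^bsub>T\<^esub> \<phi> c \<otimes>\<^bsub>T\<^esub> \<phi> d"
    using assms f(1,2) by (simp add: f(3)[symmetric] T.m_assoc cd)
  finally show ?thesis by (rule phi_cancel[OF f(2), rotated 2]) (use assms f in auto)
qed

text \<open>The fractions with numerator in \<open>P\<close>, written without inverting
  denominators.\<close>

definition extension :: "'a set \<Rightarrow> 't set"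
  where "extension P = {t \<in> carrier T. \<exists>c\<in>C. \<exists>f\<in>P. t \<otimes>\<^bsub>T\<^esub> \<phi> c = \<phi> f}"

definition contraction :: "'t set \<Rightarrow> 'a set"
  where "contraction Q = {f \<in> carrier R. \<phi> f \<in> Q}"

text \<open>As c is central, f R c = f c R lies in \<open>P\<close>; primality applies and c is not
  in \<open>P\<close>.\<close>

lemma prime_cancel:
  assumes P: "prime_ideal R P" "P \<inter> C = {}" and f: "f \<in> carrier R" "c \<in> C" "f \<otimes> c \<in> P"
  shows "f \<in> P"
proof -
  interpret P: ideal P R using prime_idealD(1)[OF P(1) R.ring_axioms] .
  have "f \<otimes> x \<otimes> c \<in> P" if "x \<in> carrier R" for x
    using P.I_r_closed[OF f(3) that] C_comm[OF f(2) that] f that by (simp add: R.m_assoc)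
  then show ?thesis using prime_idealD(3)[OF P(1) R.ring_axioms, of f c] P(2) f by auto
qed

text \<open>From \<phi>(f c) = \<phi>(g) only (f c - g) d = 0 follows, for some d in
  \<open>C\<close>. This still puts f c d into \<open>P\<close>, and \<open>prime_cancel\<close>
  removes c d.\<close>

lemma phi_mem_extension:
  assumes P: "prime_ideal R P" "P \<inter> C = {}" and f: "f \<in> carrier R" "\<phi> f \<in> extension P"
  shows "f \<in> P"
proof -
  interpret P: ideal P R using prime_idealD(1)[OF P(1) R.ring_axioms] .
  obtain c g where g: "c \<in> C" "g \<in> P" "\<phi> f \<otimes>\<^bsub>T\<^esub> \<phi> c = \<phi> g"
    using f by (auto simp: extension_def)
  let ?h = "f \<otimes> c \<ominus> g"
  have gR: "g \<in> carrier R" using g P.Icarr by blast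
  have "f \<otimes> c = ?h \<oplus> g" using f g gR by (simp add: R.minus_eq R.a_assoc R.l_neg)
  then have "\<phi> g = \<phi> ?h \<oplus>\<^bsub>T\<^esub> \<phi> g" using g f gR by (simp flip: phi_mult phi_add)
  then have "\<phi> ?h = \<zero>\<^bsub>T\<^esub>" using f g gR T.add.r_cancel_one'[of "\<phi> g" "\<phi> ?h"] by simp
  then obtain d where d: "d \<in> C" "?h \<otimes> d = \<zero>" using phi_zeroD[of ?h] f g gR by auto
  have "f \<otimes> (c \<otimes> d) = (?h \<oplus> g) \<otimes> d"
    using f g d gR \<open>f \<otimes> c = ?h \<oplus> g\<close> by (simp flip: R.m_assoc)
  also have "\<dots> = g \<otimes> d" using f g gR d by (simp add: R.l_distr)
  finally have "f \<otimes> (c \<otimes> d) \<in> P" using P.I_r_closed[OF g(2), of d] d by simp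
  then show ?thesis using prime_cancel[OF P f(1)] C_mult g d by blast
qed

text \<open>Membership can be tested on any one representation as a fraction; closure and primality
  of the extension reduce to this.\<close>

lemma mem_extension_iff:
  assumes P: "prime_ideal R P" "P \<inter> C = {}"
    and "t \<in> carrier T" "c \<in> C" "f \<in> carrier R" "t \<otimes>\<^bsub>T\<^esub> \<phi> c = \<phi> f"
  shows "t \<in> extension P \<longleftrightarrow> f \<in> P"
proof
  interpret P: ideal P R using prime_idealD(1)[OF P(1) R.ring_axioms] .
  assume "t \<in> extension P"
  then obtain d g where g: "d \<in> C" "g \<in> P" "t \<otimes>\<^bsub>T\<^esub> \<phi> d = \<phi> g" by (auto simp: extension_def)
  then have gR: "g \<in> carrier R" using P.Icarr by blast
  have "\<phi> f \<otimes>\<^bsub>T\<^esub> \<phi> d = t \<otimes>\<^bsub>T\<^esub> \<phi> d \<otimes>\<^bsub>T\<^esub> \<phi> c"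
    using assms g(1) phi_central[of c "\<phi> d"] by (simp add: T.m_assoc flip: assms(6))
  also have "\<dots> = \<phi> (g \<otimes> c)" using g assms gR by (simp add: phi_mult)
  finally have "\<phi> f \<in> extension P"
    using g assms P.I_r_closed[OF g(2), of c] by (auto simp: extension_def)
  then show "f \<in> P" by (rule phi_mem_extension[OF P assms(5)])
qed (use assms in \<open>auto simp: extension_def\<close>)

lemma contraction_extension:
  assumes "prime_ideal R P" "P \<inter> C = {}"
  shows "contraction (extension P) = P"
proof -
  interpret P: ideal P R using prime_idealD(1)[OF assms(1) R.ring_axioms] .
  have "\<phi> f \<in> extension P \<longleftrightarrow> f \<in> P" if "f \<in> carrier R" for f
    by (rule mem_extension_iff[OF assms _ one_C that]) (use that phi_one in auto)
  then show ?thesis using P.Icarr by (auto simp: contraction_def)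
qed

lemma extension_prime:
  assumes P: "prime_ideal R P" "P \<inter> C = {}"
  shows "prime_ideal T (extension P)"
proof -
  interpret P: ideal P R using prime_idealD(1)[OF P(1) R.ring_axioms] .
  note mem = mem_extension_iff[OF P]
  have ideal: "ideal (extension P) T"
  proof (rule T.idealI_closed)
    show "extension P \<subseteq> carrier T" by (auto simp: extension_def)
    show "\<zero>\<^bsub>T\<^esub> \<in> extension P"
      using mem[of "\<zero>\<^bsub>T\<^esub>" \<one> \<zero>] one_C phi_zero by simp
  next
    fix x y assume xy: "x \<in> extension P" "y \<in> extension P"
    then obtain c f d g where f: "x \<in> carrier T" "c \<in> C" "f \<in> P" "x \<otimes>\<^bsub>T\<^esub> \<phi> c = \<phi> f"
      and g: "y \<in> carrier T" "d \<in> C" "g \<in> P" "y \<otimes>\<^bsub>T\<^esub> \<phi> d = \<phi> g" by (auto simp: extension_def)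
    have fg: "f \<in> carrier R" "g \<in> carrier R" using f g P.Icarr by auto
    have "(x \<oplus>\<^bsub>T\<^esub> y) \<otimes>\<^bsub>T\<^esub> \<phi> (c \<otimes> d) = x \<otimes>\<^bsub>T\<^esub> \<phi> c \<otimes>\<^bsub>T\<^esub> \<phi> d \<oplus>\<^bsub>T\<^esub> y \<otimes>\<^bsub>T\<^esub> \<phi> d \<otimes>\<^bsub>T\<^esub> \<phi> c"
      using f(1,2) g(1,2) phi_central[of c "\<phi> d"] by (simp add: phi_mult T.l_distr T.m_assoc)
    also have "\<dots> = \<phi> (f \<otimes> d \<oplus> g \<otimes> c)" using f g fg by (simp add: phi_mult phi_add)
    finally show "x \<oplus>\<^bsub>T\<^esub> y \<in> extension P"
      using mem[of "x \<oplus>\<^bsub>T\<^esub> y" "c \<otimes> d" "f \<otimes> d \<oplus> g \<otimes> c"] f g fg C_mult P.I_r_closed by simp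
  next
    fix x y assume x: "x \<in> carrier T" and y: "y \<in> extension P"
    obtain c f where f: "c \<in> C" "f \<in> carrier R" "x \<otimes>\<^bsub>T\<^esub> \<phi> c = \<phi> f" using phi_fractions x by blast
    obtain d g where g: "y \<in> carrier T" "d \<in> C" "g \<in> P" "y \<otimes>\<^bsub>T\<^esub> \<phi> d = \<phi> g" using y by (auto simp: extension_def)
    have gR: "g \<in> carrier R" using g P.Icarr by auto
    have "x \<otimes>\<^bsub>T\<^esub> y \<otimes>\<^bsub>T\<^esub> \<phi> (c \<otimes> d) = x \<otimes>\<^bsub>T\<^esub> (y \<otimes>\<^bsub>T\<^esub> \<phi> c) \<otimes>\<^bsub>T\<^esub> \<phi> d"
      using f(1,2) g(1,2) x by (simp add: phi_mult T.m_assoc)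
    also have "\<dots> = (x \<otimes>\<^bsub>T\<^esub> \<phi> c) \<otimes>\<^bsub>T\<^esub> (y \<otimes>\<^bsub>T\<^esub> \<phi> d)"
      using f(1,2) g(1,2) x by (simp add: phi_central[of c y, symmetric] T.m_assoc)
    also have "\<dots> = \<phi> (f \<otimes> g)" using f g gR by (simp add: phi_mult)
    finally show "x \<otimes>\<^bsub>T\<^esub> y \<in> extension P"
      using mem[of "x \<otimes>\<^bsub>T\<^esub> y" "c \<otimes> d" "f \<otimes> g"] f g gR x C_mult P.I_l_closed by simp
  next
    fix x y assume x: "y \<in> carrier T" and y: "x \<in> extension P"
    obtain c f where f: "c \<in> C" "f \<in> carrier R" "y \<otimes>\<^bsub>T\<^esub> \<phi> c = \<phi> f" using phi_fractions x by blast
    obtain d g where g: "x \<in> carrier T" "d \<in> C" "g \<in> P" "x \<otimes>\<^bsub>T\<^esub> \<phi> d = \<phi> g" using y by (auto simp: extension_def)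
    have gR: "g \<in> carrier R" using g P.Icarr by auto
    have "x \<otimes>\<^bsub>T\<^esub> y \<otimes>\<^bsub>T\<^esub> \<phi> (d \<otimes> c) = x \<otimes>\<^bsub>T\<^esub> (y \<otimes>\<^bsub>T\<^esub> \<phi> d) \<otimes>\<^bsub>T\<^esub> \<phi> c"
      using f(1,2) g(1,2) x by (simp add: phi_mult T.m_assoc)
    also have "\<dots> = (x \<otimes>\<^bsub>T\<^esub> \<phi> d) \<otimes>\<^bsub>T\<^esub> (y \<otimes>\<^bsub>T\<^esub> \<phi> c)"
      using f(1,2) g(1,2) x by (simp add: phi_central[of d y, symmetric] T.m_assoc)
    also have "\<dots> = \<phi> (g \<otimes> f)" using f g gR by (simp add: phi_mult)
    finally show "x \<otimes>\<^bsub>T\<^esub> y \<in> extension P"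
      using mem[of "x \<otimes>\<^bsub>T\<^esub> y" "d \<otimes> c" "g \<otimes> f"] f g gR x C_mult P.I_r_closed by simp
  qed
  then interpret Q: ideal "extension P" T .
  have one: "\<one>\<^bsub>T\<^esub> \<notin> extension P"
    using mem[of "\<one>\<^bsub>T\<^esub>" \<one> \<one>] one_C phi_one prime_idealD(2)[OF P(1) R.ring_axioms] by simp
  have "x \<in> extension P \<or> y \<in> extension P"
    if xy: "x \<in> carrier T" "y \<in> carrier T" "\<And>w. w \<in> carrier T \<Longrightarrow> x \<otimes>\<^bsub>T\<^esub> w \<otimes>\<^bsub>T\<^esub> y \<in> extension P" for x y
  proof -
    obtain c f where f: "c \<in> C" "f \<in> carrier R" "x \<otimes>\<^bsub>T\<^esub> \<phi> c = \<phi> f" using phi_fractions xy by blast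
    obtain d g where g: "d \<in> C" "g \<in> carrier R" "y \<otimes>\<^bsub>T\<^esub> \<phi> d = \<phi> g" using phi_fractions xy by blast
    \<comment> \<open>The hypothesis on x and y is used at \<phi>(c h), where c is the denominator
      of x.\<close>
    have "f \<otimes> h \<otimes> g \<in> P" if h: "h \<in> carrier R" for h
    proof -
      have "\<phi> (f \<otimes> h \<otimes> g) = x \<otimes>\<^bsub>T\<^esub> \<phi> (c \<otimes> h) \<otimes>\<^bsub>T\<^esub> y \<otimes>\<^bsub>T\<^esub> \<phi> d"
        using xy f(1,2) g(1,2) h by (simp add: phi_mult T.m_assoc flip: f(3) g(3))
      also have "\<dots> \<in> extension P" by (rule Q.I_r_closed) (use xy f g h in auto)
      finally show ?thesis by (rule phi_mem_extension[OF P, rotated]) (use f g h in auto)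
    qed
    then have "f \<in> P \<or> g \<in> P" using prime_idealD(3)[OF P(1) R.ring_axioms] f g by blast
    then show ?thesis using mem f g xy by blast
  qed
  then show ?thesis unfolding T.prime_ideal_iff using ideal one by blast
qed

lemma mult_phi_mem:
  assumes "ideal Q T" "c \<in> C" "t \<in> carrier T" "t \<otimes>\<^bsub>T\<^esub> \<phi> c \<in> Q"
  shows "t \<in> Q"
proof -
  interpret Q: ideal Q T by fact
  obtain u where u: "u \<in> carrier T" "\<phi> c \<otimes>\<^bsub>T\<^esub> u = \<one>\<^bsub>T\<^esub>" using phi_unit assms by blast
  then show ?thesis using Q.I_r_closed[OF assms(4) u(1)] assms by (simp add: T.m_assoc)
qed

text \<open>Multiplication by the units \<phi>(c) changes no membership in an ideal, so clearing
  denominators is harmless.\<close>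

lemma extension_contraction:
  assumes "ideal Q T"
  shows "extension (contraction Q) = Q"
proof -
  interpret Q: ideal Q T by fact
  have "t \<in> extension (contraction Q)" if t: "t \<in> Q" for t
  proof -
    obtain c f where f: "c \<in> C" "f \<in> carrier R" "t \<otimes>\<^bsub>T\<^esub> \<phi> c = \<phi> f"
      using phi_fractions t Q.Icarr by blast
    then have "\<phi> f \<in> Q" using t Q.I_r_closed[OF t, of "\<phi> c"] by simp
    then show ?thesis using f t Q.Icarr by (auto simp: extension_def contraction_def)
  qed
  moreover have "t \<in> Q" if t: "t \<in> extension (contraction Q)" for t
  proof -
    obtain c f where f: "t \<in> carrier T" "c \<in> C" "\<phi> f \<in> Q" "t \<otimes>\<^bsub>T\<^esub> \<phi> c = \<phi> f"
      using t by (auto simp: extension_def contraction_def)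
    then show ?thesis using mult_phi_mem[OF assms, of c t] by simp
  qed
  ultimately show ?thesis by blast
qed

lemma contraction_prime:
  assumes Q: "prime_ideal T Q"
  shows "prime_ideal R (contraction Q)" "contraction Q \<inter> C = {}"
proof -
  have idQ: "ideal Q T" using prime_idealD(1)[OF Q T.ring_axioms] .
  then interpret Q: ideal Q T .
  have one: "\<one>\<^bsub>T\<^esub> \<notin> Q" using prime_idealD(2)[OF Q T.ring_axioms] .
  have ideal: "ideal (contraction Q) R"
    unfolding contraction_def
    by (rule R.idealI_closed) (auto simp: phi_zero phi_add phi_mult Q.I_l_closed Q.I_r_closed)
  have "f \<in> contraction Q \<or> g \<in> contraction Q"
    if fg: "f \<in> carrier R" "g \<in> carrier R" "\<And>h. h \<in> carrier R \<Longrightarrow> f \<otimes> h \<otimes> g \<in> contraction Q" for f g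
  proof -
    have "\<phi> f \<otimes>\<^bsub>T\<^esub> t \<otimes>\<^bsub>T\<^esub> \<phi> g \<in> Q" if t: "t \<in> carrier T" for t
    proof -
      obtain c h where h: "c \<in> C" "h \<in> carrier R" "t \<otimes>\<^bsub>T\<^esub> \<phi> c = \<phi> h" using phi_fractions t by blast
      \<comment> \<open>Clearing the central denominator of \<open>t\<close> reduces the middle
        factor to the image of an element of \<open>R\<close>.\<close>
      have "\<phi> f \<otimes>\<^bsub>T\<^esub> t \<otimes>\<^bsub>T\<^esub> \<phi> g \<otimes>\<^bsub>T\<^esub> \<phi> c = \<phi> f \<otimes>\<^bsub>T\<^esub> (t \<otimes>\<^bsub>T\<^esub> \<phi> c) \<otimes>\<^bsub>T\<^esub> \<phi> g"
        using fg t h(1,2) phi_central[of c "\<phi> g"] by (simp add: T.m_assoc)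
      also have "\<dots> = \<phi> (f \<otimes> h \<otimes> g)" using fg t h by (simp add: phi_mult)
      also have "\<dots> \<in> Q" using fg h by (auto simp: contraction_def)
      finally show ?thesis by (rule mult_phi_mem[OF idQ h(1), rotated]) (use fg t in auto)
    qed
    then show ?thesis using prime_idealD(3)[OF Q T.ring_axioms, of "\<phi> f" "\<phi> g"] fg
      by (auto simp: contraction_def)
  qed
  then show "prime_ideal R (contraction Q)"
    unfolding R.prime_ideal_iff using ideal one by (auto simp: contraction_def phi_one)
  show "contraction Q \<inter> C = {}"
    using mult_phi_mem[OF idQ, of _ "\<one>\<^bsub>T\<^esub>"] one by (auto simp: contraction_def)
qed

lemma extension_bij:
  "bij_betw extension {P. prime_ideal R P \<and> P \<inter> C = {}} {Q. prime_ideal T Q}"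
proof (rule bij_betw_byWitness[where f' = contraction])
  show "\<forall>P\<in>{P. prime_ideal R P \<and> P \<inter> C = {}}. contraction (extension P) = P"
    by (simp add: contraction_extension)
  show "\<forall>Q\<in>{Q. prime_ideal T Q}. extension (contraction Q) = Q"
    by (auto intro!: extension_contraction prime_idealD(1) T.ring_axioms simp only:)
  show "extension ` {P. prime_ideal R P \<and> P \<inter> C = {}} \<subseteq> {Q. prime_ideal T Q}"
    by (auto intro: extension_prime simp only:)
  show "contraction ` {Q. prime_ideal T Q} \<subseteq> {P. prime_ideal R P \<and> P \<inter> C = {}}"
  proof (rule image_subsetI, rule CollectI, rule conjI)
    fix Q assume "Q \<in> {Q. prime_ideal T Q}"
    then have Q: "prime_ideal T Q" by (rule CollectD)
    show "prime_ideal R (contraction Q)" "contraction Q \<inter> C = {}"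
      by (rule contraction_prime[OF Q])+
  qed
qed

lemma extension_subset_iff:
  assumes "prime_ideal R P" "P \<inter> C = {}" "prime_ideal R P'" "P' \<inter> C = {}"
  shows "P \<subseteq> P' \<longleftrightarrow> extension P \<subseteq> extension P'"
proof
  show "extension P \<subseteq> extension P'" if "P \<subseteq> P'" using that by (auto simp: extension_def)
  assume "extension P \<subseteq> extension P'"
  then have "contraction (extension P) \<subseteq> contraction (extension P')" by (auto simp: contraction_def)
  then show "P \<subseteq> P'" using contraction_extension assms by simp
qed

end

section \<open>Monoid algebras\<close>

definition monomial :: "('k, 'c) ring_scheme \<Rightarrow> 'k \<Rightarrow> 'a \<Rightarrow> 'a \<Rightarrow> 'k"
  where "monomial K k m = (\<lambda>x. if x = m then k else \<zero>\<^bsub>K\<^esub>)"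

lemma monomial_one: "monomial K \<one>\<^bsub>K\<^esub> m = monoid_algebra_embed K m"
  by (simp add: monomial_def monoid_algebra_embed_def)

lemma one_monoid_algebra: "\<one>\<^bsub>monoid_algebra K M\<^esub> = monoid_algebra_embed K \<one>\<^bsub>M\<^esub>"
  by (simp add: monoid_algebra_def monoid_algebra_embed_def)

lemma add_monoid_algebra: "(f \<oplus>\<^bsub>monoid_algebra K M\<^esub> g) m = f m \<oplus>\<^bsub>K\<^esub> g m"
  by (simp add: monoid_algebra_def)

lemma zero_monoid_algebra: "\<zero>\<^bsub>monoid_algebra K M\<^esub> = (\<lambda>m. \<zero>\<^bsub>K\<^esub>)"
  by (simp add: monoid_algebra_def)

context ring
begin

lemma monoid_algebraI:
  assumes "\<And>m. f m \<in> carrier R" "finite A" "A \<subseteq> carrier M" "\<And>m. m \<notin> A \<Longrightarrow> f m = \<zero>"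
  shows "f \<in> carrier (monoid_algebra R M)"
proof -
  have "monoid_algebra_support R f \<subseteq> A" using assms(4) by (auto simp: monoid_algebra_support_def)
  then show ?thesis using assms finite_subset[of _ A] by (auto simp: monoid_algebra_def)
qed

lemma monoid_algebra_coeff: "f \<in> carrier (monoid_algebra R M) \<Longrightarrow> f m \<in> carrier R"
  by (auto simp: monoid_algebra_def)

lemma monoid_algebra_support:
  assumes "f \<in> carrier (monoid_algebra R M)"
  shows "finite (monoid_algebra_support R f)" "monoid_algebra_support R f \<subseteq> carrier M"
  using assms by (auto simp: monoid_algebra_def)

lemma monoid_algebra_nonsupport: "m \<notin> monoid_algebra_support R f \<Longrightarrow> f m = \<zero>"
  by (simp add: monoid_algebra_support_def)

lemma monomial_closed: "k \<in> carrier R \<Longrightarrow> m \<in> carrier M \<Longrightarrow> monomial R k m \<in> carrier (monoid_algebra R M)"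
  by (rule monoid_algebraI[of _ "{m}"]) (auto simp: monomial_def)

lemma support_monomial: "monoid_algebra_support R (monomial R k m) = (if k = \<zero> then {} else {m})"
  by (auto simp: monoid_algebra_support_def monomial_def)

lemma mult_monomial:
  assumes "k \<in> carrier R" "l \<in> carrier R"
  shows "monomial R k u \<otimes>\<^bsub>monoid_algebra R M\<^esub> monomial R l v = monomial R (k \<otimes> l) (u \<otimes>\<^bsub>M\<^esub> v)"
proof
  fix m
  have "(\<Oplus>b\<in>{v}. if u \<otimes>\<^bsub>M\<^esub> b = m then k \<otimes> l else \<zero>) = (if u \<otimes>\<^bsub>M\<^esub> v = m then k \<otimes> l else \<zero>)"
    using assms by simp
  then show "(monomial R k u \<otimes>\<^bsub>monoid_algebra R M\<^esub> monomial R l v) m = monomial R (k \<otimes> l) (u \<otimes>\<^bsub>M\<^esub> v) m"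
    using assms by (auto simp: monoid_algebra_def support_monomial) (auto simp: monomial_def)
qed

text \<open>Reduces additive statements to monomials. The zero function needs no separate case,
  being a monomial with coefficient zero.\<close>

lemma monoid_algebra_induct [consumes 2, case_names monomial add]:
  assumes "f \<in> carrier (monoid_algebra R M)"
    and "monoid M"
    and monomial: "\<And>k m. k \<in> carrier R \<Longrightarrow> m \<in> carrier M \<Longrightarrow> P (monomial R k m)"
    and add: "\<And>f g. \<lbrakk>f \<in> carrier (monoid_algebra R M); g \<in> carrier (monoid_algebra R M); P f; P g\<rbrakk>
      \<Longrightarrow> P (f \<oplus>\<^bsub>monoid_algebra R M\<^esub> g)"
  shows "P f"
proof -
  let ?A = "monoid_algebra R M"
  have induct: "P f" if "finite A" "A \<subseteq> carrier M" "f \<in> carrier ?A" "\<And>m. m \<notin> A \<Longrightarrow> f m = \<zero>" for A f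
    using that
  proof (induction A arbitrary: f rule: finite_induct)
    case empty
    then have "f = monomial R \<zero> \<one>\<^bsub>M\<^esub>" by (auto simp: monomial_def)
    then show ?case using monomial monoid.one_closed[OF assms(2)] by simp
  next
    case (insert a A)
    let ?g = "f(a := \<zero>)"
    have fc: "f m \<in> carrier R" for m by (rule monoid_algebra_coeff[OF insert.prems(2)])
    have g: "?g \<in> carrier ?A"
      by (rule monoid_algebraI[of _ A]) (use insert fc in auto)
    have "P ?g" by (rule insert.IH[OF _ g]) (use insert.prems in auto)
    moreover have "f = monomial R (f a) a \<oplus>\<^bsub>?A\<^esub> ?g"
      using fc by (auto simp: fun_eq_iff add_monoid_algebra monomial_def)
    moreover have "a \<in> carrier M" using insert.prems by simp
    ultimately show ?case using add[OF monomial_closed g] monomial fc by metis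
  qed
  show ?thesis
    by (rule induct[OF monoid_algebra_support[OF assms(1)] assms(1)]) (rule monoid_algebra_nonsupport)
qed

end

text \<open>The linear extension of \<open>h\<close> to monoid algebras: coefficients are summed
  along the fibres of \<open>h\<close>.\<close>

definition pushforward :: "('k, 'c) ring_scheme \<Rightarrow> ('a \<Rightarrow> 'g) \<Rightarrow> ('a \<Rightarrow> 'k) \<Rightarrow> 'g \<Rightarrow> 'k"
  where "pushforward K h f =
    (\<lambda>g. \<Oplus>\<^bsub>K\<^esub>m\<in>monoid_algebra_support K f. if h m = g then f m else \<zero>\<^bsub>K\<^esub>)"

section \<open>Functoriality of the monoid algebra\<close>

context ring
begin

text \<open>Allows a common summation set for functions with different supports.\<close>

lemma pushforward_eq:
  assumes "f \<in> carrier (monoid_algebra R M)" "finite A" "monoid_algebra_support R f \<subseteq> A"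
  shows "pushforward R h f g = (\<Oplus>m\<in>A. if h m = g then f m else \<zero>)"
  unfolding pushforward_def
  by (rule add.finprod_mono_neutral_cong_left)
     (use assms monoid_algebra_coeff[OF assms(1)] monoid_algebra_nonsupport[of _ f] in auto)

lemma pushforward_closed:
  assumes "f \<in> carrier (monoid_algebra R M)" "h \<in> carrier M \<rightarrow> carrier N"
  shows "pushforward R h f \<in> carrier (monoid_algebra R N)"
proof (rule monoid_algebraI[of _ "h ` monoid_algebra_support R f"])
  show "pushforward R h f g \<in> carrier R" for g
    unfolding pushforward_def using monoid_algebra_coeff[OF assms(1)] by (intro finsum_closed) auto
  show "pushforward R h f g = \<zero>" if "g \<notin> h ` monoid_algebra_support R f" for g
    unfolding pushforward_def using that by (intro add.finprod_one_eqI) auto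
qed (use assms monoid_algebra_support[OF assms(1)] in auto)

lemma pushforward_add:
  assumes "f \<in> carrier (monoid_algebra R M)" "f' \<in> carrier (monoid_algebra R M)" "monoid M"
  shows "pushforward R h (f \<oplus>\<^bsub>monoid_algebra R M\<^esub> f') =
    pushforward R h f \<oplus>\<^bsub>monoid_algebra R N\<^esub> pushforward R h f'"
proof
  fix g
  interpret A: ring "monoid_algebra R M" by (rule ring_monoid_algebra[OF ring_axioms assms(3)])
  let ?S = "monoid_algebra_support R f \<union> monoid_algebra_support R f'"
  note c = monoid_algebra_coeff[OF assms(1)] monoid_algebra_coeff[OF assms(2)]
  have S: "finite ?S" using monoid_algebra_support assms by blast
  have "pushforward R h (f \<oplus>\<^bsub>monoid_algebra R M\<^esub> f') g =
      (\<Oplus>m\<in>?S. if h m = g then (f \<oplus>\<^bsub>monoid_algebra R M\<^esub> f') m else \<zero>)"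
    using assms S by (intro pushforward_eq[of _ M]) (auto simp: monoid_algebra_support_def add_monoid_algebra)
  also have "\<dots> = (\<Oplus>m\<in>?S. (if h m = g then f m else \<zero>) \<oplus> (if h m = g then f' m else \<zero>))"
    using c by (intro finsum_cong') (auto simp: add_monoid_algebra)
  also have "\<dots> = pushforward R h f g \<oplus> pushforward R h f' g"
    using c S by (subst finsum_addf) (auto simp: pushforward_eq[OF assms(1) S] pushforward_eq[OF assms(2) S])
  finally show "pushforward R h (f \<oplus>\<^bsub>monoid_algebra R M\<^esub> f') g =
      (pushforward R h f \<oplus>\<^bsub>monoid_algebra R N\<^esub> pushforward R h f') g"
    by (simp add: add_monoid_algebra)
qed

lemma pushforward_monomial:
  assumes "k \<in> carrier R"
  shows "pushforward R h (monomial R k m) = monomial R k (h m)"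
proof
  fix g
  have "(\<Oplus>x\<in>{m}. if h x = g then k else \<zero>) = (if h m = g then k else \<zero>)" using assms by simp
  then show "pushforward R h (monomial R k m) g = monomial R k (h m) g"
    using assms by (auto simp: pushforward_def support_monomial) (auto simp: monomial_def)
qed

lemma pushforward_hom:
  assumes "monoid M" "monoid N" "h \<in> hom M N" "h \<one>\<^bsub>M\<^esub> = \<one>\<^bsub>N\<^esub>"
  shows "pushforward R h \<in> ring_hom (monoid_algebra R M) (monoid_algebra R N)"
proof -
  let ?A = "monoid_algebra R M" and ?B = "monoid_algebra R N" and ?p = "pushforward R h"
  interpret A: ring ?A by (rule ring_monoid_algebra[OF ring_axioms assms(1)])
  interpret B: ring ?B by (rule ring_monoid_algebra[OF ring_axioms assms(2)])
  interpret M: monoid M by fact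
  have h: "h \<in> carrier M \<rightarrow> carrier N" "\<And>a b. a \<in> carrier M \<Longrightarrow> b \<in> carrier M \<Longrightarrow> h (a \<otimes>\<^bsub>M\<^esub> b) = h a \<otimes>\<^bsub>N\<^esub> h b"
    using assms(3) by (auto simp: hom_def)
  note cl = pushforward_closed[OF _ h(1)]
  note pa = pushforward_add[OF _ _ assms(1)]
  have mult_mono: "?p (monomial R k a \<otimes>\<^bsub>?A\<^esub> f) = ?p (monomial R k a) \<otimes>\<^bsub>?B\<^esub> ?p f"
    if ka: "k \<in> carrier R" "a \<in> carrier M" and "f \<in> carrier ?A" for k a f
    using that(3) assms(1)
  proof (induction rule: monoid_algebra_induct)
    case (monomial l b)
    then show ?case using ka by (simp add: mult_monomial pushforward_monomial h(2))
  next
    case (add f g)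
    note m = monomial_closed[OF ka]
    have "?p (monomial R k a \<otimes>\<^bsub>?A\<^esub> (f \<oplus>\<^bsub>?A\<^esub> g)) =
        ?p (monomial R k a \<otimes>\<^bsub>?A\<^esub> f) \<oplus>\<^bsub>?B\<^esub> ?p (monomial R k a \<otimes>\<^bsub>?A\<^esub> g)"
      using add m by (simp add: A.r_distr pa[where N = N])
    then show ?case using add m cl by (simp add: B.r_distr pa[where N = N])
  qed
  have mult: "?p (f \<otimes>\<^bsub>?A\<^esub> g) = ?p f \<otimes>\<^bsub>?B\<^esub> ?p g" if "f \<in> carrier ?A" "g \<in> carrier ?A" for f g
    using that(1) assms(1)
  proof (induction rule: monoid_algebra_induct)
    case (monomial k a)
    then show ?case using mult_mono that by simp
  next
    case (add f f')
    have "?p ((f \<oplus>\<^bsub>?A\<^esub> f') \<otimes>\<^bsub>?A\<^esub> g) = ?p (f \<otimes>\<^bsub>?A\<^esub> g) \<oplus>\<^bsub>?B\<^esub> ?p (f' \<otimes>\<^bsub>?A\<^esub> g)"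
      using add that by (simp add: A.l_distr pa[where N = N])
    then show ?case using add that cl by (simp add: B.l_distr pa[where N = N])
  qed
  show ?thesis
  proof (rule ring_hom_memI)
    show "?p \<one>\<^bsub>?A\<^esub> = \<one>\<^bsub>?B\<^esub>"
      by (simp add: one_monoid_algebra pushforward_monomial assms(4) flip: monomial_one)
  qed (use cl mult pa[where N = N] in auto)
qed

text \<open>Right multiplication by s is the pushforward along m \<mapsto> m s, so its fibres can be
  compared with those of \<iota>.\<close>

lemma mult_monomial_one_apply:
  assumes "f \<in> carrier (monoid_algebra R M)" "\<one> \<noteq> \<zero>"
  shows "(f \<otimes>\<^bsub>monoid_algebra R M\<^esub> monomial R \<one> s) = pushforward R (\<lambda>m. m \<otimes>\<^bsub>M\<^esub> s) f"
proof
  fix x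
  have "(f \<otimes>\<^bsub>monoid_algebra R M\<^esub> monomial R \<one> s) x = (\<Oplus>m\<in>monoid_algebra_support R f.
      \<Oplus>v\<in>{s}. if m \<otimes>\<^bsub>M\<^esub> v = x then f m \<otimes> monomial R \<one> s v else \<zero>)"
    using assms(2) by (simp add: monoid_algebra_def support_monomial)
  also have "\<dots> = (\<Oplus>m\<in>monoid_algebra_support R f. if m \<otimes>\<^bsub>M\<^esub> s = x then f m else \<zero>)"
    using monoid_algebra_coeff[OF assms(1)]
    by (intro finsum_cong') (auto simp: monomial_def)
  finally show "(f \<otimes>\<^bsub>monoid_algebra R M\<^esub> monomial R \<one> s) x = pushforward R (\<lambda>m. m \<otimes>\<^bsub>M\<^esub> s) f x"
    by (simp add: pushforward_def)
qed

end

section \<open>The group algebra as a central localization of the monoid algebra\<close>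

context monoid_fractions
begin

text \<open>The product of the witnesses for the finitely many pairs works for all of them, because
  elements of \<open>S\<close> commute.\<close>

lemma uniform_equalizer:
  assumes "finite A" "A \<subseteq> carrier M"
  shows "\<exists>s\<in>S. \<forall>a\<in>A. \<forall>b\<in>A. \<iota> a = \<iota> b \<longrightarrow> a \<otimes> s = b \<otimes> s"
proof -
  have "\<exists>s\<in>S. \<forall>(a, b)\<in>F. \<iota> a = \<iota> b \<longrightarrow> a \<otimes> s = b \<otimes> s"
    if "finite F" "F \<subseteq> carrier M \<times> carrier M" for F
    using that
  proof (induction F rule: finite_induct)
    case empty
    then show ?case using one_in_S by blast
  next
    case (insert p F)
    obtain a b where p: "p = (a, b)" "a \<in> carrier M" "b \<in> carrier M" using insert.prems by blast
    obtain s where s: "s \<in> S" "\<And>c d. (c, d) \<in> F \<Longrightarrow> \<iota> c = \<iota> d \<Longrightarrow> c \<otimes> s = d \<otimes> s"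
      using insert by blast
    obtain t where t: "t \<in> S" "\<iota> a = \<iota> b \<Longrightarrow> a \<otimes> t = b \<otimes> t"
      using iota_eqD[OF p(2,3)] one_in_S by blast
    have "c \<otimes> (s \<otimes> t) = d \<otimes> (s \<otimes> t)" if cd: "(c, d) \<in> insert p F" and eq: "\<iota> c = \<iota> d" for c d
    proof -
      have car: "c \<in> carrier M" "d \<in> carrier M" using cd insert.prems by auto
      have "c \<otimes> s \<otimes> t = d \<otimes> s \<otimes> t"
      proof (cases "(c, d) \<in> F")
        case True
        then show ?thesis using s(2) eq by simp
      next
        case False
        then have "c = a" "d = b" using cd p by auto
        then show ?thesis using t eq s(1) p S_right_comm[of s t] by simp
      qed
      then show ?thesis using car s(1) t(1) by (simp add: m_assoc)
    qed
    then show ?case using s(1) t(1) by (intro bexI[of _ "s \<otimes> t"]) auto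
  qed
  from this[of "A \<times> A"] assms show ?thesis by blast
qed

lemma ring_fractions_monoid_algebra:
  assumes "field K"
  shows "ring_fractions (monoid_algebra K M) (monoid_algebra K G) (pushforward K \<iota>)
    (monoid_algebra_embed K ` S)"
proof -
  interpret K: field K by fact
  let ?A = "monoid_algebra K M" and ?B = "monoid_algebra K G" and ?p = "pushforward K \<iota>"
    and ?e = "monoid_algebra_embed K"
  interpret A: ring ?A by (rule ring_monoid_algebra[OF K.ring_axioms monoid_axioms])
  interpret B: ring ?B by (rule ring_monoid_algebra[OF K.ring_axioms G.monoid_axioms])
  have hom: "?p \<in> ring_hom ?A ?B"
    by (rule K.pushforward_hom[OF monoid_axioms G.monoid_axioms iota_hom iota_one])
  note p_closed = ring_hom_closed[OF hom] and p_add = ring_hom_add[OF hom] and p_mult = ring_hom_mult[OF hom]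
  have e_closed: "?e a \<in> carrier ?A" if "a \<in> carrier M" for a
    unfolding monomial_one[symmetric] using that by (intro K.monomial_closed) auto
  have e_mult: "?e a \<otimes>\<^bsub>?A\<^esub> ?e b = ?e (a \<otimes> b)" for a b
    unfolding monomial_one[symmetric] by (simp add: K.mult_monomial)
  have p_e: "?p (?e a) = ?e (\<iota> a)" for a
    unfolding monomial_one[symmetric] by (simp add: K.pushforward_monomial)
  have comm: "?e s \<otimes>\<^bsub>?A\<^esub> f = f \<otimes>\<^bsub>?A\<^esub> ?e s" if s: "s \<in> S" and f: "f \<in> carrier ?A" for s f
    using f monoid_axioms
  proof (induction rule: K.monoid_algebra_induct)
    case (monomial k m)
    then show ?case
      unfolding monomial_one[symmetric] using s by (simp add: K.mult_monomial S_comm)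
  next
    case (add f g)
    then show ?case using e_closed s by (simp add: A.l_distr A.r_distr)
  qed
  show ?thesis
  proof (intro ring_fractions.intro ring_fractions_axioms.intro A.ring_axioms B.ring_axioms hom)
    show "?e ` S \<subseteq> carrier ?A" using e_closed by auto
    show "\<one>\<^bsub>?A\<^esub> \<in> ?e ` S" unfolding one_monoid_algebra by (rule imageI[OF one_in_S])
    show "c \<otimes>\<^bsub>?A\<^esub> d \<in> ?e ` S" if "c \<in> ?e ` S" "d \<in> ?e ` S" for c d
      using that e_mult by auto
    show "c \<otimes>\<^bsub>?A\<^esub> f = f \<otimes>\<^bsub>?A\<^esub> c" if "c \<in> ?e ` S" "f \<in> carrier ?A" for c f
      using that comm by auto
  next
    fix f assume f: "f \<in> carrier ?A" and zero: "?p f = \<zero>\<^bsub>?B\<^esub>"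
    let ?s = "monoid_algebra_support K f"
    note supp = K.monoid_algebra_support[OF f]
    obtain s where s: "s \<in> S" "\<And>a b. a \<in> ?s \<Longrightarrow> b \<in> ?s \<Longrightarrow> \<iota> a = \<iota> b \<Longrightarrow> a \<otimes> s = b \<otimes> s"
      using uniform_equalizer[OF supp] by blast
    \<comment> \<open>On the support of f, the maps m \<mapsto> m s and \<iota> have the same fibres
      by the choice of s. Each nonempty fibre sum is therefore a coefficient of the vanishing
      \<open>?p f\<close>.\<close>
    have "pushforward K (\<lambda>m. m \<otimes> s) f x = \<zero>\<^bsub>K\<^esub>" for x
    proof (cases "\<exists>a\<in>?s. a \<otimes> s = x")
      case True
      then obtain a where a: "a \<in> ?s" "a \<otimes> s = x" by blast
      have "b \<otimes> s = x \<longleftrightarrow> \<iota> b = \<iota> a" if b: "b \<in> ?s" for b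
      proof
        have car: "a \<in> carrier M" "b \<in> carrier M" using a(1) b supp(2) by auto
        show "\<iota> b = \<iota> a" if "b \<otimes> s = x"
          using iota_eqI[OF car(2,1) S_in_carrier[OF s(1)]] that a(2) by simp
        show "b \<otimes> s = x" if "\<iota> b = \<iota> a" using s(2)[OF b a(1) that] a(2) by simp
      qed
      then have "pushforward K (\<lambda>m. m \<otimes> s) f x = ?p f (\<iota> a)"
        unfolding pushforward_def using K.monoid_algebra_coeff[OF f] by (intro K.finsum_cong') auto
      then show ?thesis using zero by (simp add: zero_monoid_algebra)
    next
      case False
      then show ?thesis unfolding pushforward_def by (intro K.add.finprod_one_eqI) auto
    qed
    then have "f \<otimes>\<^bsub>?A\<^esub> ?e s = \<zero>\<^bsub>?A\<^esub>"
      using K.mult_monomial_one_apply[OF f] by (simp add: monomial_one zero_monoid_algebra fun_eq_iff)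
    then show "\<exists>c\<in>?e ` S. f \<otimes>\<^bsub>?A\<^esub> c = \<zero>\<^bsub>?A\<^esub>" using s(1) by blast
  next
    fix t assume "t \<in> carrier ?B"
    then show "\<exists>f\<in>carrier ?A. \<exists>c\<in>?e ` S. t \<otimes>\<^bsub>?B\<^esub> ?p c = ?p f"
      using G.monoid_axioms
    proof (induction rule: K.monoid_algebra_induct)
      case (monomial k g)
      obtain a s where a: "a \<in> carrier M" "s \<in> S" "g \<otimes>\<^bsub>G\<^esub> \<iota> s = \<iota> a"
        using iota_fractions monomial by blast
      have "monomial K k g \<otimes>\<^bsub>?B\<^esub> ?p (?e s) = ?p (monomial K k a)"
        unfolding p_e monomial_one[symmetric]
        using monomial a by (simp add: K.mult_monomial K.pushforward_monomial)
      moreover have "monomial K k a \<in> carrier ?A" using monomial a by (intro K.monomial_closed)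
      ultimately show ?case using a by blast
    next
      case (add x y)
      then obtain f s g t where f: "f \<in> carrier ?A" "s \<in> S" "x \<otimes>\<^bsub>?B\<^esub> ?p (?e s) = ?p f"
        and g: "g \<in> carrier ?A" "t \<in> S" "y \<otimes>\<^bsub>?B\<^esub> ?p (?e t) = ?p g" by blast
      have st: "?e s \<in> carrier ?A" "?e t \<in> carrier ?A" using f g e_closed by auto
      have pc: "?p (?e t) \<otimes>\<^bsub>?B\<^esub> ?p (?e s) = ?p (?e s) \<otimes>\<^bsub>?B\<^esub> ?p (?e t)"
        using st comm[OF f(2) st(2)] by (simp flip: p_mult)
      have "(x \<oplus>\<^bsub>?B\<^esub> y) \<otimes>\<^bsub>?B\<^esub> ?p (?e s \<otimes>\<^bsub>?A\<^esub> ?e t) =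
          x \<otimes>\<^bsub>?B\<^esub> ?p (?e s) \<otimes>\<^bsub>?B\<^esub> ?p (?e t) \<oplus>\<^bsub>?B\<^esub> y \<otimes>\<^bsub>?B\<^esub> ?p (?e t) \<otimes>\<^bsub>?B\<^esub> ?p (?e s)"
        using add.hyps st by (simp add: p_mult p_closed B.l_distr B.m_assoc pc)
      also have "\<dots> = ?p (f \<otimes>\<^bsub>?A\<^esub> ?e t \<oplus>\<^bsub>?A\<^esub> g \<otimes>\<^bsub>?A\<^esub> ?e s)"
        using f g st by (simp add: p_mult p_add)
      finally show ?case
        using f g st by (intro bexI[of _ "f \<otimes>\<^bsub>?A\<^esub> ?e t \<oplus>\<^bsub>?A\<^esub> g \<otimes>\<^bsub>?A\<^esub> ?e s"]
            bexI[of _ "?e s \<otimes>\<^bsub>?A\<^esub> ?e t"]) (auto simp: e_mult)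
    qed
  next
    fix c assume "c \<in> ?e ` S"
    then obtain s where s: "s \<in> S" "c = ?e s" by blast
    have "?p c \<otimes>\<^bsub>?B\<^esub> ?e (inv\<^bsub>G\<^esub> \<iota> s) = \<one>\<^bsub>?B\<^esub>"
      unfolding s(2) p_e one_monoid_algebra
      unfolding monomial_one[symmetric] using s(1) by (simp add: K.mult_monomial)
    moreover have "?e (inv\<^bsub>G\<^esub> \<iota> s) \<in> carrier ?B"
      unfolding monomial_one[symmetric] using s(1) by (intro K.monomial_closed) auto
    ultimately show "\<exists>u\<in>carrier ?B. ?p c \<otimes>\<^bsub>?B\<^esub> u = \<one>\<^bsub>?B\<^esub>" by blast
  qed
qed

text \<open>Every a in \<open>M\<close> divides an element of \<open>S\<close>, so an ideal
  containing a already meets \<open>S\<close>.\<close>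

lemma disjoint_embed_iff:
  assumes "field K" "ideal P (monoid_algebra K M)"
  shows "P \<inter> monoid_algebra_embed K ` carrier M = {} \<longleftrightarrow> P \<inter> monoid_algebra_embed K ` S = {}"
proof
  interpret K: field K by fact
  interpret P: ideal P "monoid_algebra K M" by fact
  assume disj: "P \<inter> monoid_algebra_embed K ` S = {}"
  have "monoid_algebra_embed K a \<notin> P" if a: "a \<in> carrier M" for a
  proof
    assume "monoid_algebra_embed K a \<in> P"
    obtain b where b: "b \<in> carrier M" "a \<otimes> b \<in> S" using divides_S a by blast
    have "monoid_algebra_embed K b \<in> carrier (monoid_algebra K M)"
      unfolding monomial_one[symmetric] using b by (intro K.monomial_closed) auto
    from P.I_r_closed[OF \<open>monoid_algebra_embed K a \<in> P\<close> this]
    have "monoid_algebra_embed K (a \<otimes> b) \<in> P"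
      unfolding monomial_one[symmetric] by (simp add: K.mult_monomial)
    then show False using disj b by blast
  qed
  then show "P \<inter> monoid_algebra_embed K ` carrier M = {}" by blast
next
  assume "P \<inter> monoid_algebra_embed K ` carrier M = {}"
  then show "P \<inter> monoid_algebra_embed K ` S = {}" using S_in_carrier by blast
qed

lemma prime_ideal_correspondence:
  assumes "field K"
  shows "\<exists>\<phi>. bij_betw \<phi>
      {P. prime_ideal (monoid_algebra K M) P \<and> P \<inter> monoid_algebra_embed K ` carrier M = {}}
      {Q. prime_ideal (monoid_algebra K G) Q} \<and>
    (\<forall>P P'. prime_ideal (monoid_algebra K M) P \<longrightarrow> P \<inter> monoid_algebra_embed K ` carrier M = {} \<longrightarrow>
      prime_ideal (monoid_algebra K M) P' \<longrightarrow> P' \<inter> monoid_algebra_embed K ` carrier M = {} \<longrightarrow>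
      (P \<subseteq> P' \<longleftrightarrow> \<phi> P \<subseteq> \<phi> P'))"
proof -
  interpret F: ring_fractions "monoid_algebra K M" "monoid_algebra K G" "pushforward K \<iota>"
    "monoid_algebra_embed K ` S"
    by (rule ring_fractions_monoid_algebra[OF assms])
  have disj: "P \<inter> monoid_algebra_embed K ` carrier M = {} \<longleftrightarrow> P \<inter> monoid_algebra_embed K ` S = {}"
    if "prime_ideal (monoid_algebra K M) P" for P
    by (rule disjoint_embed_iff[OF assms prime_idealD(1)[OF that F.R.ring_axioms]])
  have "{P. prime_ideal (monoid_algebra K M) P \<and> P \<inter> monoid_algebra_embed K ` carrier M = {}} =
      {P. prime_ideal (monoid_algebra K M) P \<and> P \<inter> monoid_algebra_embed K ` S = {}}"
    by (intro Collect_cong conj_cong refl disj)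
  then show ?thesis
    using F.extension_bij F.extension_subset_iff
    by (intro exI[of _ F.extension] conjI allI impI) (simp_all only: disj)
qed

end

theorem proposition5p6:
  fixes X :: "'x set" and r :: "'x \<times> 'x \<Rightarrow> 'x \<times> 'x" and K :: "('k, 'c) ring_scheme"
  assumes "ybe_solution X r"
    and "finite X"
    and "ybe_bijective X r"
    and "ybe_left_nondegenerate X r"
    and "field K"
  shows "let M = structure_monoid X r;
             G = structure_group X r;
             \<eta> = cancellative_congruence M;
             M' = quotient_monoid M \<eta>
         in
           (\<exists>\<phi>. bij_betw \<phi>
                  {P. prime_ideal (monoid_algebra K M) P \<and>
                      P \<inter> monoid_algebra_embed K ` carrier M = {}}
                  {Q. prime_ideal (monoid_algebra K G) Q} \<and>
                (\<forall>P P'. prime_ideal (monoid_algebra K M) P \<longrightarrow>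
                        P \<inter> monoid_algebra_embed K ` carrier M = {} \<longrightarrow>
                        prime_ideal (monoid_algebra K M) P' \<longrightarrow>
                        P' \<inter> monoid_algebra_embed K ` carrier M = {} \<longrightarrow>
                        (P \<subseteq> P' \<longleftrightarrow> \<phi> P \<subseteq> \<phi> P'))) \<and>
           congruence M \<eta> \<and> cancellative M' \<and>
           (\<exists>z\<in>monoid_center M'.
              is_group_of_quotients M' (central_localization M' (powers_of M' z))
                (localization_map M' (powers_of M' z)) \<and>
              G \<cong> central_localization M' (powers_of M' z))"
proof -
  interpret finite_bijective_lnd_solution X r
    by (intro finite_bijective_lnd_solution.intro finite_bijective_lnd_solution_axioms.intro assms)
  obtain z \<iota> where z: "z \<in> monoid_center SM"
    and fractions: "monoid_fractions SM (powers_of SM z) SG \<iota>" by (rule ex_monoid_fractions)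
  interpret F: monoid_fractions SM "powers_of SM z" SG \<iota> by (rule fractions)
  have zM: "z \<in> carrier SM" using z by (simp add: monoid_center_def)
  \<comment> \<open>\<open>z\<close> must be recognized as one of its own powers, since
    \<open>cls_center\<close> speaks about elements of the denominator set.\<close>
  have "z [^]\<^bsub>SM\<^esub> (1 :: nat) \<in> powers_of SM z" unfolding powers_of_def by (rule rangeI)
  then have "F.cls z \<in> monoid_center F.M'" using zM by (intro F.cls_center) simp
  moreover note F.group_of_quotients_M' F.iso_localization_M'
  ultimately show ?thesis
    unfolding Let_def
    using F.prime_ideal_correspondence[OF assms(5)] F.congruence_eta F.cancellative_M'
    by (intro conjI bexI[of _ "F.cls z"]) (simp_all only: F.powers_of_cls[OF zM])
qed

end
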